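(* Let $\mathbb{SIM}(2)$ be the similitude group and $\widehat{\mathbb{SIM}(2)}=\{\pi\}$. For every $p$ with $2<p<\infty$ there exists an operator-valued function $\sigma\in L^p(\mathbb{SIM}(2)\times\widehat{\mathbb{SIM}(2)},S_p)$ such that the Weyl transform $W_\sigma$ is not a bounded linear operator on $L^2(\mathbb{SIM}(2))$.
   Context: Similitude group: $G=\mathbb{SIM}(2)=\{(b,a,\theta): b\in\mathbb R^2,\ a>0,\ \theta\in[0,2\pi)\}$ with product $(b,a,\theta)*(b',a',\theta')=(b+aR_\theta b',aa',\theta+\theta')$ (angles modulo $2\pi$), where $R_\theta=\begin{pmatrix}\cos\theta&-\sin\theta\\ \sin\theta&\cos\theta\end{pmatrix}$. Left Haar measure: $d\mu=d\mu_L(b,a,\theta)=\frac{db\,da\,d\theta}{a^3}$; $L^2(G)=L^2(G,\mu)$. The irreducible unitary representation $\pi$ of $G$ on $L^2(\mathbb R^2)$ is $(\pi(b,a,\theta)\phi)(x)=a\,e^{-ib\cdot x}\phi(aR_{-\theta}x)$, and $\widehat G=\{\pi\}$. The Duflo-Moore operator is the unbounded positive operator $(K_\pi\phi)(x)=\|x\|_2^2\,\phi(x)$ on $L^2(\mathbb R^2)$; $K_\pi^{r}$ is multiplication by $\|x\|_2^{2r}$. $S_r$ denotes the $r$-Schatten class on $L^2(\mathbb R^2)$, $\|A\|_{S_r}^r=\operatorname{Tr}(A^*A)^{r/2}$, with $\|A\|_{S_r}=\infty$ if $A$ does not extend to an element of $S_r$. For $1\le p<\infty$, $L^p(G\times\widehat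 G,S_p)$ is the set of measurable operator-valued functions $\sigma$ ($\sigma(x,\pi)$ an operator on $L^2(\mathbb R^2)$) such that $$\|\sigma\|_{p,\mu}^p=\int_G\|\sigma(x,\pi)K_\pi^{1/p}\|_{S_p}^p\,d\mu(x)<\infty .$$ Wigner transform: $W(f,g)(x,\pi)=\int_G f(x')\,g(x'^{-1}x)\,\pi(x')\,d\mu(x')$ for $f,g\in C_c(G)$, extended to $f,g\in L^2(G)$ by continuity, using $\|W(f,g)\|_{2,\mu}\le\|f\|_{L^2(G)}\|g\|_{L^2(G)}$. Weyl transform: for a symbol $\sigma\in L^p(G\times\widehat G,S_p)$, $W_\sigma$ is defined by $$\langle W_\sigma f,\overline g\rangle=\langle W(f,g),\sigma\rangle_\mu=\int_G\operatorname{Tr}\big(\sigma(x,\pi)^*W(f,g)(x,\pi)K_\pi\big)\,d\mu(x),\qquad f,g\in L^2(G),$$ where the trace is understood as $\operatorname{Tr}\big((\sigma K_\pi^{1/p})^*\,(W(f,g)K_\pi^{1/p'})\big)$, $\frac1p+\frac1{p'}=1$. For $p>2$, "$W_\sigma$ is a bounded linear operator on $L^2(G)$" means that the right-hand side is well defined for all $f,g\in L^2(G)$ and there is a constant $C(\sigma)$ with $|\langle W(f,g),\sigma\rangle_\mu|\le C(\sigma)\|f\|_{L^2(G)}\|g\|_{L^2(G)}$ for all $f,g\in L^2(G)$. *)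

theory Defs
  imports
    "HOL-Analysis.Analysis"
    "HOL-Algebra.Group"
    "HOL-Computational_Algebra.Polynomial"
    "HOL-Library.Real_Mod"
begin

definition square_integrable :: "'a measure \<Rightarrow> ('a \<Rightarrow> complex) \<Rightarrow> bool" where
  "square_integrable M f \<longleftrightarrow> f \<in> borel_measurable M \<and> integrable M (\<lambda>x. (cmod (f x))\<^sup>2)"

definition L2_norm :: "'a measure \<Rightarrow> ('a \<Rightarrow> complex) \<Rightarrow> real" where
  "L2_norm M f = sqrt (\<integral>x. (cmod (f x))\<^sup>2 \<partial>M)"

lemma square_integrable_0: "square_integrable M (\<lambda>_. 0)"
  by (simp add: square_integrable_def)

lemma square_integrable_cmult:
  assumes "square_integrable M f"
  shows "square_integrable M (\<lambda>x. c * f x)"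
  using assms by (auto simp: square_integrable_def norm_mult power_mult_distrib)

lemma square_integrable_add:
  assumes f: "square_integrable M f" and g: "square_integrable M g"
  shows "square_integrable M (\<lambda>x. f x + g x)"
proof -
  have bound: "(cmod (a + b))\<^sup>2 \<le> 2 * (cmod a)\<^sup>2 + 2 * (cmod b)\<^sup>2" for a b
  proof -
    have "(cmod (a + b))\<^sup>2 \<le> (cmod a + cmod b)\<^sup>2"
      by (intro power_mono norm_triangle_ineq norm_ge_zero)
    also have "\<dots> \<le> 2 * (cmod a)\<^sup>2 + 2 * (cmod b)\<^sup>2"
      using sum_squares_bound[of "cmod a" "cmod b"] by (simp add: power2_sum)
    finally show ?thesis .
  qed
  have "integrable M (\<lambda>x. 2 * (cmod (f x))\<^sup>2 + 2 * (cmod (g x))\<^sup>2)"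
    using f g by (simp add: square_integrable_def)
  then have "integrable M (\<lambda>x. (cmod (f x + g x))\<^sup>2)"
    by (rule Bochner_Integration.integrable_bound)
       (use f g bound in \<open>auto simp: square_integrable_def\<close>)
  then show ?thesis
    using f g by (auto simp: square_integrable_def)
qed

lemma borel_measurable_cnj [measurable (raw)]:
  assumes "f \<in> borel_measurable M"
  shows "(\<lambda>x. cnj (f x)) \<in> borel_measurable M"
  by (rule measurable_compose[OF assms borel_measurable_continuous_onI])
     (intro continuous_intros)

lemma square_integrable_mult_cnj:
  assumes f: "square_integrable M f" and g: "square_integrable M g"
  shows "integrable M (\<lambda>x. f x * cnj (g x))"
proof -
  have "integrable M (\<lambda>x. (cmod (f x))\<^sup>2 + (cmod (g x))\<^sup>2)"
    using f g by (simp add: square_integrable_def)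
  moreover have "cmod a * cmod b \<le> (cmod a)\<^sup>2 + (cmod b)\<^sup>2" for a b
    using sum_squares_bound[of "cmod a" "cmod b"] mult_nonneg_nonneg[OF norm_ge_zero norm_ge_zero, of a b]
    by linarith
  ultimately show ?thesis
    using f g
    by (elim Bochner_Integration.integrable_bound) (auto simp: square_integrable_def norm_mult)
qed

definition ae_rel :: "(real^2 \<Rightarrow> complex) \<Rightarrow> (real^2 \<Rightarrow> complex) \<Rightarrow> bool" where
  "ae_rel f g \<longleftrightarrow> square_integrable lborel f \<and> square_integrable lborel g \<and>
     (AE x in lborel. f x = g x)"

text \<open>The Hilbert space $L^2(\mathbb{R}^2)$ of square-integrable functions modulo equality
  almost everywhere.\<close>

quotient_type l2 = "real^2 \<Rightarrow> complex" / partial: ae_rel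
proof (rule part_equivpI)
  show "\<exists>f. ae_rel f f"
    by (rule exI[of _ "\<lambda>_. 0"]) (simp add: ae_rel_def square_integrable_0)
  show "symp ae_rel"
    by (auto simp: symp_def ae_rel_def)
  show "transp ae_rel"
    by (auto simp: transp_def ae_rel_def)
qed

lift_definition cinner :: "l2 \<Rightarrow> l2 \<Rightarrow> complex" is
  "\<lambda>f g. \<integral>x. f x * cnj (g x) \<partial>lborel"
  by (intro integral_cong_AE)
     (auto simp: ae_rel_def square_integrable_def intro!: borel_measurable_times borel_measurable_cnj)

lift_definition cscale :: "complex \<Rightarrow> l2 \<Rightarrow> l2" is "\<lambda>c f x. c * f x"
  by (auto simp: ae_rel_def square_integrable_cmult)

instantiation l2 :: real_inner
begin

lift_definition zero_l2 :: l2 is "\<lambda>_. 0"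
  by (simp add: ae_rel_def square_integrable_0)

lift_definition plus_l2 :: "l2 \<Rightarrow> l2 \<Rightarrow> l2" is "\<lambda>f g x. f x + g x"
  by (auto simp: ae_rel_def square_integrable_add)

definition uminus_l2 :: "l2 \<Rightarrow> l2" where "- \<phi> = cscale (- 1) \<phi>"
definition minus_l2 :: "l2 \<Rightarrow> l2 \<Rightarrow> l2" where "\<phi> - \<psi> = \<phi> + - (\<psi> :: l2)"
definition scaleR_l2 :: "real \<Rightarrow> l2 \<Rightarrow> l2" where "r *\<^sub>R \<phi> = cscale (of_real r) \<phi>"
definition inner_l2 :: "l2 \<Rightarrow> l2 \<Rightarrow> real" where "\<phi> \<bullet> \<psi> = Re (cinner \<phi> \<psi>)"
definition norm_l2 :: "l2 \<Rightarrow> real" where "norm \<phi> = sqrt (\<phi> \<bullet> (\<phi> :: l2))"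
definition dist_l2 :: "l2 \<Rightarrow> l2 \<Rightarrow> real" where "dist \<phi> \<psi> = norm (\<phi> - \<psi> :: l2)"
definition sgn_l2 :: "l2 \<Rightarrow> l2" where "sgn \<phi> = inverse (norm \<phi>) *\<^sub>R (\<phi> :: l2)"
definition uniformity_l2 :: "(l2 \<times> l2) filter" where
  "uniformity = (INF e\<in>{0<..}. principal {(x :: l2, y). dist x y < e})"
definition open_l2 :: "l2 set \<Rightarrow> bool" where
  "open U \<longleftrightarrow> (\<forall>x\<in>U. eventually (\<lambda>(x', y :: l2). x' = x \<longrightarrow> y \<in> U) uniformity)"

instance
proof
  fix \<phi> \<psi> \<rho> :: l2 and r s :: real
  note eqI = ae_rel_def square_integrable_add square_integrable_cmult square_integrable_0
  show "\<phi> + \<psi> + \<rho> = \<phi> + (\<psi> + \<rho>)"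
    by transfer (auto simp: eqI add.assoc)
  show "\<phi> + \<psi> = \<psi> + \<phi>"
    by transfer (auto simp: eqI add.commute)
  show "0 + \<phi> = \<phi>"
    by transfer (auto simp: eqI)
  show "- \<phi> + \<phi> = 0"
    unfolding uminus_l2_def by transfer
      (auto simp: eqI intro!: square_integrable_add square_integrable_cmult[where c = "-1", simplified])
  show "\<phi> - \<psi> = \<phi> + - \<psi>"
    by (fact minus_l2_def)
  show "r *\<^sub>R (\<phi> + \<psi>) = r *\<^sub>R \<phi> + r *\<^sub>R \<psi>"
    unfolding scaleR_l2_def by transfer (auto simp: eqI distrib_left)
  show "(r + s) *\<^sub>R \<phi> = r *\<^sub>R \<phi> + s *\<^sub>R \<phi>"
    unfolding scaleR_l2_def by transfer (auto simp: eqI distrib_right)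
  show "r *\<^sub>R s *\<^sub>R \<phi> = (r * s) *\<^sub>R \<phi>"
    unfolding scaleR_l2_def by transfer (auto simp: eqI mult.assoc)
  show "1 *\<^sub>R \<phi> = \<phi>"
    unfolding scaleR_l2_def by transfer (auto simp: eqI)
  show "sgn \<phi> = inverse (norm \<phi>) *\<^sub>R \<phi>"
    by (fact sgn_l2_def)
  show "dist \<phi> \<psi> = norm (\<phi> - \<psi>)"
    by (fact dist_l2_def)
  show "(uniformity :: (l2 \<times> l2) filter) = (INF e\<in>{0<..}. principal {(x, y). dist x y < e})"
    by (fact uniformity_l2_def)
  show "open U \<longleftrightarrow> (\<forall>x\<in>U. eventually (\<lambda>(x', y). x' = x \<longrightarrow> y \<in> U) uniformity)" for U :: "l2 set"
    by (fact open_l2_def)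
  show "\<phi> \<bullet> \<psi> = \<psi> \<bullet> \<phi>"
    unfolding inner_l2_def
  proof transfer
    fix f g :: "real^2 \<Rightarrow> complex"
    have "(\<integral>x. f x * cnj (g x) \<partial>lborel) = (\<integral>x. cnj (g x * cnj (f x)) \<partial>lborel)"
      by (simp add: mult.commute)
    also have "\<dots> = cnj (\<integral>x. g x * cnj (f x) \<partial>lborel)"
      by (rule Bochner_Integration.integral_cnj)
    finally show "Re (\<integral>x. f x * cnj (g x) \<partial>lborel) = Re (\<integral>x. g x * cnj (f x) \<partial>lborel)"
      by simp
  qed
  show "(\<phi> + \<psi>) \<bullet> \<rho> = \<phi> \<bullet> \<rho> + \<psi> \<bullet> \<rho>"
    unfolding inner_l2_def
    by transfer (auto simp: ae_rel_def distrib_right square_integrable_mult_cnj)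
  show "(r *\<^sub>R \<phi>) \<bullet> \<psi> = r * (\<phi> \<bullet> \<psi>)"
    unfolding inner_l2_def scaleR_l2_def
    by transfer (auto simp: mult.assoc)
  have Re_self: "Re (\<integral>x. f x * cnj (f x) \<partial>lborel) = (\<integral>x. (cmod (f x))\<^sup>2 \<partial>lborel)"
    for f :: "real^2 \<Rightarrow> complex"
  proof -
    have "(\<lambda>x. f x * cnj (f x)) = (\<lambda>x. complex_of_real ((cmod (f x))\<^sup>2))"
      by (simp only: complex_norm_square)
    then show ?thesis by (simp only: integral_complex_of_real Re_complex_of_real)
  qed
  show "0 \<le> \<phi> \<bullet> \<phi>"
    unfolding inner_l2_def by transfer (simp add: Re_self)
  show "\<phi> \<bullet> \<phi> = 0 \<longleftrightarrow> \<phi> = 0"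
    unfolding inner_l2_def
  proof transfer
    fix f :: "real^2 \<Rightarrow> complex"
    assume "ae_rel f f"
    then have f: "square_integrable lborel f" by (simp add: ae_rel_def)
    then have "(\<integral>x. (cmod (f x))\<^sup>2 \<partial>lborel) = 0 \<longleftrightarrow> (AE x in lborel. (cmod (f x))\<^sup>2 = 0)"
      by (intro integral_nonneg_eq_0_iff_AE) (auto simp: square_integrable_def)
    then show "Re (\<integral>x. f x * cnj (f x) \<partial>lborel) = 0 \<longleftrightarrow> ae_rel f (\<lambda>_. 0)"
      using f by (simp add: Re_self ae_rel_def square_integrable_0)
  qed
  show "norm \<phi> = sqrt (\<phi> \<bullet> \<phi>)"
    by (fact norm_l2_def)
qed

end

definition bounded_clinear :: "(l2 \<Rightarrow> l2) \<Rightarrow> bool" where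
  "bounded_clinear T \<longleftrightarrow> bounded_linear T \<and> (\<forall>c \<phi>. T (cscale c \<phi>) = cscale c (T \<phi>))"

definition cadjoint :: "(l2 \<Rightarrow> l2) \<Rightarrow> l2 \<Rightarrow> l2" where
  "cadjoint T = (THE S. \<forall>\<phi> \<psi>. cinner (T \<phi>) \<psi> = cinner \<phi> (S \<psi>))"

definition orthonormal_basis :: "l2 set \<Rightarrow> bool" where
  "orthonormal_basis B \<longleftrightarrow>
     (\<forall>e\<in>B. \<forall>e'\<in>B. cinner e e' = (if e = e' then 1 else 0)) \<and>
     (\<forall>\<phi>. (\<forall>e\<in>B. cinner \<phi> e = 0) \<longrightarrow> \<phi> = 0)"

text \<open>Traces are computed in a fixed basis; for positive and for trace class operators they do not
  depend on it.\<close>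

definition onb :: "l2 set" where
  "onb = (SOME B. orthonormal_basis B)"

definition op_trace :: "(l2 \<Rightarrow> l2) \<Rightarrow> complex" where
  "op_trace T = (\<Sum>\<^sub>\<infinity>e\<in>onb. cinner (T e) e)"

definition positive_trace :: "(l2 \<Rightarrow> l2) \<Rightarrow> ennreal" where
  "positive_trace P = (\<Sum>\<^sub>\<infinity>e\<in>onb. ennreal (Re (cinner (P e) e)))"

definition poly_op :: "real poly \<Rightarrow> (l2 \<Rightarrow> l2) \<Rightarrow> l2 \<Rightarrow> l2" where
  "poly_op q P \<phi> = (\<Sum>i\<le>degree q. coeff q i *\<^sub>R (P ^^ i) \<phi>)"

text \<open>Continuous functional calculus: for a bounded positive operator $P$, whose spectrum lies in
  $[0, \|P\|]$, and $s > 0$, the power $P^s$ is the norm limit of $q_n(P)$ for polynomials $q_n$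
  converging to $t \mapsto t^s$ uniformly on $[0, \|P\|]$.\<close>

definition positive_power :: "real \<Rightarrow> (l2 \<Rightarrow> l2) \<Rightarrow> l2 \<Rightarrow> l2" where
  "positive_power s P = (THE Q. bounded_clinear Q \<and>
     (\<forall>q :: nat \<Rightarrow> real poly.
        uniform_limit {0..onorm P} (\<lambda>n t. poly (q n) t) (\<lambda>t. t powr s) sequentially \<longrightarrow>
        (\<lambda>n. onorm (\<lambda>\<phi>. poly_op (q n) P \<phi> - Q \<phi>)) \<longlonglongrightarrow> 0))"

text \<open>Possibly unbounded, partially defined operators on $L^2(\mathbb{R}^2)$ are partial maps:
  \<^const>\<open>map_comp\<close> is the product of operators on its natural domain, and \<^const>\<open>map_le\<close> says that
  the second operator extends the first.\<close>

type_synonym op = "l2 \<rightharpoonup> l2"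

definition linear_op :: "op \<Rightarrow> bool" where
  "linear_op A \<longleftrightarrow> A 0 = Some 0 \<and>
     (\<forall>\<phi> \<psi> \<phi>' \<psi>'. A \<phi> = Some \<phi>' \<longrightarrow> A \<psi> = Some \<psi>' \<longrightarrow> A (\<phi> + \<psi>) = Some (\<phi>' + \<psi>')) \<and>
     (\<forall>c \<phi> \<phi>'. A \<phi> = Some \<phi>' \<longrightarrow> A (cscale c \<phi>) = Some (cscale c \<phi>'))"

definition total_op :: "(l2 \<Rightarrow> l2) \<Rightarrow> op" where
  "total_op B = (\<lambda>\<phi>. Some (B \<phi>))"

definition op_diff :: "op \<Rightarrow> op \<Rightarrow> op" where
  "op_diff A B = (\<lambda>\<phi>. case (A \<phi>, B \<phi>) of
     (Some \<phi>', Some \<phi>'') \<Rightarrow> Some (\<phi>' - \<phi>'') | _ \<Rightarrow> None)"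

text \<open>Density of the domain makes the bounded extension unique.\<close>

definition bounded_extension :: "op \<Rightarrow> (l2 \<Rightarrow> l2) \<Rightarrow> bool" where
  "bounded_extension A B \<longleftrightarrow>
     closure (dom A) = UNIV \<and> bounded_clinear B \<and> A \<subseteq>\<^sub>m total_op B"

definition bext :: "op \<Rightarrow> l2 \<Rightarrow> l2" where
  "bext A = (THE B. bounded_extension A B)"

text \<open>$\|A\|_{S_r}^r = \mathrm{Tr}\,(A^*A)^{r/2}$ for the bounded extension of $A$, and $\infty$ if
  there is none.\<close>

definition schatten_pow :: "real \<Rightarrow> op \<Rightarrow> ennreal" where
  "schatten_pow r A =
     (if \<exists>B. bounded_extension A B
      then positive_trace (positive_power (r / 2) (cadjoint (bext A) \<circ> bext A))
      else \<infinity>)"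

type_synonym sim2 = "(real^2) \<times> real \<times> real"

definition rot :: "real \<Rightarrow> real^2^2" where
  "rot \<theta> = vector [vector [cos \<theta>, - sin \<theta>], vector [sin \<theta>, cos \<theta>]]"

definition SIM2 :: "sim2 monoid" where
  "SIM2 = \<lparr>carrier = {(b, a, \<theta>). 0 < a \<and> 0 \<le> \<theta> \<and> \<theta> < 2 * pi},
     mult = (\<lambda>(b, a, \<theta>) (b', a', \<theta>'). (b + a *\<^sub>R (rot \<theta> *v b'), a * a', (\<theta> + \<theta>') rmod (2 * pi))),
     one = (0, 1, 0)\<rparr>"

lemma rot_0: "rot 0 = mat 1"
  by (simp add: rot_def mat_def vec_eq_iff forall_2)

lemma rot_mult: "rot \<theta> *v (rot \<theta>' *v b) = rot (\<theta> + \<theta>') *v b"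
  by (simp add: rot_def vec_eq_iff forall_2 matrix_vector_mult_def sum_2 cos_add sin_add algebra_simps)

lemma rot_rmod: "rot (\<theta> rmod (2 * pi)) = rot \<theta>"
proof -
  have "\<theta> rmod (2 * pi) = \<theta> - of_int \<lfloor>\<theta> / (2 * pi)\<rfloor> * (2 * pi)"
    by (simp add: rmod_def)
  moreover have "cos (\<theta> - of_int n * (2 * pi)) = cos \<theta>" "sin (\<theta> - of_int n * (2 * pi)) = sin \<theta>" for n
    using sin_int_2pin[of n] cos_int_2pin[of n] by (simp_all add: cos_diff sin_diff mult.commute)
  ultimately show ?thesis
    by (simp add: rot_def)
qed

lemma rmod_add_left: "(x rmod z + y) rmod z = (x + y) rmod z"
  using rmod_add[of "x rmod z" z y] rmod_add[of x z y] by simp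

lemma rmod_add_right: "(x + y rmod z) rmod z = (x + y) rmod z"
  using rmod_add_left[of y z x] by (simp add: add.commute)

lemma group_SIM2: "group SIM2"
proof (rule groupI)
  show "\<one>\<^bsub>SIM2\<^esub> \<in> carrier SIM2"
    by (simp add: SIM2_def)
next
  fix x y assume "x \<in> carrier SIM2" "y \<in> carrier SIM2"
  then show "x \<otimes>\<^bsub>SIM2\<^esub> y \<in> carrier SIM2"
    by (auto simp: SIM2_def rmod_nonneg rmod_less)
next
  fix x y z assume "x \<in> carrier SIM2" "y \<in> carrier SIM2" "z \<in> carrier SIM2"
  then show "x \<otimes>\<^bsub>SIM2\<^esub> y \<otimes>\<^bsub>SIM2\<^esub> z = x \<otimes>\<^bsub>SIM2\<^esub> (y \<otimes>\<^bsub>SIM2\<^esub> z)"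
    by (auto simp: SIM2_def rot_rmod rot_mult matrix_vector_right_distrib scaleR_right_distrib
        matrix_vector_mult_scaleR add.assoc
        rmod_add_left rmod_add_right)
next
  fix x assume "x \<in> carrier SIM2"
  then show "\<one>\<^bsub>SIM2\<^esub> \<otimes>\<^bsub>SIM2\<^esub> x = x"
    by (auto simp: SIM2_def rot_0 intro!: rmod_idem)
next
  fix x assume "x \<in> carrier SIM2"
  then obtain b a \<theta> where x: "x = (b, a, \<theta>)" "0 < a" "0 \<le> \<theta>" "\<theta> < 2 * pi"
    by (auto simp: SIM2_def)
  let ?y = "(- (inverse a *\<^sub>R (rot (- \<theta>) *v b)), inverse a, (- \<theta>) rmod (2 * pi))"
  have "?y \<in> carrier SIM2" "?y \<otimes>\<^bsub>SIM2\<^esub> x = \<one>\<^bsub>SIM2\<^esub>"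
    using x by (auto simp: SIM2_def rot_rmod rmod_add_left rmod_nonneg rmod_less)
  then show "\<exists>y\<in>carrier SIM2. y \<otimes>\<^bsub>SIM2\<^esub> x = \<one>\<^bsub>SIM2\<^esub>" ..
qed

text \<open>The left Haar measure $a^{-3}\,db\,da\,d\theta$.\<close>

definition haar :: "sim2 measure" where
  "haar = density (restrict_space lborel (carrier SIM2)) (\<lambda>(b, a, \<theta>). ennreal (1 / a ^ 3))"

definition L2_SIM2 :: "(sim2 \<Rightarrow> complex) set" where
  "L2_SIM2 = {f. square_integrable haar f}"

text \<open>Continuity on $\mathbb{R}^2 \times (0,\infty) \times \mathbb{R}/2\pi\mathbb{Z}$ is continuity of
  the $2\pi$-periodic extension in the angle.  The angle ranges over a compact circle, so compact
  support only restricts $(b, a)$.\<close>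

definition Cc_SIM2 :: "(sim2 \<Rightarrow> complex) set" where
  "Cc_SIM2 = {f.
     continuous_on (UNIV \<times> {0<..} \<times> UNIV) (\<lambda>(b, a, t). f (b, a, t rmod (2 * pi))) \<and>
     (\<exists>S. compact S \<and> S \<subseteq> UNIV \<times> {0<..} \<and>
        (\<forall>(b, a, \<theta>)\<in>carrier SIM2. (b, a) \<notin> S \<longrightarrow> f (b, a, \<theta>) = 0))}"

definition irrep :: "sim2 \<Rightarrow> l2 \<Rightarrow> l2" where
  "irrep = (\<lambda>(b, a, \<theta>) \<phi>.
     abs_l2 (\<lambda>x. of_real a * cis (- (b \<bullet> x)) * rep_l2 \<phi> (a *\<^sub>R (rot (- \<theta>) *v x))))"

text \<open>\<^term>\<open>K_power r\<close> is $K_\pi^r$, multiplication by $\|x\|_2^{2r}$ on its maximal domain.\<close>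

definition K_power :: "real \<Rightarrow> op" where
  "K_power r \<phi> =
     (let \<psi> = (\<lambda>x. of_real (norm x powr (2 * r)) * rep_l2 \<phi> x)
      in if square_integrable lborel \<psi> then Some (abs_l2 \<psi>) else None)"

text \<open>Since the dual is the single point $\pi$, a symbol is a function of the group variable alone.
  \<^term>\<open>symbol_norm_pow p \<sigma>\<close> is $\|\sigma\|_{p,\mu}^p$.  Measurability of $\sigma$ is weak measurability
  of the field of bounded operators $\sigma(x,\pi) K_\pi^{1/p}$.\<close>

definition symbol_norm_pow :: "real \<Rightarrow> (sim2 \<Rightarrow> op) \<Rightarrow> ennreal" where
  "symbol_norm_pow p \<sigma> = (\<integral>\<^sup>+x. schatten_pow p (\<sigma> x \<circ>\<^sub>m K_power (1 / p)) \<partial>haar)"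

definition measurable_symbol :: "real \<Rightarrow> (sim2 \<Rightarrow> op) \<Rightarrow> bool" where
  "measurable_symbol p \<sigma> \<longleftrightarrow>
     (\<exists>B. (AE x in haar. bounded_extension (\<sigma> x \<circ>\<^sub>m K_power (1 / p)) (B x)) \<and>
          (\<forall>\<phi> \<psi>. (\<lambda>x. cinner (B x \<phi>) \<psi>) \<in> borel_measurable haar))"

definition Lp_symbols :: "real \<Rightarrow> (sim2 \<Rightarrow> op) set" where
  "Lp_symbols p = {\<sigma>. (\<forall>x\<in>carrier SIM2. linear_op (\<sigma> x)) \<and>
     measurable_symbol p \<sigma> \<and> symbol_norm_pow p \<sigma> < \<infinity>}"

text \<open>The operator-valued integral defining $W(f,g)(x,\pi)$ for $f, g \in C_c(G)$ is understood
  weakly.\<close>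

definition wigner_Cc :: "(sim2 \<Rightarrow> complex) \<Rightarrow> (sim2 \<Rightarrow> complex) \<Rightarrow> sim2 \<Rightarrow> l2 \<Rightarrow> l2" where
  "wigner_Cc f g x = (THE T. bounded_clinear T \<and>
     (\<forall>\<phi> \<psi>. cinner (T \<phi>) \<psi> =
        (\<integral>x'. f x' * g (inv\<^bsub>SIM2\<^esub> x' \<otimes>\<^bsub>SIM2\<^esub> x) * cinner (irrep x' \<phi>) \<psi> \<partial>haar)))"

text \<open>The extension by continuity of the Wigner transform to $f, g \in L^2(G)$.  Its value is an
  element of $L^2(G \times \widehat{G}, S_2)$, i.e. a class of symbols agreeing almost everywhere;
  \<^term>\<open>wigner f g\<close> is that class.  Such a symbol is determined by $\Omega(x,\pi) K_\pi^{1/2}$, that is,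
  on the range of $K_\pi^{1/2}$, which is the domain of $K_\pi^{-1/2}$; this is taken as the domain of
  every $\Omega(x,\pi)$.\<close>

definition wigner :: "(sim2 \<Rightarrow> complex) \<Rightarrow> (sim2 \<Rightarrow> complex) \<Rightarrow> (sim2 \<Rightarrow> op) set" where
  "wigner f g = {\<Omega> \<in> Lp_symbols 2.
     (\<forall>x\<in>carrier SIM2. dom (\<Omega> x) = dom (K_power (- 1 / 2))) \<and>
     (\<exists>F H :: nat \<Rightarrow> sim2 \<Rightarrow> complex.
        (\<forall>n. F n \<in> Cc_SIM2 \<and> H n \<in> Cc_SIM2) \<and>
        (\<lambda>n. L2_norm haar (\<lambda>x. F n x - f x)) \<longlonglongrightarrow> 0 \<and>
        (\<lambda>n. L2_norm haar (\<lambda>x. H n x - g x)) \<longlonglongrightarrow> 0 \<and>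
        (\<lambda>n. symbol_norm_pow 2 (\<lambda>x. op_diff (total_op (wigner_Cc (F n) (H n) x)) (\<Omega> x)))
          \<longlonglongrightarrow> 0)}"

text \<open>The operator $(\sigma K_\pi^{1/p})^* (\Omega K_\pi^{1/p'})$ at $x$, where $1/p' = 1 - 1/p$.\<close>

definition weyl_integrand :: "real \<Rightarrow> (sim2 \<Rightarrow> op) \<Rightarrow> (sim2 \<Rightarrow> op) \<Rightarrow> sim2 \<Rightarrow> op" where
  "weyl_integrand p \<sigma> \<Omega> x =
     total_op (cadjoint (bext (\<sigma> x \<circ>\<^sub>m K_power (1 / p)))) \<circ>\<^sub>m (\<Omega> x \<circ>\<^sub>m K_power (1 - 1 / p))"

text \<open>\<^term>\<open>weyl_pairing p \<sigma> \<Omega> z\<close>: the integral $\langle \Omega, \sigma \rangle_\mu$ is well defined (almost every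
  integrand extends to a trace class operator, and the trace is integrable) and has value $z$.
  The function \<open>h\<close> absorbs the null set on which the trace is meaningless.\<close>

definition weyl_pairing :: "real \<Rightarrow> (sim2 \<Rightarrow> op) \<Rightarrow> (sim2 \<Rightarrow> op) \<Rightarrow> complex \<Rightarrow> bool" where
  "weyl_pairing p \<sigma> \<Omega> z \<longleftrightarrow>
     (\<exists>h. has_bochner_integral haar h z \<and>
        (AE x in haar. schatten_pow 1 (weyl_integrand p \<sigma> \<Omega> x) < \<infinity> \<and>
           h x = op_trace (bext (weyl_integrand p \<sigma> \<Omega> x))))"

text \<open>$W_\sigma$ is given by $\langle W_\sigma f, \overline{g} \rangle = \langle W(f,g), \sigma \rangle_\mu$,
  so its boundedness is boundedness of this everywhere defined form.\<close>

definition weyl_bounded :: "real \<Rightarrow> (sim2 \<Rightarrow> op) \<Rightarrow> bool" where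
  "weyl_bounded p \<sigma> \<longleftrightarrow>
     (\<exists>C. \<forall>f\<in>L2_SIM2. \<forall>g\<in>L2_SIM2. \<forall>\<Omega>\<in>wigner f g.
        \<exists>z. weyl_pairing p \<sigma> \<Omega> z \<and> cmod z \<le> C * L2_norm haar f * L2_norm haar g)"

end

theory Submission
  imports Defs
begin

text \<open>
  The symbol enters the Weyl transform as the operator $\sigma K_\pi^{1/p}$, paired with
  $W(f,g) K_\pi^{1/p'}$.  For $p > 2$ the exponent $1/p'$ exceeds $1/2$, whereas square integrability of
  $f$ and $g$ only controls $W(f,g) K_\pi^{1/2}$, which is Hilbert--Schmidt.  Since $K_\pi$ is
  multiplication by $\|x\|_2^2$ on the Fourier side of the translations, the excess
  $1/p' - 1/2 = 1/2 - 1/p$ in the exponent stands for $1 - 2/p$ derivatives of $f$ in the translation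
  variable.  A merely continuous $f$ need not have them, and then the pairing with a suitable $\sigma$
  is not even defined.

  Let $f(b,a,\theta) = u(b) v(a)$, where $u$ is a product of two hat functions times the lacunary series
  $\sum_n r^n e^{i 2^n b_1}$ and $v$ is a bump in $[1,2]$, and let $g$ be a continuous cutoff which equals
  $1$ wherever it matters, so that $W(f,g)(x,\pi) = \pi(f)$ for all $x$ in a set $E$ of positive finite
  measure (\<open>cut_amp_eq_rough_amp\<close>).  On a function of $\|x\|_2$, the operator $\pi(f)$ is an average over
  dilations followed by multiplication with $\hat u$ (\<open>pi_fun_shell\<close>).  As the Fourier transform of a
  hat function is nonnegative, $\hat u \ge r^n/4$ on a unit square near $(2^n, 0)$
  (\<open>lacunary_hat_ge\<close>).  The symbol is $\sigma(x,\pi) = 1_E(x) P K_\pi^{-1/p}$ with $P$ the projection onto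
  the line spanned by $\hat u$ (\<open>rank_one_symbol\<close>).  Then
  $(\sigma K_\pi^{1/p})^* W(f,g) K_\pi^{1/p'}$ is $P \pi(f) K_\pi^{1/p'}$ at each $x \in E$; it maps the
  indicator of the annulus $2^n \le \|x\|_2 \le 2^{n+2}$, whose norm is of order $2^n$, to a vector of norm
  at least a constant times $r^{2n} 2^{2n/p'}$ (\<open>cinner_pi_shell_ge\<close>).  The quotient
  $(r^2 2^{1-2/p})^n$ is unbounded when $r$ is close to $1$, so no bounded extension, hence no trace,
  exists at any point of $E$.

  It remains to see that $W(f,g)$ is a legitimate representative of its class, that is, to bound
  $\|W(f,g)\|_{2,\mu}$.  Here $W(f,g)(x,\pi) = \pi(h)$ with $h$ depending on the point $x$ and on $(b,a)$
  alone.  In polar coordinates (\<open>nn_integral_polar\<close>) the operator $\pi(h) K_\pi^{1/2}$ is an integral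
  operator whose kernel is built from the partial Fourier transform of $h$; its Hilbert--Schmidt norm is
  controlled by an inequality of Plancherel type (\<open>plancherel_le\<close>), which Bessel's inequality for
  exponentials on a square provides.  Schatten norms are given through the continuous functional calculus;
  the powers that occur are computed from the bound $\|q(P)\| \le \sup_{[0,\|P\|]} |q|$
  (\<open>norm_poly_op_le\<close>), which follows from a representation of polynomials that are nonnegative on an
  interval (\<open>nonneg_op_weighted\<close>).
\<close>

section \<open>The complex Hilbert space structure\<close>

lemma square_integrable_rep_l2: "square_integrable lborel (rep_l2 \<phi>)"
  using Quotient3_rep_reflp[OF Quotient3_l2, of \<phi>] by (simp add: ae_rel_def)

lemma borel_measurable_rep_l2 [measurable]: "rep_l2 \<phi> \<in> borel_measurable borel"
  using square_integrable_rep_l2[of \<phi>] by (simp add: square_integrable_def)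

lemma ae_rel_self: "square_integrable lborel f \<Longrightarrow> ae_rel f f"
  by (simp add: ae_rel_def)

lemma abs_l2_eqI:
  assumes "square_integrable lborel f" "square_integrable lborel g" "AE x in lborel. f x = g x"
  shows "abs_l2 f = abs_l2 g"
  using Quotient3_rel[OF Quotient3_l2, of f g] assms by (simp add: ae_rel_def)

lemma abs_rep_l2 [simp]: "abs_l2 (rep_l2 \<phi>) = \<phi>"
  using Quotient3_abs_rep[OF Quotient3_l2] by blast

lemma rep_abs_l2:
  assumes "square_integrable lborel f"
  shows "AE x in lborel. rep_l2 (abs_l2 f) x = f x"
  using Quotient3_rep_abs[OF Quotient3_l2, OF ae_rel_self[OF assms]] by (simp add: ae_rel_def)

lemma cinner_eq_rep: "cinner \<phi> \<psi> = (\<integral>x. rep_l2 \<phi> x * cnj (rep_l2 \<psi> x) \<partial>lborel)"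
  by (simp add: cinner_def)

lemma cinner_abs:
  assumes "square_integrable lborel f" "square_integrable lborel g"
  shows "cinner (abs_l2 f) (abs_l2 g) = (\<integral>x. f x * cnj (g x) \<partial>lborel)"
  by (rule cinner.abs_eq) (simp_all add: ae_rel_self assms)

lemma add_abs_l2:
  assumes "square_integrable lborel f" "square_integrable lborel g"
  shows "abs_l2 f + abs_l2 g = abs_l2 (\<lambda>x. f x + g x)"
  by (rule plus_l2.abs_eq) (simp_all add: ae_rel_self assms)

lemma cscale_abs_l2:
  assumes "square_integrable lborel f"
  shows "cscale c (abs_l2 f) = abs_l2 (\<lambda>x. c * f x)"
  by (rule cscale.abs_eq) (simp_all add: ae_rel_self assms)

lemma cinner_add_left: "cinner (\<phi> + \<psi>) \<rho> = cinner \<phi> \<rho> + cinner \<psi> \<rho>"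
  by transfer (auto simp: ae_rel_def distrib_right square_integrable_mult_cnj)

lemma cinner_cscale_left: "cinner (cscale c \<phi>) \<psi> = c * cinner \<phi> \<psi>"
  by transfer (simp add: mult.assoc)

lemma cnj_cinner: "cnj (cinner \<phi> \<psi>) = cinner \<psi> \<phi>"
  unfolding cinner_eq_rep Bochner_Integration.integral_cnj[symmetric] by (simp add: mult.commute)

lemma cinner_add_right: "cinner \<rho> (\<phi> + \<psi>) = cinner \<rho> \<phi> + cinner \<rho> \<psi>"
  by (metis cinner_add_left cnj_cinner complex_cnj_add)

lemma cinner_cscale_right: "cinner \<phi> (cscale c \<psi>) = cnj c * cinner \<phi> \<psi>"
  by (metis cinner_cscale_left cnj_cinner complex_cnj_mult)

lemma cinner_zero [simp]: "cinner 0 \<phi> = 0" "cinner \<phi> 0 = 0"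
  using cinner_add_left[of 0 0 \<phi>] cinner_add_right[of \<phi> 0 0] by simp_all

lemma cinner_minus: "cinner (- \<phi>) \<psi> = - cinner \<phi> \<psi>" "cinner \<psi> (- \<phi>) = - cinner \<psi> \<phi>"
  by (simp_all add: uminus_l2_def cinner_cscale_left cinner_cscale_right)

lemma cinner_diff: "cinner (\<phi> - \<phi>') \<psi> = cinner \<phi> \<psi> - cinner \<phi>' \<psi>"
    "cinner \<psi> (\<phi> - \<phi>') = cinner \<psi> \<phi> - cinner \<psi> \<phi>'"
  unfolding minus_l2_def cinner_add_left cinner_add_right cinner_minus by simp_all

lemma cinner_sum: "cinner (sum f A) \<psi> = (\<Sum>i\<in>A. cinner (f i) \<psi>)"
    "cinner \<psi> (sum f A) = (\<Sum>i\<in>A. cinner \<psi> (f i))"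
  by (induction A rule: infinite_finite_induct) (simp_all add: cinner_add_left cinner_add_right)

lemma cinner_self: "cinner \<phi> \<phi> = of_real ((norm \<phi>)\<^sup>2)"
proof -
  have "Im (cinner \<phi> \<phi>) = 0"
    using arg_cong[OF cnj_cinner[of \<phi> \<phi>], of Im] by simp
  then show ?thesis
    by (simp add: complex_eq_iff power2_norm_eq_inner inner_l2_def)
qed

lemma cscale_add_left: "cscale (c + d) \<phi> = cscale c \<phi> + cscale d \<phi>"
  by transfer (auto simp: ae_rel_def square_integrable_add square_integrable_cmult distrib_right)

lemma cscale_add_right: "cscale c (\<phi> + \<psi>) = cscale c \<phi> + cscale c \<psi>"
  by transfer (auto simp: ae_rel_def square_integrable_add square_integrable_cmult distrib_left)

lemma cscale_cscale: "cscale c (cscale d \<phi>) = cscale (c * d) \<phi>"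
  by transfer (auto simp: ae_rel_def square_integrable_add square_integrable_cmult mult.assoc)

lemma cscale_one [simp]: "cscale 1 \<phi> = \<phi>"
  by transfer (auto simp: ae_rel_def)

lemma cscale_zero [simp]: "cscale c 0 = 0" "cscale 0 \<phi> = 0"
  using cscale_add_right[of c 0 0] cscale_add_left[of 0 0 \<phi>] by simp_all

lemma norm_cscale: "norm (cscale c \<phi>) = cmod c * norm \<phi>"
proof -
  have "complex_of_real ((norm (cscale c \<phi>))\<^sup>2) = (c * cnj c) * of_real ((norm \<phi>)\<^sup>2)"
    unfolding cinner_self[symmetric] cinner_cscale_left cinner_cscale_right
    by (simp only: mult_ac)
  also have "\<dots> = of_real ((cmod c * norm \<phi>)\<^sup>2)"
    by (simp only: complex_norm_square[symmetric] power_mult_distrib of_real_mult)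
  finally have "(norm (cscale c \<phi>))\<^sup>2 = (cmod c * norm \<phi>)\<^sup>2"
    unfolding of_real_eq_iff .
  then show ?thesis
    by (rule power2_eq_imp_eq) simp_all
qed

lemma cmod_cinner_le: "cmod (cinner \<phi> \<psi>) \<le> norm \<phi> * norm \<psi>"
proof (cases "cinner \<phi> \<psi> = 0")
  case False
  define c where "c = cnj (cinner \<phi> \<psi>) / cmod (cinner \<phi> \<psi>)"
  have c: "cmod c = 1" "c * cinner \<phi> \<psi> = of_real (cmod (cinner \<phi> \<psi>))"
    using False complex_norm_square[of "cinner \<phi> \<psi>"]
    by (auto simp: c_def norm_divide field_simps power2_eq_square)
  have "cmod (cinner \<phi> \<psi>) = cscale c \<phi> \<bullet> \<psi>"
    by (simp add: inner_l2_def cinner_cscale_left c)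
  also have "\<dots> \<le> norm (cscale c \<phi>) * norm \<psi>"
    by (rule norm_cauchy_schwarz)
  finally show ?thesis by (simp add: norm_cscale c)
qed simp

lemma cinner_right_eqI: "(\<And>\<psi>. cinner \<phi> \<psi> = cinner \<phi>' \<psi>) \<Longrightarrow> \<phi> = \<phi>'"
  using cinner_self[of "\<phi> - \<phi>'"] by (simp add: cinner_diff)

lemma cinner_left_eqI: "(\<And>\<psi>. cinner \<psi> \<phi> = cinner \<psi> \<phi>') \<Longrightarrow> \<phi> = \<phi>'"
  using cinner_self[of "\<phi> - \<phi>'"] by (simp add: cinner_diff)

lemma norm_l2_square: "(norm \<phi>)\<^sup>2 = (\<integral>x. (cmod (rep_l2 \<phi> x))\<^sup>2 \<partial>lborel)"
proof -
  have "complex_of_real ((norm \<phi>)\<^sup>2) = (\<integral>x. of_real ((cmod (rep_l2 \<phi> x))\<^sup>2) \<partial>lborel)"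
    unfolding cinner_self[symmetric] cinner_eq_rep by (simp only: complex_norm_square)
  then show ?thesis by (simp only: integral_complex_of_real of_real_eq_iff)
qed

abbreviation sq_norm :: "('a::euclidean_space \<Rightarrow> complex) \<Rightarrow> ennreal" where
  "sq_norm f \<equiv> \<integral>\<^sup>+x. ennreal ((cmod (f x))\<^sup>2) \<partial>lborel"

lemma nn_integral_rep_l2: "sq_norm (rep_l2 \<phi>) = ennreal ((norm \<phi>)\<^sup>2)"
  unfolding norm_l2_square using square_integrable_rep_l2[of \<phi>]
  by (intro nn_integral_eq_integral) (auto simp: square_integrable_def)

lemma square_integrable_iff_nn_integral:
  "square_integrable M f \<longleftrightarrow>
     f \<in> borel_measurable M \<and> (\<integral>\<^sup>+x. ennreal ((cmod (f x))\<^sup>2) \<partial>M) < \<infinity>"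
  by (auto simp: square_integrable_def integrable_iff_bounded)

lemma norm_abs_l2: 
  assumes "square_integrable lborel f"
  shows "ennreal ((norm (abs_l2 f))\<^sup>2) = sq_norm f"
  unfolding nn_integral_rep_l2[symmetric]
  by (rule nn_integral_cong_AE) (use rep_abs_l2[OF assms] in auto)

lemma bounded_clinearI:
  assumes "\<And>\<phi> \<psi>. T (\<phi> + \<psi>) = T \<phi> + T \<psi>" "\<And>c \<phi>. T (cscale c \<phi>) = cscale c (T \<phi>)"
    and "\<And>\<phi>. norm (T \<phi>) \<le> K * norm \<phi>"
  shows "bounded_clinear T"
  unfolding bounded_clinear_def
  by (intro conjI allI assms(2) bounded_linear_intro[where K = K])
     (auto simp: assms scaleR_l2_def mult.commute)

lemma bounded_clinear_bounded: "bounded_clinear T \<Longrightarrow> bounded_linear T"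
  by (simp add: bounded_clinear_def)

lemma bounded_clinear_compose:
  "bounded_clinear S \<Longrightarrow> bounded_clinear T \<Longrightarrow> bounded_clinear (S \<circ> T)"
  by (simp add: bounded_clinear_def bounded_linear_compose comp_def)

lemma cadjointI:
  assumes "\<And>\<phi> \<psi>. cinner (T \<phi>) \<psi> = cinner \<phi> (S \<psi>)"
  shows "cadjoint T = S"
  unfolding cadjoint_def
proof (rule the_equality)
  show "S' = S" if "\<forall>\<phi> \<psi>. cinner (T \<phi>) \<psi> = cinner \<phi> (S' \<psi>)" for S'
    using that assms by (intro ext cinner_left_eqI) metis
qed (use assms in blast)

subsection \<open>Orthonormal bases\<close>

definition orthonormal_set :: "l2 set \<Rightarrow> bool" where
  "orthonormal_set B \<longleftrightarrow> (\<forall>e\<in>B. \<forall>e'\<in>B. cinner e e' = (if e = e' then 1 else 0))"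

lemma bessel_inequality:
  assumes "finite F" "orthonormal_set F"
  shows "(\<Sum>e\<in>F. (cmod (cinner \<phi> e))\<^sup>2) \<le> (norm \<phi>)\<^sup>2"
proof -
  define \<psi> where "\<psi> = (\<Sum>e\<in>F. cscale (cinner \<phi> e) e)"
  have sq: "complex_of_real (\<Sum>e\<in>F. (cmod (cinner \<phi> e))\<^sup>2)
      = (\<Sum>e\<in>F. cnj (cinner \<phi> e) * cinner \<phi> e)"
    by (simp only: of_real_sum complex_norm_square mult.commute)
  have "cinner \<phi> \<psi> = of_real (\<Sum>e\<in>F. (cmod (cinner \<phi> e))\<^sup>2)"
    unfolding sq by (simp add: \<psi>_def cinner_sum cinner_cscale_right)
  moreover have "cinner \<psi> e = cinner \<phi> e" if "e \<in> F" for e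
  proof -
    have "cinner \<psi> e = (\<Sum>e'\<in>F. cinner \<phi> e' * (if e' = e then 1 else 0))"
      using assms(2) that by (auto simp: \<psi>_def cinner_sum cinner_cscale_left orthonormal_set_def intro!: sum.cong)
    then show ?thesis using assms(1) that by (simp add: if_distrib sum.delta cong: if_cong)
  qed
  then have "cinner \<psi> \<psi> = of_real (\<Sum>e\<in>F. (cmod (cinner \<phi> e))\<^sup>2)"
    unfolding sq by (subst (2) \<psi>_def) (simp add: cinner_sum cinner_cscale_right)
  ultimately have "cinner (\<phi> - \<psi>) (\<phi> - \<psi>)
      = of_real ((norm \<phi>)\<^sup>2 - (\<Sum>e\<in>F. (cmod (cinner \<phi> e))\<^sup>2))"
    using cnj_cinner[of \<phi> \<psi>, symmetric] by (simp add: cinner_diff cinner_self[of \<phi>])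
  then have "(norm (\<phi> - \<psi>))\<^sup>2 = (norm \<phi>)\<^sup>2 - (\<Sum>e\<in>F. (cmod (cinner \<phi> e))\<^sup>2)"
    unfolding cinner_self of_real_eq_iff .
  then show ?thesis by (smt (verit) zero_le_power2)
qed

text \<open>By Zorn's lemma: a nonzero vector orthogonal to a maximal orthonormal set could be normalised and
  added to it.\<close>

lemma orthonormal_basis_exists: "\<exists>B. orthonormal_basis B"
proof -
  have "\<exists>B\<in>{B. orthonormal_set B}. \<forall>X\<in>{B. orthonormal_set B}. B \<subseteq> X \<longrightarrow> X = B"
  proof (rule subset_Zorn')
    fix C assume C: "subset.chain {B. orthonormal_set B} C"
    show "\<Union>C \<in> {B. orthonormal_set B}"
      unfolding mem_Collect_eq orthonormal_set_def
    proof (intro ballI)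
      fix e e' assume "e \<in> \<Union>C" "e' \<in> \<Union>C"
      then obtain B B' where B: "B \<in> C" "B' \<in> C" "e \<in> B" "e' \<in> B'" by blast
      then have "B \<subseteq> B' \<or> B' \<subseteq> B" "orthonormal_set B" "orthonormal_set B'"
        using C by (auto simp: subset_chain_def)
      then show "cinner e e' = (if e = e' then 1 else 0)"
        using B unfolding orthonormal_set_def by blast
    qed
  qed
  then obtain B where B: "orthonormal_set B" and
    max: "\<And>X. orthonormal_set X \<Longrightarrow> B \<subseteq> X \<Longrightarrow> X = B" by blast
  have "\<phi> = 0" if orth: "\<And>e. e \<in> B \<Longrightarrow> cinner \<phi> e = 0" for \<phi>
  proof (rule ccontr)
    assume "\<phi> \<noteq> 0"
    define e0 where "e0 = cscale (of_real (1 / norm \<phi>)) \<phi>"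
    have 1: "cinner e0 e0 = 1"
      using \<open>\<phi> \<noteq> 0\<close> by (simp add: e0_def norm_cscale cinner_self norm_divide)
    have 2: "cinner e0 e = 0" "cinner e e0 = 0" if "e \<in> B" for e
      using orth[OF that] cnj_cinner[of \<phi> e]
      by (simp_all add: e0_def cinner_cscale_left cinner_cscale_right)
    have "orthonormal_set (insert e0 B)"
      using 1 2 B unfolding orthonormal_set_def by auto
    then have "e0 \<in> B" using max[of "insert e0 B"] by blast
    then show False using 1 2 by simp
  qed
  then show ?thesis
    using B unfolding orthonormal_basis_def orthonormal_set_def by (intro exI[of _ B]) blast
qed

lemma orthonormal_onb:
  assumes "F \<subseteq> onb"
  shows "orthonormal_set F"
proof -
  have "orthonormal_basis onb"
    unfolding onb_def by (rule someI_ex[OF orthonormal_basis_exists])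
  then show ?thesis
    unfolding orthonormal_basis_def orthonormal_set_def using assms by (meson subsetD)
qed

text \<open>A trace is estimated through its finite partial sums, on arbitrary finite orthonormal families, so
  that the basis chosen in the definition never has to be known.\<close>

lemma positive_trace_le:
  assumes "\<And>F. finite F \<Longrightarrow> orthonormal_set F \<Longrightarrow> (\<Sum>e\<in>F. ennreal (Re (cinner (P e) e))) \<le> C"
  shows "positive_trace P \<le> C"
  unfolding positive_trace_def
  by (subst nonneg_infsum_complete) (auto intro!: SUP_least assms orthonormal_onb)

lemma bextI:
  assumes "bounded_extension A B"
  shows "bext A = B"
  unfolding bext_def
proof (rule the_equality)
  fix B' assume B': "bounded_extension A B'"
  have lin: "bounded_linear (\<lambda>\<phi>. B' \<phi> - B \<phi>)"
    using assms B' by (intro bounded_linear_sub) (simp_all add: bounded_extension_def bounded_clinear_def)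
  have "closed ((\<lambda>\<phi>. B' \<phi> - B \<phi>) -` {0})"
    by (intro continuous_closed_vimage closed_singleton allI)
       (rule linear_continuous_at[OF lin])
  moreover have "dom A \<subseteq> (\<lambda>\<phi>. B' \<phi> - B \<phi>) -` {0}"
  proof
    fix \<phi> assume "\<phi> \<in> dom A"
    then have "A \<phi> = Some (B \<phi>)" "A \<phi> = Some (B' \<phi>)"
      using assms B' by (auto simp: bounded_extension_def map_le_def total_op_def)
    then show "\<phi> \<in> (\<lambda>\<phi>. B' \<phi> - B \<phi>) -` {0}" by simp
  qed
  ultimately have "closure (dom A) \<subseteq> (\<lambda>\<phi>. B' \<phi> - B \<phi>) -` {0}"
    by (rule closure_minimal[rotated])
  then have "B' \<phi> - B \<phi> = 0" for \<phi>
    using assms unfolding bounded_extension_def by blast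
  then show "B' = B" by auto
qed (fact assms)

lemma schatten_pow_eq:
  assumes "bounded_extension A B"
  shows "schatten_pow r A = positive_trace (positive_power (r / 2) (cadjoint B \<circ> B))"
  using assms bextI[OF assms] by (auto simp: schatten_pow_def)

section \<open>Functional calculus of a positive operator\<close>

lemma poly_op_eq_sum:
  assumes "degree q \<le> n"
  shows "poly_op q P \<phi> = (\<Sum>i\<le>n. coeff q i *\<^sub>R (P ^^ i) \<phi>)"
  unfolding poly_op_def
  by (rule sum.mono_neutral_left) (use assms in \<open>auto simp: coeff_eq_0\<close>)

lemma poly_op_add: "poly_op (p + q) P \<phi> = poly_op p P \<phi> + poly_op q P \<phi>"
  by (simp add: poly_op_eq_sum[of _ "max (degree p) (degree q)"] degree_add_le
      scaleR_add_left sum.distrib)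

lemma poly_op_smult: "poly_op (smult c q) P \<phi> = c *\<^sub>R poly_op q P \<phi>"
  by (simp add: poly_op_eq_sum[of _ "degree q"] scaleR_sum_right)

lemma poly_op_0 [simp]: "poly_op 0 P \<phi> = 0"
  by (simp add: poly_op_def)

lemma poly_op_diff: "poly_op (p - q) P \<phi> = poly_op p P \<phi> - poly_op q P \<phi>"
  using poly_op_add[of p "smult (-1) q" P \<phi>] poly_op_smult[of "-1" q P \<phi>] by simp

lemma poly_op_pCons:
  assumes "bounded_linear P"
  shows "poly_op (pCons a q) P \<phi> = a *\<^sub>R \<phi> + P (poly_op q P \<phi>)"
proof -
  have lin: "linear P" using assms by (rule bounded_linear.linear)
  have "poly_op (pCons a q) P \<phi> = (\<Sum>i\<le>Suc (degree q). coeff (pCons a q) i *\<^sub>R (P ^^ i) \<phi>)"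
    by (rule poly_op_eq_sum) (simp add: degree_pCons_le)
  also have "\<dots> = a *\<^sub>R \<phi> + (\<Sum>i\<le>degree q. coeff q i *\<^sub>R P ((P ^^ i) \<phi>))"
    by (subst sum.atMost_Suc_shift) simp
  also have "(\<Sum>i\<le>degree q. coeff q i *\<^sub>R P ((P ^^ i) \<phi>)) = P (poly_op q P \<phi>)"
    by (simp add: poly_op_def linear_sum[OF lin] linear_scale[OF lin])
  finally show ?thesis .
qed

lemma poly_nonneg_Icc:
  fixes q :: "real poly"
  assumes "a < b" "\<And>t. a < t \<Longrightarrow> t < b \<Longrightarrow> 0 \<le> poly q t" "a \<le> t" "t \<le> b"
  shows "0 \<le> poly q t"
proof -
  have "closed {t. 0 \<le> poly q t}"
    by (intro closed_Collect_le continuous_intros)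
  then have "closure {a<..<b} \<subseteq> {t. 0 \<le> poly q t}"
    by (rule closure_minimal[rotated]) (use assms in auto)
  then show ?thesis using assms by auto
qed

context
  fixes P :: "l2 \<Rightarrow> l2"
  assumes P: "bounded_linear P"
begin

lemma poly_op_1: "poly_op 1 P \<phi> = \<phi>"
  using poly_op_pCons[OF P, of 1 0] linear_0[OF bounded_linear.linear[OF P]] by (simp add: one_pCons)

lemma poly_op_mult: "poly_op (p * q) P \<phi> = poly_op p P (poly_op q P \<phi>)"
proof (induction p)
  case (pCons a p)
  then show ?case
    using linear_0[OF bounded_linear.linear[OF P]]
    by (simp add: mult_pCons_left poly_op_add poly_op_smult poly_op_pCons[OF P])
qed simp

lemma poly_op_X: "poly_op [:0, 1:] P \<phi> = P \<phi>"
  using linear_0[OF bounded_linear.linear[OF P]] by (simp add: poly_op_pCons[OF P])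

lemma poly_op_const: "poly_op [:c:] P \<phi> = c *\<^sub>R \<phi>"
  using linear_0[OF bounded_linear.linear[OF P]] by (simp add: poly_op_pCons[OF P])

lemma bounded_linear_poly_op: "bounded_linear (poly_op q P)"
proof (induction q)
  case 0
  have "poly_op 0 P = (\<lambda>_. 0)" by auto
  then show ?case by (simp add: bounded_linear_zero)
next
  case (pCons a q)
  have "poly_op (pCons a q) P = (\<lambda>\<phi>. a *\<^sub>R \<phi> + P (poly_op q P \<phi>))"
    by (rule ext) (rule poly_op_pCons[OF P])
  then show ?case
    using bounded_linear_add[OF bounded_linear_scaleR_right[of a] bounded_linear_compose[OF P pCons.IH]] by simp
qed

context
  assumes selfadj: "\<And>\<phi> \<psi>. P \<phi> \<bullet> \<psi> = \<phi> \<bullet> P \<psi>"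
    and pos: "\<And>\<phi>. 0 \<le> P \<phi> \<bullet> \<phi>"
begin

lemma poly_op_selfadj: "poly_op q P \<phi> \<bullet> \<psi> = \<phi> \<bullet> poly_op q P \<psi>"
proof (induction q arbitrary: \<phi> \<psi>)
  case (pCons a q)
  have "P (poly_op q P \<phi>) \<bullet> \<psi> = \<phi> \<bullet> poly_op (q * [:0, 1:]) P \<psi>"
    by (simp only: selfadj pCons.IH poly_op_mult poly_op_X)
  also have "poly_op (q * [:0, 1:]) P \<psi> = P (poly_op q P \<psi>)"
    by (simp only: mult.commute[of q] poly_op_mult poly_op_X)
  finally show ?case
    by (simp add: poly_op_pCons[OF P] inner_add_left inner_add_right)
qed simp

definition "nonneg_op q \<longleftrightarrow> (\<forall>\<phi>. 0 \<le> poly_op q P \<phi> \<bullet> \<phi>)"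

lemma nonneg_op_add: "nonneg_op p \<Longrightarrow> nonneg_op q \<Longrightarrow> nonneg_op (p + q)"
  by (simp add: nonneg_op_def poly_op_add inner_add_left)

lemma nonneg_op_smult: "0 \<le> c \<Longrightarrow> nonneg_op q \<Longrightarrow> nonneg_op (smult c q)"
  by (simp add: nonneg_op_def poly_op_smult)

text \<open>Because $s(P) q(P) s(P)$ is positive when $q(P)$ is.\<close>

lemma nonneg_op_square: 
  assumes "nonneg_op q"
  shows "nonneg_op (s * s * q)"
  unfolding nonneg_op_def
proof
  fix \<phi>
  have "poly_op (s * s * q) P \<phi> = poly_op s P (poly_op q P (poly_op s P \<phi>))"
    unfolding poly_op_mult[symmetric] by (simp add: mult_ac)
  then show "0 \<le> poly_op (s * s * q) P \<phi> \<bullet> \<phi>"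
    using assms by (simp add: nonneg_op_def poly_op_selfadj[of s])
qed

text \<open>Multiplication by one of the two linear weights $X$, $Y$ permutes the products $1, X, Y, XY$ up to the
  square $X^2$.\<close>

lemma nonneg_op_mult_weight:
  assumes s: "\<And>w. w \<in> {1, X, Y, X * Y} \<Longrightarrow> nonneg_op (w * s)"
    and w: "w \<in> {1, X, Y, X * Y}"
  shows "nonneg_op (w * X * s)"
proof -
  have "nonneg_op (X * s)" "nonneg_op (X * Y * s)"
    "nonneg_op (X * X * (1 * s))" "nonneg_op (X * X * (Y * s))"
    using s[of X] s[of "X * Y"] nonneg_op_square[OF s[of 1]] nonneg_op_square[OF s[of Y]] by blast+
  moreover have "X * X * (1 * s) = X * X * s" "X * X * (Y * s) = X * Y * X * s" "X * Y * s = Y * X * s"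
    "X * s = 1 * X * s" by (simp_all only: mult_ac mult_1)
  ultimately show ?thesis using w by (metis insertE emptyE)
qed

context
  fixes M :: real
  assumes M: "0 < M" and onorm_le: "onorm P \<le> M"
begin

text \<open>A polynomial is nonnegative on $[0,M]$ iff it is a combination of these weights with sums of squares
  as coefficients.  Of a positive operator of norm at most $M$, each weight is a positive operator.\<close>

definition "weights = {1, [:0, 1:], [:M, - 1:], [:0, 1:] * [:M, - 1:]}"

lemma nonneg_op_weights: "w \<in> weights \<Longrightarrow> nonneg_op w"
proof -
  have 1: "nonneg_op 1" by (simp add: nonneg_op_def poly_op_1)
  have X: "nonneg_op [:0, 1:]" using pos by (simp add: nonneg_op_def poly_op_X)
  have M_X: "nonneg_op [:M, - 1:]"
    unfolding nonneg_op_def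
  proof
    fix \<phi>
    have "P \<phi> \<bullet> \<phi> \<le> norm (P \<phi>) * norm \<phi>" by (rule norm_cauchy_schwarz)
    also have "\<dots> \<le> (M * norm \<phi>) * norm \<phi>"
      by (intro mult_right_mono order_trans[OF onorm[OF P]] onorm_le) auto
    finally have *: "P \<phi> \<bullet> \<phi> \<le> M * (\<phi> \<bullet> \<phi>)"
      by (simp add: power2_norm_eq_inner[symmetric] power2_eq_square mult.assoc)
    have "poly_op [:M, - 1:] P \<phi> = M *\<^sub>R \<phi> - P \<phi>"
      using poly_op_diff[of "[:M:]" "[:0,1:]" P \<phi>] by (simp add: poly_op_const poly_op_X)
    then show "0 \<le> poly_op [:M, - 1:] P \<phi> \<bullet> \<phi>"
      using * by (simp add: inner_diff_left)
  qed
  \<comment> \<open>$M\,t(M-t) = t^2 (M-t) + (M-t)^2 t$\<close>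
  have "[:0, 1:] * [:M, - 1:] =
      smult (1 / M) ([:0, 1:] * [:0, 1:] * [:M, - 1:] + [:M, - 1:] * [:M, - 1:] * [:0, 1:])"
    using M by (simp add: field_simps)
  then have "nonneg_op ([:0, 1:] * [:M, - 1:])"
    using M X M_X by (metis nonneg_op_add nonneg_op_smult nonneg_op_square less_imp_le zero_le_divide_1_iff)
  then show "w \<in> weights \<Longrightarrow> nonneg_op w"
    using 1 X M_X by (auto simp: weights_def)
qed

text \<open>Induction on the degree: let $t_0$ be a minimum point of $r$ on $[0,M]$, with value $m$, and split off
  a factor of $r - m$.  If $t_0$ is an endpoint, the linear factor is a weight.  If $t_0$ is interior,
  it is a double root, and the factor is a square.  Carrying the weight $w$ along makes the
  first case go through.\<close>

lemma nonneg_op_weighted: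
  assumes "\<And>t. 0 \<le> t \<Longrightarrow> t \<le> M \<Longrightarrow> 0 \<le> poly r t" "w \<in> weights"
  shows "nonneg_op (w * r)"
  using assms
proof (induction "degree r" arbitrary: r w rule: less_induct)
  case less
  obtain t0 where t0: "0 \<le> t0" "t0 \<le> M" "\<And>t. 0 \<le> t \<Longrightarrow> t \<le> M \<Longrightarrow> poly r t0 \<le> poly r t"
    using continuous_attains_inf[of "{0..M}" "poly r"] continuous_on_poly[OF continuous_on_id, of _ r] M
    by auto
  define m where "m = poly r t0"
  have m: "0 \<le> m" using less.prems t0 by (auto simp: m_def)
  obtain s where s: "r - [:m:] = [:- t0, 1:] * s"
    using poly_eq_0_iff_dvd[of "r - [:m:]" t0] by (auto simp: m_def elim: dvdE)
  have r: "r = [:m:] + [:- t0, 1:] * s" using s by (simp add: algebra_simps)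
  have mw: "nonneg_op (w * [:m:])"
    using nonneg_op_smult[OF m nonneg_op_weights[OF less.prems(2)]] by simp
  have s_sign: "0 \<le> (t - t0) * poly s t" if "0 \<le> t" "t \<le> M" for t
    using t0(3)[OF that] arg_cong[OF s, of "\<lambda>q. poly q t"] by (simp add: m_def algebra_simps)
  show ?case
  proof (cases "s = 0")
    case True
    then show ?thesis using mw r by simp
  next
    case False
    have deg: "degree s < degree r"
    proof -
      have "Suc (degree s) = degree (r - [:m:])"
        using s False by (simp add: degree_mult_eq del: mult_pCons_left)
      also have "\<dots> \<le> max (degree r) (degree [:m:])" by (rule degree_diff_le_max)
      finally show ?thesis by simp
    qed
    consider "t0 = 0" | "t0 = M" | "0 < t0" "t0 < M" using t0 by linarith
    then show ?thesis
    proof cases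
      case 1
      have sn: "0 \<le> poly s t" if "0 \<le> t" "t \<le> M" for t
      proof (rule poly_nonneg_Icc[OF M _ that])
        show "0 \<le> poly s t" if "0 < t" "t < M" for t
          using s_sign[of t] 1 that by (simp add: zero_le_mult_iff)
      qed
      have "nonneg_op (w' * s)" if "w' \<in> {1, [:0, 1:], [:M, - 1:], [:0, 1:] * [:M, - 1:]}" for w'
        using less.hyps[OF deg sn] that by (simp only: weights_def)
      then have "nonneg_op (w * [:0, 1:] * s)"
        using less.prems(2) unfolding weights_def by (rule nonneg_op_mult_weight)
      moreover have "w * r = w * [:m:] + w * [:0, 1:] * s"
        unfolding r 1 by (simp only: distrib_left mult.assoc minus_zero)
      ultimately show ?thesis using nonneg_op_add[OF mw, of "w * [:0, 1:] * s"] by (simp only:)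
    next
      case 2
      have sn: "0 \<le> poly (- s) t" if "0 \<le> t" "t \<le> M" for t
      proof (rule poly_nonneg_Icc[OF M _ that])
        show "0 \<le> poly (- s) t" if "0 < t" "t < M" for t
          using s_sign[of t] 2 that by (simp add: zero_le_mult_iff)
      qed
      have W: "{1, [:M, - 1:], [:0, 1:], [:M, - 1:] * [:0, 1:]} = weights"
        unfolding weights_def mult.commute[of "[:M, - 1:]"] by blast
      have "nonneg_op (w' * - s)" if "w' \<in> {1, [:M, - 1:], [:0, 1:], [:M, - 1:] * [:0, 1:]}" for w'
        using that less.hyps[OF _ sn] deg unfolding W degree_minus by blast
      then have "nonneg_op (w * [:M, - 1:] * - s)"
        using less.prems(2) unfolding W[symmetric] by (rule nonneg_op_mult_weight)
      moreover have "[:- t0, 1:] = - [:M, - 1:]" using 2 by simp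
      then have "w * r = w * [:m:] + w * [:M, - 1:] * - s"
        unfolding r by (simp only: distrib_left mult.assoc mult_minus_left mult_minus_right)
      ultimately show ?thesis using nonneg_op_add[OF mw, of "w * [:M, - 1:] * - s"] by (simp only:)
    next
      case 3
      have "0 \<le> poly s t0"
      proof (rule poly_nonneg_Icc[OF 3(2)])
        show "0 \<le> poly s t" if "t0 < t" "t < M" for t
          using s_sign[of t] 3 that by (simp add: zero_le_mult_iff)
      qed (use 3 in auto)
      moreover have "0 \<le> poly (- s) t0"
      proof (rule poly_nonneg_Icc[OF 3(1)])
        show "0 \<le> poly (- s) t" if "0 < t" "t < t0" for t
          using s_sign[of t] 3 that by (simp add: zero_le_mult_iff)
      qed (use 3 in auto)
      ultimately have "poly s t0 = 0" by simp
      then obtain s' where s': "s = [:- t0, 1:] * s'"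
        by (auto simp: poly_eq_0_iff_dvd elim: dvdE)
      have sgn: "0 \<le> poly s' t" if "0 \<le> t" "t \<le> M" "t \<noteq> t0" for t
      proof -
        have "0 \<le> (t - t0)\<^sup>2 * poly s' t"
          using s_sign[OF that(1,2)] by (simp add: s' power2_eq_square algebra_simps)
        then show ?thesis using that(3) by (simp add: zero_le_mult_iff)
      qed
      have "0 \<le> poly s' t0"
        by (rule poly_nonneg_Icc[OF 3(1)]) (use sgn 3 in auto)
      then have sn: "0 \<le> poly s' t" if "0 \<le> t" "t \<le> M" for t
        using sgn[OF that] by (cases "t = t0") auto
      have "degree s' \<le> degree s"
        using False s' by (simp add: degree_mult_eq del: mult_pCons_left)
      then have "nonneg_op ([:- t0, 1:] * [:- t0, 1:] * (w * s'))"
        using deg by (intro nonneg_op_square less.hyps sn less.prems(2)) auto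
      moreover have "w * r = w * [:m:] + [:- t0, 1:] * [:- t0, 1:] * (w * s')"
        unfolding r s' by (simp only: distrib_left mult_ac)
      ultimately show ?thesis
        using nonneg_op_add[OF mw, of "[:- t0, 1:] * [:- t0, 1:] * (w * s')"] by (simp only:)
    qed
  qed
qed

text \<open>The spectral bound, from positivity of $\epsilon^2 - q^2$ at $P$.\<close>

lemma norm_poly_op_le:
  assumes "\<And>t. 0 \<le> t \<Longrightarrow> t \<le> M \<Longrightarrow> \<bar>poly q t\<bar> \<le> \<epsilon>"
  shows "norm (poly_op q P \<phi>) \<le> \<epsilon> * norm \<phi>"
proof -
  have \<epsilon>: "0 \<le> \<epsilon>" using assms[of 0] M by auto
  have "nonneg_op (1 * ([:\<epsilon>\<^sup>2:] - q * q))"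
  proof (rule nonneg_op_weighted)
    fix t assume "0 \<le> t" "t \<le> M"
    then have "(poly q t)\<^sup>2 \<le> \<epsilon>\<^sup>2" using assms \<epsilon> by (metis abs_le_square_iff abs_of_nonneg)
    then show "0 \<le> poly ([:\<epsilon>\<^sup>2:] - q * q) t" by (simp add: power2_eq_square)
  qed (simp add: weights_def)
  then have "poly_op q P (poly_op q P \<phi>) \<bullet> \<phi> \<le> \<epsilon>\<^sup>2 * (\<phi> \<bullet> \<phi>)"
    by (simp add: nonneg_op_def poly_op_diff poly_op_const poly_op_mult inner_diff_left)
  then have "(norm (poly_op q P \<phi>))\<^sup>2 \<le> (\<epsilon> * norm \<phi>)\<^sup>2"
    by (simp add: poly_op_selfadj power2_norm_eq_inner power_mult_distrib)
  then show ?thesis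
    by (rule power2_le_imp_le) (simp add: \<epsilon>)
qed

end

lemma norm_poly_op_le_onorm:
  assumes "\<And>t. 0 \<le> t \<Longrightarrow> t \<le> onorm P \<Longrightarrow> \<bar>poly q t\<bar> \<le> \<epsilon>"
  shows "norm (poly_op q P \<phi>) \<le> \<epsilon> * norm \<phi>"
proof (cases "onorm P = 0")
  case True
  then have "P \<psi> = 0" for \<psi> using onorm_eq_0[OF P] by auto
  then have "poly_op q P \<phi> = poly q 0 *\<^sub>R \<phi>"
    by (cases q) (simp add: poly_op_pCons[OF P])
  then show ?thesis using assms[of 0] True by (simp add: mult_right_mono)
next
  case False
  then show ?thesis
    using norm_poly_op_le[of "onorm P", OF _ _ assms] onorm_pos_le[OF P] by simp
qed

end
end

lemma onorm_tendsto_0I: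
  assumes "\<And>e. 0 < e \<Longrightarrow> \<forall>\<^sub>F n in sequentially. \<forall>\<phi>. norm (D n \<phi> :: l2) \<le> e * norm (\<phi> :: l2)"
    and "\<And>n. bounded_linear (D n)"
  shows "(\<lambda>n. onorm (D n)) \<longlonglongrightarrow> 0"
proof (rule tendstoI)
  fix e :: real assume "0 < e"
  then have "\<forall>\<^sub>F n in sequentially. \<forall>\<phi>. norm (D n \<phi>) \<le> (e / 2) * norm \<phi>"
    by (intro assms) simp
  then show "\<forall>\<^sub>F n in sequentially. dist (onorm (D n)) 0 < e"
  proof eventually_elim
    case (elim n)
    then have "onorm (D n) \<le> e / 2" using \<open>0 < e\<close> by (intro onorm_bound) auto
    then show ?case using \<open>0 < e\<close> onorm_pos_le[OF assms(2)[of n]] by (simp add: dist_real_def)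
  qed
qed

lemma exists_polynomials_powr:
  assumes "0 < s"
  shows "\<exists>q :: nat \<Rightarrow> real poly. uniform_limit {0..M} (\<lambda>n t. poly (q n) t) (\<lambda>t. t powr s) sequentially"
proof -
  have cont: "continuous_on {0..M} (\<lambda>t::real. t powr s)"
    using assms by (intro continuous_on_powr' continuous_intros) auto
  have "\<exists>g. real_polynomial_function g \<and> (\<forall>x\<in>{0..M}. \<bar>x powr s - g x\<bar> < inverse (real (Suc n)))" for n
    using Stone_Weierstrass_real_polynomial_function[OF compact_Icc cont, of "inverse (real (Suc n))"]
    by (metis inverse_positive_iff_positive of_nat_0_less_iff zero_less_Suc)
  then obtain g where g: "\<And>n. real_polynomial_function (g n)"
    "\<And>n x. x \<in> {0..M} \<Longrightarrow> \<bar>x powr s - g n x\<bar> < inverse (real (Suc n))" by metis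
  have "\<exists>q. \<forall>t. poly q t = g n t" for n
  proof -
    obtain a m where "g n = (\<lambda>x. \<Sum>i\<le>m. a i * x ^ i)"
      using g(1)[of n] unfolding real_polynomial_function_iff_sum by blast
    then show ?thesis by (intro exI[of _ "\<Sum>i\<le>m. monom (a i) i"]) (simp add: poly_sum poly_monom)
  qed
  then obtain q where q: "\<And>n t. poly (q n) t = g n t" by metis
  show ?thesis
  proof (intro exI[of _ q] uniform_limitI)
    fix e :: real assume "0 < e"
    from order_tendstoD(2)[OF LIMSEQ_inverse_real_of_nat this]
    show "\<forall>\<^sub>F n in sequentially. \<forall>t\<in>{0..M}. dist (poly (q n) t) (t powr s) < e"
    proof eventually_elim
      case (elim n)
      show ?case
      proof
        fix t assume "t \<in> {0..M}"
        from g(2)[OF this, of n] elim show "dist (poly (q n) t) (t powr s) < e"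
          unfolding q dist_real_def abs_minus_commute[of "g n t"] by (rule less_trans)
      qed
    qed
  qed
qed

text \<open>Convergence along every approximating sequence determines $P^s$ because an approximating sequence
  exists, by Weierstrass.\<close>

lemma positive_power_eqI:
  assumes P: "bounded_linear P" and Q: "bounded_clinear Q" and s: "0 < s"
    and lim: "\<And>q. uniform_limit {0..onorm P} (\<lambda>n t. poly (q n) t) (\<lambda>t. t powr s) sequentially \<Longrightarrow>
        (\<lambda>n. onorm (\<lambda>\<phi>. poly_op (q n) P \<phi> - Q \<phi>)) \<longlonglongrightarrow> 0"
  shows "positive_power s P = Q"
  unfolding positive_power_def
proof (rule the_equality)
  fix Q' assume Q': "bounded_clinear Q' \<and> (\<forall>q :: nat \<Rightarrow> real poly.
        uniform_limit {0..onorm P} (\<lambda>n t. poly (q n) t) (\<lambda>t. t powr s) sequentially \<longrightarrow>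
        (\<lambda>n. onorm (\<lambda>\<phi>. poly_op (q n) P \<phi> - Q' \<phi>)) \<longlonglongrightarrow> 0)"
  obtain q :: "nat \<Rightarrow> real poly" where
    q: "uniform_limit {0..onorm P} (\<lambda>n t. poly (q n) t) (\<lambda>t. t powr s) sequentially"
    using exists_polynomials_powr[OF s] by blast
  note bl = bounded_linear_poly_op[OF P] bounded_clinear_bounded[OF Q] bounded_clinear_bounded[OF conjunct1[OF Q']]
  have "(\<lambda>n. onorm (\<lambda>\<phi>. poly_op (q n) P \<phi> - Q \<phi>) + onorm (\<lambda>\<phi>. poly_op (q n) P \<phi> - Q' \<phi>)) \<longlonglongrightarrow> 0 + 0"
    using Q' q by (intro tendsto_add lim) auto
  moreover have "onorm (\<lambda>\<phi>. Q' \<phi> - Q \<phi>)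
      \<le> onorm (\<lambda>\<phi>. poly_op (q n) P \<phi> - Q \<phi>) + onorm (\<lambda>\<phi>. poly_op (q n) P \<phi> - Q' \<phi>)" for n
    using onorm_triangle[of "\<lambda>\<phi>. poly_op (q n) P \<phi> - Q \<phi>" "\<lambda>\<phi>. - (poly_op (q n) P \<phi> - Q' \<phi>)"] bl
    by (simp only: onorm_neg) (simp add: bounded_linear_sub bounded_linear_minus)
  ultimately have "onorm (\<lambda>\<phi>. Q' \<phi> - Q \<phi>) \<le> 0 + 0"
    by (intro LIMSEQ_le_const) auto
  then have "onorm (\<lambda>\<phi>. Q' \<phi> - Q \<phi>) = 0"
    using onorm_pos_le[of "\<lambda>\<phi>. Q' \<phi> - Q \<phi>"] bl by (simp add: bounded_linear_sub)
  then show "Q' = Q"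
    using onorm_eq_0[of "\<lambda>\<phi>. Q' \<phi> - Q \<phi>"] bl by (auto simp: bounded_linear_sub)
qed (use Q lim in auto)

lemma positive_power_1:
  assumes P: "bounded_clinear P" and selfadj: "\<And>\<phi> \<psi>. P \<phi> \<bullet> \<psi> = \<phi> \<bullet> P \<psi>"
    and pos: "\<And>\<phi>. 0 \<le> P \<phi> \<bullet> \<phi>"
  shows "positive_power 1 P = P"
proof (rule positive_power_eqI)
  note P' = bounded_clinear_bounded[OF P]
  fix q :: "nat \<Rightarrow> real poly"
  assume q: "uniform_limit {0..onorm P} (\<lambda>n t. poly (q n) t) (\<lambda>t. t powr 1) sequentially"
  show "(\<lambda>n. onorm (\<lambda>\<phi>. poly_op (q n) P \<phi> - P \<phi>)) \<longlonglongrightarrow> 0"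
  proof (rule onorm_tendsto_0I)
    fix e :: real assume "0 < e"
    from uniform_limitD[OF q this]
    show "\<forall>\<^sub>F n in sequentially. \<forall>\<phi>. norm (poly_op (q n) P \<phi> - P \<phi>) \<le> e * norm \<phi>"
    proof eventually_elim
      case (elim n)
      have "norm (poly_op (q n - [:0, 1:]) P \<phi>) \<le> e * norm \<phi>" for \<phi>
      proof (rule norm_poly_op_le_onorm[OF P' selfadj pos])
        fix t assume "0 \<le> t" "t \<le> onorm P"
        then show "\<bar>poly (q n - [:0, 1:]) t\<bar> \<le> e"
          using elim[rule_format, of t] by (simp add: dist_real_def)
      qed
      then show ?case by (simp add: poly_op_diff poly_op_X[OF P'])
    qed
  qed (intro bounded_linear_sub bounded_linear_poly_op P')
qed (use P bounded_clinear_bounded in auto)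

text \<open>Here $q(P) = q(0)(1 - P) + q(1) P$, so only the values at $0$ and $1$ matter; and $1 \le \|P\|$ unless
  $P = 0$.\<close>

lemma positive_power_idempotent:
  assumes P: "bounded_clinear P" and idem: "\<And>\<phi>. P (P \<phi>) = P \<phi>" and s: "0 < s"
  shows "positive_power s P = P"
proof (rule positive_power_eqI[OF bounded_clinear_bounded[OF P] P s])
  note P' = bounded_clinear_bounded[OF P]
  fix q :: "nat \<Rightarrow> real poly"
  assume q: "uniform_limit {0..onorm P} (\<lambda>n t. poly (q n) t) (\<lambda>t. t powr s) sequentially"
  have eq: "poly_op r P \<phi> = poly r 0 *\<^sub>R (\<phi> - P \<phi>) + poly r 1 *\<^sub>R P \<phi>" for r \<phi>
  proof (induction r)
    case (pCons a r)
    have lin: "linear P" using P' by (rule bounded_linear.linear)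
    show ?case
      by (simp add: poly_op_pCons[OF P'] pCons.IH linear_add[OF lin] linear_diff[OF lin]
          linear_scale[OF lin] idem algebra_simps)
  qed simp
  have q0: "(\<lambda>n. poly (q n) 0) \<longlonglongrightarrow> 0"
    using tendsto_uniform_limitI[OF q, of 0] onorm_pos_le[OF P'] by simp
  have q1: "(\<lambda>n. poly (q n) 1 - 1) \<longlonglongrightarrow> 0" if "P \<noteq> (\<lambda>_. 0)"
  proof -
    obtain \<phi> where "P \<phi> \<noteq> 0" using \<open>P \<noteq> (\<lambda>_. 0)\<close> by auto
    then have "1 \<le> onorm P" using onorm[OF P', of "P \<phi>"] by (simp add: idem)
    then show ?thesis
      using tendsto_diff[OF tendsto_uniform_limitI[OF q, of 1] tendsto_const[of 1]] by simp
  qed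
  have b: "(\<lambda>n. \<bar>poly (q n) 0\<bar> * onorm (\<lambda>\<phi>. \<phi> - P \<phi>) + \<bar>poly (q n) 1 - 1\<bar> * onorm P) \<longlonglongrightarrow> 0"
  proof (cases "P = (\<lambda>_. 0)")
    case True
    then show ?thesis
      using tendsto_mult[OF tendsto_rabs[OF q0] tendsto_const] by (simp add: onorm_zero)
  next
    case False
    from tendsto_add[OF tendsto_mult[OF tendsto_rabs[OF q0] tendsto_const] tendsto_mult[OF tendsto_rabs[OF q1[OF False]] tendsto_const]]
    show ?thesis by simp
  qed
  have I: "bounded_linear (\<lambda>\<phi>. \<phi> - P \<phi>)" by (intro bounded_linear_sub bounded_linear_ident P')
  show "(\<lambda>n. onorm (\<lambda>\<phi>. poly_op (q n) P \<phi> - P \<phi>)) \<longlonglongrightarrow> 0"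
  proof (rule Lim_null_comparison[OF always_eventually b], rule allI)
    fix n
    have "norm (poly_op (q n) P \<phi> - P \<phi>)
        \<le> (\<bar>poly (q n) 0\<bar> * onorm (\<lambda>\<phi>. \<phi> - P \<phi>) + \<bar>poly (q n) 1 - 1\<bar> * onorm P) * norm \<phi>" for \<phi>
    proof -
      have "poly_op (q n) P \<phi> - P \<phi> = poly (q n) 0 *\<^sub>R (\<phi> - P \<phi>) + (poly (q n) 1 - 1) *\<^sub>R P \<phi>"
        by (simp add: eq algebra_simps)
      also have "norm \<dots> \<le> \<bar>poly (q n) 0\<bar> * norm (\<phi> - P \<phi>) + \<bar>poly (q n) 1 - 1\<bar> * norm (P \<phi>)"
        by (rule order_trans[OF norm_triangle_ineq]) simp
      also have "\<dots> \<le> \<bar>poly (q n) 0\<bar> * (onorm (\<lambda>\<phi>. \<phi> - P \<phi>) * norm \<phi>) + \<bar>poly (q n) 1 - 1\<bar> * (onorm P * norm \<phi>)"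
        by (intro add_mono mult_left_mono onorm[OF I] onorm[OF P']) auto
      finally show ?thesis by (simp add: algebra_simps)
    qed
    then have "onorm (\<lambda>\<phi>. poly_op (q n) P \<phi> - P \<phi>)
        \<le> \<bar>poly (q n) 0\<bar> * onorm (\<lambda>\<phi>. \<phi> - P \<phi>) + \<bar>poly (q n) 1 - 1\<bar> * onorm P"
      by (intro onorm_bound) (auto intro!: add_nonneg_nonneg mult_nonneg_nonneg onorm_pos_le I P')
    moreover have "bounded_linear (\<lambda>\<phi>. poly_op (q n) P \<phi> - P \<phi>)"
      by (intro bounded_linear_sub bounded_linear_poly_op P')
    ultimately show "norm (onorm (\<lambda>\<phi>. poly_op (q n) P \<phi> - P \<phi>))
        \<le> \<bar>poly (q n) 0\<bar> * onorm (\<lambda>\<phi>. \<phi> - P \<phi>) + \<bar>poly (q n) 1 - 1\<bar> * onorm P"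
      using onorm_pos_le[of "\<lambda>\<phi>. poly_op (q n) P \<phi> - P \<phi>"] by simp
  qed
qed

section \<open>Hilbert--Schmidt integral operators\<close>

definition kernel_fun :: "((real^2) \<times> (real^2) \<Rightarrow> complex) \<Rightarrow> (real^2 \<Rightarrow> complex) \<Rightarrow> real^2 \<Rightarrow> complex" where
  "kernel_fun k f \<xi> = (\<integral>\<eta>. k (\<xi>, \<eta>) * f \<eta> \<partial>lborel)"

definition kernel_op :: "((real^2) \<times> (real^2) \<Rightarrow> complex) \<Rightarrow> l2 \<Rightarrow> l2" where
  "kernel_op k \<phi> = abs_l2 (kernel_fun k (rep_l2 \<phi>))"

definition kernel_adj :: "((real^2) \<times> (real^2) \<Rightarrow> complex) \<Rightarrow> (real^2) \<times> (real^2) \<Rightarrow> complex" where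
  "kernel_adj k = (\<lambda>(\<xi>, \<eta>). cnj (k (\<eta>, \<xi>)))"

abbreviation "L2_kernel \<equiv> square_integrable (lborel :: ((real^2) \<times> (real^2)) measure)"

lemma square_integrable_mult:
  assumes "square_integrable M f" "square_integrable M g"
  shows "integrable M (\<lambda>x. f x * g x)"
proof -
  have "square_integrable M (\<lambda>x. cnj (g x))"
    using assms(2) by (auto simp: square_integrable_def)
  from square_integrable_mult_cnj[OF assms(1) this] show ?thesis by simp
qed

lemma nn_integral_lborel_prod:
  assumes "F \<in> borel_measurable borel"
  shows "(\<integral>\<^sup>+z. F z \<partial>(lborel :: ('a::euclidean_space \<times> 'b::euclidean_space) measure))
      = (\<integral>\<^sup>+x. (\<integral>\<^sup>+y. F (x, y) \<partial>lborel) \<partial>lborel)"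
    and "(\<integral>\<^sup>+z. F z \<partial>(lborel :: ('a::euclidean_space \<times> 'b::euclidean_space) measure))
      = (\<integral>\<^sup>+y. (\<integral>\<^sup>+x. F (x, y) \<partial>lborel) \<partial>lborel)"
proof -
  have F: "F \<in> borel_measurable (lborel \<Otimes>\<^sub>M lborel)"
    using assms by (simp add: lborel_prod)
  show "(\<integral>\<^sup>+z. F z \<partial>lborel) = (\<integral>\<^sup>+x. (\<integral>\<^sup>+y. F (x, y) \<partial>lborel) \<partial>lborel)"
    unfolding lborel_prod[symmetric] by (rule lborel.nn_integral_fst[OF F, symmetric])
  show "(\<integral>\<^sup>+z. F z \<partial>lborel) = (\<integral>\<^sup>+y. (\<integral>\<^sup>+x. F (x, y) \<partial>lborel) \<partial>lborel)"
    unfolding lborel_prod[symmetric] by (rule lborel_pair.nn_integral_snd[OF F, symmetric])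
qed

lemma square_integrable_prod:
  fixes f :: "'a::euclidean_space \<Rightarrow> complex" and g :: "'b::euclidean_space \<Rightarrow> complex"
  assumes "square_integrable lborel f" "square_integrable lborel g"
  shows "square_integrable (lborel :: ('a \<times> 'b) measure) (\<lambda>(x, y). f x * g y)"
proof -
  have [measurable]: "f \<in> borel_measurable borel" "g \<in> borel_measurable borel"
    using assms by (auto simp: square_integrable_def)
  have m: "(\<lambda>(x, y). f x * g y) \<in> borel_measurable (borel :: ('a \<times> 'b) measure)"
    unfolding borel_prod[symmetric] by measurable
  have "(\<integral>\<^sup>+z. ennreal ((cmod (case z of (x, y) \<Rightarrow> f x * g y))\<^sup>2) \<partial>(lborel :: ('a \<times> 'b) measure))
      = (\<integral>\<^sup>+x. ennreal ((cmod (f x))\<^sup>2) * sq_norm g \<partial>lborel)"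
    using m by (subst nn_integral_lborel_prod(1))
      (auto simp: norm_mult power_mult_distrib ennreal_mult nn_integral_cmult)
  also have "\<dots> = sq_norm f * sq_norm g"
    by (rule nn_integral_multc) auto
  also have "\<dots> < \<infinity>"
    using assms by (auto simp: square_integrable_iff_nn_integral ennreal_mult_less_top)
  finally show ?thesis
    using m by (simp add: square_integrable_iff_nn_integral)
qed

lemma square_integrable_cnj: "square_integrable M f \<Longrightarrow> square_integrable M (\<lambda>x. cnj (f x))"
  by (auto simp: square_integrable_def)

lemma L2_kernel_adj:
  assumes "L2_kernel k"
  shows "L2_kernel (kernel_adj k)"
proof -
  have [measurable]: "k \<in> borel_measurable (borel \<Otimes>\<^sub>M borel)"
    using assms by (simp add: square_integrable_def borel_prod)
  have m: "k \<in> borel_measurable borel" "kernel_adj k \<in> borel_measurable borel"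
    unfolding kernel_adj_def borel_prod[symmetric] by measurable
  then show ?thesis
    using assms nn_integral_lborel_prod(1)[of "\<lambda>z. ennreal ((cmod (k z))\<^sup>2)"]
      nn_integral_lborel_prod(2)[of "\<lambda>z. ennreal ((cmod (kernel_adj k z))\<^sup>2)"]
    by (simp add: square_integrable_iff_nn_integral kernel_adj_def)
qed

context
  fixes k :: "(real^2) \<times> (real^2) \<Rightarrow> complex"
  assumes k: "L2_kernel k"
begin

lemma L2_kernel_measurable [measurable]: "k \<in> borel_measurable (borel \<Otimes>\<^sub>M borel)"
  using k by (simp add: square_integrable_def borel_prod)

lemma nn_integral_L2_kernel:
  "(\<integral>\<^sup>+\<xi>. sq_norm (\<lambda>\<eta>. k (\<xi>, \<eta>)) \<partial>lborel) = sq_norm k"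
  using k by (subst nn_integral_lborel_prod(1)) (auto simp: square_integrable_def)

lemma L2_kernel_finite: "sq_norm k < \<infinity>"
  using k by (simp add: square_integrable_iff_nn_integral)

lemma L2_kernel_sections: "AE \<xi> in lborel. square_integrable lborel (\<lambda>\<eta>. k (\<xi>, \<eta>))"
proof -
  have "AE \<xi> in lborel. sq_norm (\<lambda>\<eta>. k (\<xi>, \<eta>)) \<noteq> \<infinity>"
    by (rule nn_integral_PInf_AE) (use L2_kernel_finite in \<open>auto simp: nn_integral_L2_kernel\<close>)
  then show ?thesis
    by eventually_elim (auto simp: square_integrable_iff_nn_integral top.not_eq_extremum)
qed

lemma kernel_fun_eq_cinner:
  assumes "square_integrable lborel (\<lambda>\<eta>. k (\<xi>, \<eta>))" "square_integrable lborel f"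
  shows "kernel_fun k f \<xi> = cinner (abs_l2 f) (abs_l2 (\<lambda>\<eta>. cnj (k (\<xi>, \<eta>))))"
  using cinner_abs[OF assms(2) square_integrable_cnj[OF assms(1)]]
  by (simp add: kernel_fun_def mult.commute)

lemma kernel_fun_measurable [measurable]:
  assumes [measurable]: "f \<in> borel_measurable borel"
  shows "kernel_fun k f \<in> borel_measurable borel"
  unfolding kernel_fun_def by measurable

text \<open>For almost every $\xi$, the values at $\xi$ of the images of an orthonormal family are its coefficients
  with respect to the section of the kernel at $\xi$, so Bessel's inequality applies pointwise.\<close>

lemma sum_kernel_fun_le:
  assumes F: "finite F" "orthonormal_set F"
  shows "(\<Sum>e\<in>F. \<integral>\<^sup>+\<xi>. ennreal ((cmod (kernel_fun k (rep_l2 e) \<xi>))\<^sup>2) \<partial>lborel)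
      \<le> sq_norm k"
proof -
  have "(\<Sum>e\<in>F. \<integral>\<^sup>+\<xi>. ennreal ((cmod (kernel_fun k (rep_l2 e) \<xi>))\<^sup>2) \<partial>lborel)
      = (\<integral>\<^sup>+\<xi>. (\<Sum>e\<in>F. ennreal ((cmod (kernel_fun k (rep_l2 e) \<xi>))\<^sup>2)) \<partial>lborel)"
    by (rule nn_integral_sum[symmetric]) measurable
  also have "\<dots> \<le> (\<integral>\<^sup>+\<xi>. sq_norm (\<lambda>\<eta>. k (\<xi>, \<eta>)) \<partial>lborel)"
  proof (rule nn_integral_mono_AE)
    show "AE \<xi> in lborel. (\<Sum>e\<in>F. ennreal ((cmod (kernel_fun k (rep_l2 e) \<xi>))\<^sup>2))
        \<le> sq_norm (\<lambda>\<eta>. k (\<xi>, \<eta>))"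
      using L2_kernel_sections
    proof eventually_elim
      case (elim \<xi>)
      let ?k = "\<lambda>\<eta>. cnj (k (\<xi>, \<eta>))"
      have "(\<Sum>e\<in>F. ennreal ((cmod (kernel_fun k (rep_l2 e) \<xi>))\<^sup>2))
          = ennreal (\<Sum>e\<in>F. (cmod (kernel_fun k (rep_l2 e) \<xi>))\<^sup>2)"
        by (rule sum_ennreal) simp
      also have "(\<Sum>e\<in>F. (cmod (kernel_fun k (rep_l2 e) \<xi>))\<^sup>2) = (\<Sum>e\<in>F. (cmod (cinner (abs_l2 ?k) e))\<^sup>2)"
        by (intro sum.cong refl)
           (metis kernel_fun_eq_cinner[OF elim square_integrable_rep_l2] abs_rep_l2 cnj_cinner complex_mod_cnj)
      also have "\<dots> \<le> (norm (abs_l2 ?k))\<^sup>2"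
        by (rule bessel_inequality[OF F])
      also have "ennreal \<dots> = sq_norm (\<lambda>\<eta>. k (\<xi>, \<eta>))"
        by (subst norm_abs_l2[OF square_integrable_cnj[OF elim]]) simp
      finally show ?case by (simp add: ennreal_leI)
    qed
  qed
  finally show ?thesis by (simp only: nn_integral_L2_kernel)
qed

lemma kernel_fun_bound:
  "sq_norm (kernel_fun k (rep_l2 \<phi>))
      \<le> sq_norm k * ennreal ((norm \<phi>)\<^sup>2)"
proof -
  have "sq_norm (kernel_fun k (rep_l2 \<phi>))
      \<le> (\<integral>\<^sup>+\<xi>. sq_norm (\<lambda>\<eta>. k (\<xi>, \<eta>)) * ennreal ((norm \<phi>)\<^sup>2) \<partial>lborel)"
  proof (rule nn_integral_mono_AE)
    show "AE \<xi> in lborel. ennreal ((cmod (kernel_fun k (rep_l2 \<phi>) \<xi>))\<^sup>2)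
        \<le> sq_norm (\<lambda>\<eta>. k (\<xi>, \<eta>)) * ennreal ((norm \<phi>)\<^sup>2)"
      using L2_kernel_sections
    proof eventually_elim
      case (elim \<xi>)
      let ?k = "abs_l2 (\<lambda>\<eta>. cnj (k (\<xi>, \<eta>)))"
      have "(cmod (kernel_fun k (rep_l2 \<phi>) \<xi>))\<^sup>2 \<le> (norm \<phi> * norm ?k)\<^sup>2"
        unfolding kernel_fun_eq_cinner[OF elim square_integrable_rep_l2] abs_rep_l2
        by (intro power_mono cmod_cinner_le) simp
      then have "ennreal ((cmod (kernel_fun k (rep_l2 \<phi>) \<xi>))\<^sup>2) \<le> ennreal ((norm ?k)\<^sup>2) * ennreal ((norm \<phi>)\<^sup>2)"
        by (simp add: ennreal_mult[symmetric] power_mult_distrib mult.commute)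
      then show ?case
        by (subst (asm) norm_abs_l2[OF square_integrable_cnj[OF elim]]) simp
    qed
  qed
  also have "\<dots> = sq_norm k * ennreal ((norm \<phi>)\<^sup>2)"
    by (subst nn_integral_multc) (simp_all add: nn_integral_L2_kernel)
  finally show ?thesis .
qed

lemma square_integrable_kernel_fun: "square_integrable lborel (kernel_fun k (rep_l2 \<phi>))"
  using order.strict_trans1[OF kernel_fun_bound[of \<phi>]] L2_kernel_finite
  by (simp add: square_integrable_iff_nn_integral ennreal_mult_less_top)

lemma norm_kernel_op: 
  "ennreal ((norm (kernel_op k \<phi>))\<^sup>2) = sq_norm (kernel_fun k (rep_l2 \<phi>))"
  unfolding kernel_op_def by (rule norm_abs_l2[OF square_integrable_kernel_fun])

lemma bounded_clinear_kernel_op: "bounded_clinear (kernel_op k)"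
proof (rule bounded_clinearI)
  fix \<phi> \<psi> :: l2 and c :: complex
  have "AE \<xi> in lborel. kernel_fun k (rep_l2 (\<phi> + \<psi>)) \<xi> = kernel_fun k (rep_l2 \<phi>) \<xi> + kernel_fun k (rep_l2 \<psi>) \<xi>"
    using L2_kernel_sections
    by eventually_elim
       (simp add: kernel_fun_eq_cinner[OF _ square_integrable_rep_l2] cinner_add_left)
  then show "kernel_op k (\<phi> + \<psi>) = kernel_op k \<phi> + kernel_op k \<psi>"
    unfolding kernel_op_def
    by (simp add: add_abs_l2 square_integrable_kernel_fun abs_l2_eqI square_integrable_add)
  have "AE \<xi> in lborel. kernel_fun k (rep_l2 (cscale c \<phi>)) \<xi> = c * kernel_fun k (rep_l2 \<phi>) \<xi>"
    using L2_kernel_sections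
    by eventually_elim
       (simp add: kernel_fun_eq_cinner[OF _ square_integrable_rep_l2] cinner_cscale_left)
  then show "kernel_op k (cscale c \<phi>) = cscale c (kernel_op k \<phi>)"
    unfolding kernel_op_def
    by (simp add: cscale_abs_l2 square_integrable_kernel_fun abs_l2_eqI square_integrable_cmult)
  define I where "I = sq_norm k"
  have I: "I = ennreal (enn2real I)" using L2_kernel_finite by (simp add: I_def)
  have "ennreal ((norm (kernel_op k \<phi>))\<^sup>2) \<le> ennreal (enn2real I * (norm \<phi>)\<^sup>2)"
    using kernel_fun_bound[of \<phi>] I unfolding norm_kernel_op I_def[symmetric]
    by (metis enn2real_nonneg ennreal_mult zero_le_power2)
  then have "(norm (kernel_op k \<phi>))\<^sup>2 \<le> (sqrt (enn2real I) * norm \<phi>)\<^sup>2"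
    by (simp add: power_mult_distrib)
  then show "norm (kernel_op k \<phi>) \<le> sqrt (enn2real I) * norm \<phi>"
    by (rule power2_le_imp_le) simp
qed

lemma cinner_kernel_op: 
  "cinner (kernel_op k \<phi>) \<psi> = (\<integral>z. k z * (rep_l2 \<phi> (snd z) * cnj (rep_l2 \<psi> (fst z))) \<partial>lborel)"
  "integrable lborel (\<lambda>z. k z * (rep_l2 \<phi> (snd z) * cnj (rep_l2 \<psi> (fst z))))"
proof -
  have "square_integrable lborel (\<lambda>(x, y). cnj (rep_l2 \<psi> x) * rep_l2 \<phi> y)"
    by (intro square_integrable_prod square_integrable_cnj square_integrable_rep_l2)
  from square_integrable_mult[OF k this]
  show int: "integrable lborel (\<lambda>z. k z * (rep_l2 \<phi> (snd z) * cnj (rep_l2 \<psi> (fst z))))"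
    by (simp add: case_prod_beta mult_ac)
  have "cinner (kernel_op k \<phi>) \<psi> = (\<integral>\<xi>. kernel_fun k (rep_l2 \<phi>) \<xi> * cnj (rep_l2 \<psi> \<xi>) \<partial>lborel)"
    unfolding kernel_op_def
    using cinner_abs[OF square_integrable_kernel_fun square_integrable_rep_l2, of \<phi> \<psi>] by simp
  also have "\<dots> = (\<integral>\<xi>. (\<integral>\<eta>. k (\<xi>, \<eta>) * (rep_l2 \<phi> \<eta> * cnj (rep_l2 \<psi> \<xi>)) \<partial>lborel) \<partial>lborel)"
    unfolding kernel_fun_def by (simp flip: integral_mult_left_zero add: mult.assoc)
  also have "\<dots> = (\<integral>z. k z * (rep_l2 \<phi> (snd z) * cnj (rep_l2 \<psi> (fst z))) \<partial>lborel)"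
    using lborel_pair.integral_fst'[of "\<lambda>z. k z * (rep_l2 \<phi> (snd z) * cnj (rep_l2 \<psi> (fst z)))"] int
    by (simp add: lborel_prod)
  finally show "cinner (kernel_op k \<phi>) \<psi> = \<dots>" .
qed

end

text \<open>Fubini, with the product of the kernel and $\phi \otimes \psi$ as the integrable function.\<close>

lemma cinner_kernel_op_adj:
  assumes "L2_kernel k"
  shows "cinner (kernel_op k \<phi>) \<psi> = cinner \<phi> (kernel_op (kernel_adj k) \<psi>)"
proof -
  note adj = L2_kernel_adj[OF assms]
  let ?f = "\<lambda>z. k z * (rep_l2 \<phi> (snd z) * cnj (rep_l2 \<psi> (fst z)))"
  have "cinner \<phi> (kernel_op (kernel_adj k) \<psi>) = cnj (\<integral>z. kernel_adj k z * (rep_l2 \<psi> (snd z) * cnj (rep_l2 \<phi> (fst z))) \<partial>lborel)"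
    by (simp only: cinner_kernel_op(1)[OF adj, symmetric] cnj_cinner)
  also have "\<dots> = (\<integral>z. ?f (snd z, fst z) \<partial>lborel)"
    unfolding Bochner_Integration.integral_cnj[symmetric]
    by (simp add: kernel_adj_def case_prod_beta mult_ac)
  also have "\<dots> = (\<integral>z. ?f z \<partial>lborel)"
    using lborel_pair.integral_product_swap[of ?f] cinner_kernel_op(2)[OF assms, of \<phi> \<psi>]
    by (simp add: lborel_prod split_beta')
  finally show ?thesis by (simp add: cinner_kernel_op(1)[OF assms])
qed

lemma schatten_pow_2_le:
  assumes A: "bounded_extension A (kernel_op k)" and k: "L2_kernel k"
  shows "schatten_pow 2 A \<le> sq_norm k"
proof -
  let ?T = "kernel_op k" and ?S = "kernel_op (kernel_adj k)"
  note adj = cinner_kernel_op_adj[OF k]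
  have cadj: "cadjoint ?T = ?S"
    by (rule cadjointI) (rule adj)
  have TT: "cinner ((?S \<circ> ?T) \<phi>) \<psi> = cinner (?T \<phi>) (?T \<psi>)" for \<phi> \<psi>
    using arg_cong[OF adj[of \<psi> "?T \<phi>"], of cnj] by (simp add: cnj_cinner)
  have "positive_power 1 (?S \<circ> ?T) = ?S \<circ> ?T"
  proof (rule positive_power_1)
    show "bounded_clinear (?S \<circ> ?T)"
      by (intro bounded_clinear_compose bounded_clinear_kernel_op L2_kernel_adj k)
    show "(?S \<circ> ?T) \<phi> \<bullet> \<psi> = \<phi> \<bullet> (?S \<circ> ?T) \<psi>" for \<phi> \<psi>
      using TT[of \<phi> \<psi>] adj[of \<phi> "?T \<psi>"] by (simp add: inner_l2_def)
    show "0 \<le> (?S \<circ> ?T) \<phi> \<bullet> \<phi>" for \<phi>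
      using TT[of \<phi> \<phi>] by (simp only: inner_l2_def) (simp add: cinner_self)
  qed
  then have "schatten_pow 2 A = positive_trace (?S \<circ> ?T)"
    using schatten_pow_eq[OF A, of 2] cadj by simp
  also have "\<dots> \<le> sq_norm k"
  proof (rule positive_trace_le)
    fix F assume F: "finite F" "orthonormal_set F"
    have "Re (cinner ((?S \<circ> ?T) e) e) = (norm (?T e))\<^sup>2" for e
      by (simp only: TT cinner_self Re_complex_of_real)
    then show "(\<Sum>e\<in>F. ennreal (Re (cinner ((?S \<circ> ?T) e) e))) \<le> sq_norm k"
      using sum_kernel_fun_le[OF k F] by (simp add: norm_kernel_op[OF k] del: comp_apply)
  qed
  finally show ?thesis .
qed

lemma schatten_pow_projection_le:
  assumes A: "bounded_extension A P" and adj: "\<And>\<phi> \<psi>. cinner (P \<phi>) \<psi> = cinner \<phi> (P \<psi>)"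
    and idem: "\<And>\<phi>. P (P \<phi>) = P \<phi>" and r: "0 < r"
  shows "schatten_pow r A = positive_trace P"
proof -
  have "cadjoint P \<circ> P = P"
    using cadjointI[of P P] adj idem by (auto simp: comp_def)
  moreover have "positive_power (r / 2) P = P"
    using A r by (intro positive_power_idempotent idem) (auto simp: bounded_extension_def)
  ultimately show ?thesis using schatten_pow_eq[OF A] by simp
qed

section \<open>Polar coordinates and the action of similitudes on the plane\<close>

lemma borel_measurable_vector2 [measurable]:
  "(\<lambda>(x, y). vector [x, y] :: real^2) \<in> borel_measurable (borel \<Otimes>\<^sub>M borel)"
proof -
  have eq: "(\<lambda>(x, y). vector [x, y] :: real^2) = (\<lambda>z. fst z *\<^sub>R axis 1 1 + snd z *\<^sub>R axis 2 1)"
    by (auto simp: fun_eq_iff vec_eq_iff forall_2 axis_def)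
  show ?thesis unfolding eq by measurable
qed

lemma borel_measurable_vec_nth [measurable]: "(\<lambda>v::real^'n. v $ i) \<in> borel_measurable borel"
  by (intro borel_measurable_continuous_onI continuous_intros)

lemma borel_measurable_fst_comp [measurable (raw)]:
  fixes f :: "'a \<Rightarrow> 'b::topological_space \<times> 'c::topological_space"
  assumes "f \<in> borel_measurable M"
  shows "(\<lambda>x. fst (f x)) \<in> borel_measurable M"
  by (rule measurable_compose[OF assms borel_measurable_continuous_onI]) (intro continuous_intros)

lemma borel_measurable_snd_comp [measurable (raw)]:
  fixes f :: "'a \<Rightarrow> 'b::topological_space \<times> 'c::topological_space"
  assumes "f \<in> borel_measurable M"
  shows "(\<lambda>x. snd (f x)) \<in> borel_measurable M"
  by (rule measurable_compose[OF assms borel_measurable_continuous_onI]) (intro continuous_intros)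

lemma lborel_vec2:
  "(lborel :: (real^2) measure) = distr (lborel :: (real \<times> real) measure) borel (\<lambda>(x, y). vector [x, y])"
proof (rule lborel_eqI)
  fix l u :: "real^2" assume le: "\<And>b. b \<in> Basis \<Longrightarrow> l \<bullet> b \<le> u \<bullet> b"
  have Basis: "(Basis :: (real^2) set) = {axis 1 1, axis 2 1}"
    by (auto simp: Basis_vec_def UNIV_2)
  have le': "l $ 1 \<le> u $ 1" "l $ 2 \<le> u $ 2"
    using le[of "axis 1 1"] le[of "axis 2 1"] by (auto simp: inner_axis Basis)
  have m: "(\<lambda>(x, y). vector [x, y] :: real^2) \<in> measurable lborel borel"
    using borel_measurable_vector2 by (simp add: borel_prod)
  have "(\<lambda>(x, y). vector [x, y]) -` box l u = {l $ 1<..<u $ 1} \<times> {l $ 2<..<u $ 2}"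
    by (auto simp: mem_box Basis inner_axis)
  then have "emeasure (distr lborel borel (\<lambda>(x, y). vector [x, y] :: real^2)) (box l u)
      = emeasure lborel ({l $ 1<..<u $ 1} \<times> {l $ 2<..<u $ 2})"
    by (simp add: emeasure_distr[OF m])
  also have "\<dots> = ennreal (u $ 1 - l $ 1) * ennreal (u $ 2 - l $ 2)"
    unfolding lborel_prod[symmetric] using le' by (subst lborel.emeasure_pair_measure_Times) auto
  also have "\<dots> = (\<Prod>b\<in>Basis. (u - l) \<bullet> b)"
    using le' unfolding Basis
    by (subst prod.insert) (auto simp: axis_eq_axis inner_axis ennreal_mult)
  finally show "emeasure (distr lborel borel (\<lambda>(x, y). vector [x, y] :: real^2)) (box l u)
      = (\<Prod>b\<in>Basis. (u - l) \<bullet> b)" .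
qed simp

lemma nn_integral_vec2:
  assumes "F \<in> borel_measurable borel"
  shows "(\<integral>\<^sup>+v. F v \<partial>(lborel :: (real^2) measure)) = (\<integral>\<^sup>+z. F (vector [fst z, snd z]) \<partial>lborel)"
  using borel_measurable_vector2 assms
  by (subst lborel_vec2) (simp add: nn_integral_distr borel_prod case_prod_beta)

text \<open>Transporting the density \<open>d\<close> along \<open>g\<close> gives a measure; it is Lebesgue measure, because it has the right
  value on boxes by the formula for the measure of a differentiable image.\<close>

lemma nn_integral_change_of_variables:
  fixes g :: "real^'n::{finite,wellorder} \<Rightarrow> real^'n::_"
  assumes S [measurable]: "S \<in> sets borel"
    and der: "\<And>x. x \<in> S \<Longrightarrow> (g has_derivative g' x) (at x within S)" and inj: "inj_on g S"
    and g [measurable]: "g \<in> borel_measurable borel"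
    and d: "\<And>x. x \<in> S \<Longrightarrow> \<bar>det (matrix (g' x))\<bar> = d x" and d_meas [measurable]: "d \<in> borel_measurable borel"
    and img: "- N \<subseteq> g ` S" "N \<inter> g ` S = {}" "N \<in> null_sets lborel"
    and F [measurable]: "F \<in> borel_measurable borel"
  shows "(\<integral>\<^sup>+y. F y \<partial>lborel) = (\<integral>\<^sup>+x. indicator S x * ennreal (d x) * F (g x) \<partial>lborel)"
proof -
  have d0: "0 \<le> d x" if "x \<in> S" for x
    using d[OF that] by (metis abs_ge_zero)
  define M where "M = distr (density lborel (\<lambda>x. indicator S x * ennreal (d x))) borel g"
  have "lborel = M"
  proof (rule lborel_eqI)
    fix l u :: "real^'n::_" assume le: "\<And>b. b \<in> Basis \<Longrightarrow> l \<bullet> b \<le> u \<bullet> b"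
    define S' where "S' = S \<inter> g -` box l u"
    have S' [measurable]: "S' \<in> sets borel"
      unfolding S'_def using measurable_sets[OF g, of "box l u"] by auto
    have img': "g ` S' = box l u - N"
      using img unfolding S'_def by blast
    have N: "N \<in> sets borel" "N \<in> null_sets lebesgue"
      using img(3) by (auto simp: null_sets_def intro: null_sets_completionI)
    have "g ` S' \<in> lmeasurable"
      unfolding img' by (rule bounded_set_imp_lmeasurable) (use N in \<open>auto intro: bounded_subset\<close>)
    moreover have "measure lebesgue (g ` S') = measure lborel (box l u)"
      unfolding img' using N measure_Diff_null_set[of "box l u" lebesgue N] by simp
    ultimately have "((\<lambda>x. \<bar>det (matrix (g' x))\<bar>) has_integral measure lborel (box l u)) S'"
      using has_measure_differentiable_image[of S' g g' "measure lborel (box l u)"]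
        has_derivative_subset[OF der, of _ S'] inj_on_subset[OF inj, of S'] S'
      by (auto simp: S'_def)
    then have "(d has_integral measure lborel (box l u)) S'"
      by (rule has_integral_eq[rotated]) (use d in \<open>auto simp: S'_def\<close>)
    then have I: "((\<lambda>x. indicator S' x * d x) has_integral measure lborel (box l u)) UNIV"
      by (subst (asm) has_integral_restrict_UNIV[symmetric])
         (erule has_integral_eq[rotated], simp add: indicator_def)
    have "(\<integral>\<^sup>+x. ennreal (indicator S' x * d x) \<partial>lborel) = measure lborel (box l u)"
      by (rule nn_integral_has_integral_lborel[OF _ _ I])
         (use d0 in \<open>auto simp: S'_def indicator_def\<close>)
    also have "(\<integral>\<^sup>+x. ennreal (indicator S' x * d x) \<partial>lborel) = emeasure M (box l u)"
      unfolding M_def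
      by (subst emeasure_distr, simp, simp, subst emeasure_density)
         (auto simp: S'_def indicator_def intro!: nn_integral_cong measurable_sets_borel[OF g])
    finally show "emeasure M (box l u) = (\<Prod>b\<in>Basis. (u - l) \<bullet> b)"
      using le by (simp add: measure_def inner_diff_left)
  qed (simp add: M_def)
  then have "(\<integral>\<^sup>+y. F y \<partial>lborel) = (\<integral>\<^sup>+y. F y \<partial>M)" by simp
  also have "\<dots> = (\<integral>\<^sup>+x. indicator S x * ennreal (d x) * F (g x) \<partial>lborel)"
    by (simp add: M_def nn_integral_distr nn_integral_density)
  finally show ?thesis .
qed

text \<open>The map $x \mapsto a R_{-\theta} x$ of the plane through which dilations and rotations act in $\pi$.\<close>

definition act :: "real \<Rightarrow> real \<Rightarrow> real^2 \<Rightarrow> real^2" where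
  "act a \<theta> x = a *\<^sub>R (rot (- \<theta>) *v x)"

lemma act_nth: 
  "act a \<theta> x $ 1 = a * (cos \<theta> * x $ 1 + sin \<theta> * x $ 2)"
  "act a \<theta> x $ 2 = a * (cos \<theta> * x $ 2 - sin \<theta> * x $ 1)"
  by (simp_all add: act_def rot_def matrix_vector_mult_def sum_2 algebra_simps)

lemma norm_vec2: "(norm (x :: real^2))\<^sup>2 = (x $ 1)\<^sup>2 + (x $ 2)\<^sup>2"
  by (simp add: norm_vec_def L2_set_def sum_2)

lemma norm_act: "norm (act a \<theta> x) = \<bar>a\<bar> * norm x"
proof -
  have "(a * (c * x + s * y))\<^sup>2 + (a * (c * y - s * x))\<^sup>2 = a\<^sup>2 * (s\<^sup>2 + c\<^sup>2) * (x\<^sup>2 + y\<^sup>2)"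
    for c s x y :: real by (simp add: power2_eq_square algebra_simps)
  then have "(norm (act a \<theta> x))\<^sup>2 = a\<^sup>2 * ((sin \<theta>)\<^sup>2 + (cos \<theta>)\<^sup>2) * (norm x)\<^sup>2"
    unfolding norm_vec2 act_nth .
  then have "(norm (act a \<theta> x))\<^sup>2 = (\<bar>a\<bar> * norm x)\<^sup>2"
    by (simp add: power_mult_distrib)
  then show ?thesis by (rule power2_eq_imp_eq) simp_all
qed

lemma act_eq: "act a \<theta> x = a *\<^sub>R (cos \<theta> *\<^sub>R x + sin \<theta> *\<^sub>R vector [x $ 2, - x $ 1])"
  by (simp add: vec_eq_iff forall_2 act_nth)

lemma act_act: "act a \<theta> (act b \<tau> x) = act (a * b) (\<theta> + \<tau>) x"
  by (simp add: vec_eq_iff forall_2 act_nth cos_add sin_add algebra_simps)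

lemma act_1: "act 1 0 x = x"
  by (simp add: vec_eq_iff forall_2 act_nth)

lemma borel_measurable_act [measurable (raw)]:
  assumes [measurable]: "a \<in> borel_measurable M" "\<theta> \<in> borel_measurable M" "f \<in> borel_measurable M"
  shows "(\<lambda>z. act (a z) (\<theta> z) (f z)) \<in> borel_measurable M"
proof -
  have "(\<lambda>z. vector [f z $ 2, - f z $ 1] :: real^2) = (\<lambda>z. f z $ 2 *\<^sub>R axis 1 1 + (- f z $ 1) *\<^sub>R axis 2 1)"
    by (auto simp: fun_eq_iff vec_eq_iff forall_2 axis_def)
  then show ?thesis unfolding act_eq by simp
qed

lemma det_matrix_2:
  "det (matrix (f :: real^2 \<Rightarrow> real^2))
     = f (axis 1 1) $ 1 * f (axis 2 1) $ 2 - f (axis 2 1) $ 1 * f (axis 1 1) $ 2"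
  by (simp add: det_2 matrix_def)

lemma nn_integral_act:
  assumes a: "0 < a" and F [measurable]: "F \<in> borel_measurable borel"
  shows "(\<integral>\<^sup>+x. F (act a \<theta> x) \<partial>lborel) = ennreal (1 / a\<^sup>2) * (\<integral>\<^sup>+x. F x \<partial>lborel)"
proof -
  have inv: "act a \<theta> (act (1 / a) (- \<theta>) x) = x" "act (1 / a) (- \<theta>) (act a \<theta> x) = x" for x
    using a by (simp_all add: act_act act_1)
  have lin: "linear (act a \<theta>)"
    by (rule linearI) (simp_all add: vec_eq_iff forall_2 act_nth algebra_simps)
  have "det (matrix (act a \<theta>)) = a\<^sup>2 * ((sin \<theta>)\<^sup>2 + (cos \<theta>)\<^sup>2)"
    unfolding det_matrix_2 act_nth distrib_left by (simp add: axis_def power2_eq_square)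
  then have det: "\<bar>det (matrix (act a \<theta>))\<bar> = a\<^sup>2" by simp
  have "(\<integral>\<^sup>+y. F y \<partial>lborel) = (\<integral>\<^sup>+x. indicator UNIV x * ennreal (a\<^sup>2) * F (act a \<theta> x) \<partial>lborel)"
  proof (rule nn_integral_change_of_variables[where g' = "\<lambda>_. act a \<theta>" and N = "{}"])
    show "(act a \<theta> has_derivative act a \<theta>) (at x within UNIV)" for x
      by (rule bounded_linear_imp_has_derivative) (use lin linear_conv_bounded_linear in blast)
    show "inj_on (act a \<theta>) UNIV" by (metis inv(2) injI)
    show "- {} \<subseteq> act a \<theta> ` UNIV" by (metis inv(1) UNIV_I image_iff subsetI)
  qed (auto simp: det)
  also have "\<dots> = ennreal (a\<^sup>2) * (\<integral>\<^sup>+x. F (act a \<theta> x) \<partial>lborel)"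
    by (simp add: nn_integral_cmult)
  finally show ?thesis
    using a by (simp add: mult.assoc[symmetric] ennreal_mult[symmetric])
qed

text \<open>The orbit map $(a,\theta) \mapsto a R_{-\theta}\xi$ is a bijection of the half strip onto the punctured
  plane with Jacobian $a \|\xi\|^2$: polar coordinates with $\xi$ in place of a unit vector.\<close>

lemma nn_integral_polar:
  assumes \<xi>: "\<xi> \<noteq> 0" and F [measurable]: "F \<in> borel_measurable borel"
  shows "(\<integral>\<^sup>+\<eta>. F \<eta> \<partial>lborel) = (\<integral>\<^sup>+z. indicator ({0<..} \<times> {0..<2 * pi}) z * ennreal (fst z * (norm \<xi>)\<^sup>2)
      * F (act (fst z) (snd z) \<xi>) \<partial>lborel)"
proof -
  define S where "S = {v :: real^2. 0 < v $ 1 \<and> 0 \<le> v $ 2 \<and> v $ 2 < 2 * pi}"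
  define \<xi>' :: "real^2" where "\<xi>' = vector [\<xi> $ 2, - \<xi> $ 1]"
  define g where "g = (\<lambda>v :: real^2. act (v $ 1) (v $ 2) \<xi>)"
  have g: "g v = v $ 1 *\<^sub>R (cos (v $ 2) *\<^sub>R \<xi> + sin (v $ 2) *\<^sub>R \<xi>')" for v
    by (simp add: g_def act_eq \<xi>'_def)
  define g' where "g' = (\<lambda>(v :: real^2) (h :: real^2). v $ 1 *\<^sub>R ((h $ 2 * - sin (v $ 2)) *\<^sub>R \<xi> + (h $ 2 * cos (v $ 2)) *\<^sub>R \<xi>')
      + h $ 1 *\<^sub>R (cos (v $ 2) *\<^sub>R \<xi> + sin (v $ 2) *\<^sub>R \<xi>'))"
  have nth: "((\<lambda>v. v $ i) has_derivative (\<lambda>h. h $ i)) (at v within S)" for i :: 2 and v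
    by (rule bounded_linear_imp_has_derivative) (rule bounded_linear_vec_nth)
  have der: "(g has_derivative g' v) (at v within S)" for v
    unfolding g g'_def by (auto intro!: derivative_eq_intros nth simp: fun_eq_iff algebra_simps)
  have alg: "(c * x + s * y) * (r * (- (c * x) - s * y)) - r * (c * y - s * x) * (c * y - s * x)
      = - (r * (s\<^sup>2 + c\<^sup>2) * (x\<^sup>2 + y\<^sup>2))" for c s r x y :: real
    by (simp add: algebra_simps power2_eq_square)
  have "det (matrix (g' v)) = - (v $ 1 * (norm \<xi>)\<^sup>2)" for v
    unfolding det_matrix_2 norm_vec2 by (simp add: g'_def axis_def \<xi>'_def alg)
  then have det: "\<bar>det (matrix (g' v))\<bar> = v $ 1 * (norm \<xi>)\<^sup>2" if "v \<in> S" for v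
    using that by (simp add: S_def)
  have norm2: "(\<xi> $ 1)\<^sup>2 + (\<xi> $ 2)\<^sup>2 \<noteq> 0"
    unfolding norm_vec2[symmetric] using \<xi> by simp
  have inj: "inj_on g S"
  proof (rule inj_onI)
    fix v w assume v: "v \<in> S" and w: "w \<in> S" and eq: "g v = g w"
    have 1: "v $ 1 = w $ 1"
      using arg_cong[OF eq, of norm] v w \<xi> by (simp add: g_def norm_act S_def)
    define c where "c = cos (v $ 2) - cos (w $ 2)"
    define s where "s = sin (v $ 2) - sin (w $ 2)"
    have "cos (v $ 2) * \<xi> $ 1 + sin (v $ 2) * \<xi> $ 2 = cos (w $ 2) * \<xi> $ 1 + sin (w $ 2) * \<xi> $ 2"
      "cos (v $ 2) * \<xi> $ 2 - sin (v $ 2) * \<xi> $ 1 = cos (w $ 2) * \<xi> $ 2 - sin (w $ 2) * \<xi> $ 1"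
      using arg_cong[OF eq, of "\<lambda>v. v $ 1"] arg_cong[OF eq, of "\<lambda>v. v $ 2"] w 1
      by (simp_all add: g_def act_nth S_def)
    then have e: "c * \<xi> $ 1 + s * \<xi> $ 2 = 0" "c * \<xi> $ 2 - s * \<xi> $ 1 = 0"
      by (simp_all add: c_def s_def algebra_simps)
    have "(c\<^sup>2 + s\<^sup>2) * ((\<xi> $ 1)\<^sup>2 + (\<xi> $ 2)\<^sup>2) = (c * \<xi> $ 1 + s * \<xi> $ 2)\<^sup>2 + (c * \<xi> $ 2 - s * \<xi> $ 1)\<^sup>2"
      by (simp add: power2_eq_square algebra_simps)
    also have "\<dots> = 0" unfolding e by simp
    finally have "c\<^sup>2 + s\<^sup>2 = 0" using norm2 mult_eq_0_iff by blast
    then have "sin (v $ 2) = sin (w $ 2) \<and> cos (v $ 2) = cos (w $ 2)"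
      by (simp add: c_def s_def sum_power2_eq_zero_iff)
    then obtain n :: int where n: "v $ 2 = w $ 2 + 2 * pi * n"
      unfolding sin_cos_eq_iff by blast
    have "\<bar>v $ 2 - w $ 2\<bar> < 2 * pi * 1"
      using v w by (auto simp: S_def abs_if)
    moreover have "\<bar>v $ 2 - w $ 2\<bar> = 2 * pi * \<bar>real_of_int n\<bar>"
      using n by (simp add: abs_mult)
    ultimately have "\<bar>real_of_int n\<bar> < 1"
      by (simp only: mult_less_cancel_left_pos pi_gt_zero zero_less_mult_iff zero_less_numeral simp_thms)
    then have "n = 0" by simp
    then show "v = w" using n 1 by (simp add: vec_eq_iff forall_2)
  qed
  have surj: "- {0} \<subseteq> g ` S"
  proof
    fix \<eta> :: "real^2" assume "\<eta> \<in> - {0}"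
    then have \<eta>: "\<eta> \<noteq> 0" by simp
    define q where "q = norm \<xi> * norm \<eta>"
    define A where "A = \<xi> $ 1 * \<eta> $ 1 + \<xi> $ 2 * \<eta> $ 2"
    define B where "B = \<xi> $ 2 * \<eta> $ 1 - \<xi> $ 1 * \<eta> $ 2"
    have q: "q\<^sup>2 = A\<^sup>2 + B\<^sup>2" "q \<noteq> 0"
      using \<xi> \<eta>
      by (simp_all add: q_def power_mult_distrib norm_vec2) (simp add: A_def B_def power2_eq_square algebra_simps)
    have "(A / q)\<^sup>2 + (B / q)\<^sup>2 = 1"
      unfolding power_divide add_divide_distrib[symmetric] q(1)[symmetric] using q(2) by simp
    then obtain t where t: "0 \<le> t" "t < 2 * pi" "A / q = cos t" "B / q = sin t"
      by (rule sincos_total_2pi)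
    have "(norm \<eta> / norm \<xi>) / q = 1 / (norm \<xi>)\<^sup>2"
      using \<xi> \<eta> by (simp add: q_def power2_eq_square)
    then have r: "norm \<eta> / norm \<xi> * (y / q) = y / (norm \<xi>)\<^sup>2" for y
      by (metis times_divide_eq_right times_divide_eq_left mult.commute mult_1)
    have "g (vector [norm \<eta> / norm \<xi>, t]) $ 1 = norm \<eta> / norm \<xi> * ((A * \<xi> $ 1 + B * \<xi> $ 2) / q)"
      by (simp only: g_def act_nth vector_2 t(3,4)[symmetric] times_divide_eq_left add_divide_distrib[symmetric])
    also have "\<dots> = ((norm \<xi>)\<^sup>2 * \<eta> $ 1) / (norm \<xi>)\<^sup>2"
      unfolding r unfolding norm_vec2 A_def B_def by (simp add: power2_eq_square algebra_simps)
    finally have 1: "g (vector [norm \<eta> / norm \<xi>, t]) $ 1 = \<eta> $ 1" using \<xi> by simp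
    have "g (vector [norm \<eta> / norm \<xi>, t]) $ 2 = norm \<eta> / norm \<xi> * ((A * \<xi> $ 2 - B * \<xi> $ 1) / q)"
      by (simp only: g_def act_nth vector_2 t(3,4)[symmetric] times_divide_eq_left diff_divide_distrib[symmetric])
    also have "\<dots> = ((norm \<xi>)\<^sup>2 * \<eta> $ 2) / (norm \<xi>)\<^sup>2"
      unfolding r unfolding norm_vec2 A_def B_def by (simp add: power2_eq_square algebra_simps)
    finally have 2: "g (vector [norm \<eta> / norm \<xi>, t]) $ 2 = \<eta> $ 2" using \<xi> by simp
    from 1 2 have "g (vector [norm \<eta> / norm \<xi>, t]) = \<eta>"
      by (simp only: vec_eq_iff forall_2 simp_thms)
    moreover have "vector [norm \<eta> / norm \<xi>, t] \<in> S"
      using \<xi> \<eta> t by (simp add: S_def)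
    ultimately show "\<eta> \<in> g ` S" by (metis image_eqI)
  qed
  have "(\<integral>\<^sup>+\<eta>. F \<eta> \<partial>lborel) = (\<integral>\<^sup>+v. indicator S v * ennreal (v $ 1 * (norm \<xi>)\<^sup>2) * F (g v) \<partial>lborel)"
  proof (rule nn_integral_change_of_variables[where g' = g' and N = "{0}"])
    have "norm (g v) \<noteq> 0" if "v \<in> S" for v
      using that \<xi> by (simp add: g_def norm_act S_def)
    then show "{0} \<inter> g ` S = {}" by fastforce
  qed (use der inj surj det in \<open>auto simp: S_def g_def\<close>)
  also have "\<dots> = (\<integral>\<^sup>+z. indicator ({0<..} \<times> {0..<2 * pi}) z * ennreal (fst z * (norm \<xi>)\<^sup>2)
      * F (act (fst z) (snd z) \<xi>) \<partial>lborel)"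
    by (subst nn_integral_vec2) (auto simp: S_def g_def indicator_def intro!: nn_integral_cong)
  finally show ?thesis .
qed

definition polar_measure :: "real^2 \<Rightarrow> (real \<times> real) measure" where
  "polar_measure \<xi> = density lborel
     (\<lambda>z. ennreal (indicator ({0<..} \<times> {0..<2 * pi}) z * (fst z * (norm \<xi>)\<^sup>2)))"

lemma borel_half_strip [measurable]: "{0<..} \<times> {0..<2 * pi} \<in> sets (borel :: (real \<times> real) measure)"
  by (auto simp: borel_prod[symmetric])

lemma distr_polar:
  assumes \<xi>: "\<xi> \<noteq> 0"
  shows "distr (polar_measure \<xi>) borel (\<lambda>z. act (fst z) (snd z) \<xi>) = lborel"
proof (rule measure_eqI)
  fix A assume "A \<in> sets (distr (polar_measure \<xi>) borel (\<lambda>z. act (fst z) (snd z) \<xi>))"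
  then have A [measurable]: "A \<in> sets borel" by simp
  have m: "(\<lambda>z. act (fst z) (snd z) \<xi>) \<in> measurable (polar_measure \<xi>) borel"
    by (simp add: polar_measure_def)
  have "emeasure (distr (polar_measure \<xi>) borel (\<lambda>z. act (fst z) (snd z) \<xi>)) A
      = (\<integral>\<^sup>+y. indicator A y \<partial>distr (polar_measure \<xi>) borel (\<lambda>z. act (fst z) (snd z) \<xi>))"
    by simp
  also have "\<dots> = (\<integral>\<^sup>+z. indicator A (act (fst z) (snd z) \<xi>) \<partial>polar_measure \<xi>)"
    by (rule nn_integral_distr[OF m]) simp
  also have "\<dots> = (\<integral>\<^sup>+z. ennreal (indicator ({0<..} \<times> {0..<2 * pi}) z * (fst z * (norm \<xi>)\<^sup>2))
      * indicator A (act (fst z) (snd z) \<xi>) \<partial>lborel)"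
    unfolding polar_measure_def by (rule nn_integral_density) auto
  also have "\<dots> = (\<integral>\<^sup>+y. indicator A y \<partial>lborel)"
    by (subst nn_integral_polar[OF \<xi>]) (auto simp: indicator_def intro!: nn_integral_cong)
  finally show "emeasure (distr (polar_measure \<xi>) borel (\<lambda>z. act (fst z) (snd z) \<xi>)) A = emeasure lborel A"
    by simp
qed simp

lemma integral_polar:
  fixes F :: "real^2 \<Rightarrow> complex"
  assumes \<xi>: "\<xi> \<noteq> 0" and F [measurable]: "F \<in> borel_measurable borel"
  shows "(\<integral>\<eta>. F \<eta> \<partial>lborel) = (\<integral>z. (indicator ({0<..} \<times> {0..<2 * pi}) z * (fst z * (norm \<xi>)\<^sup>2))
      *\<^sub>R F (act (fst z) (snd z) \<xi>) \<partial>lborel)"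
proof -
  have "(\<integral>\<eta>. F \<eta> \<partial>lborel) = (\<integral>\<eta>. F \<eta> \<partial>distr (polar_measure \<xi>) borel (\<lambda>z. act (fst z) (snd z) \<xi>))"
    by (simp only: distr_polar[OF \<xi>])
  also have "\<dots> = (\<integral>z. F (act (fst z) (snd z) \<xi>) \<partial>polar_measure \<xi>)"
    by (rule integral_distr) (simp_all add: polar_measure_def)
  also have "\<dots> = (\<integral>z. (indicator ({0<..} \<times> {0..<2 * pi}) z * (fst z * (norm \<xi>)\<^sup>2))
      *\<^sub>R F (act (fst z) (snd z) \<xi>) \<partial>lborel)"
    unfolding polar_measure_def by (rule integral_density) (auto simp: indicator_def)
  finally show ?thesis .
qed

section \<open>The integrated representation\<close>

lemma square_integrable_measurable: "square_integrable lborel f \<Longrightarrow> f \<in> borel_measurable borel"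
  unfolding square_integrable_def by simp

lemma square_integrable_finite:
  "square_integrable lborel f \<Longrightarrow> sq_norm f < \<infinity>"
  unfolding square_integrable_iff_nn_integral by (rule conjunct2)

lemma borel_carrier [measurable]: "carrier SIM2 \<in> sets borel"
proof -
  have "carrier SIM2 = {z :: sim2. 0 < fst (snd z) \<and> 0 \<le> snd (snd z) \<and> snd (snd z) < 2 * pi}"
    by (auto simp: SIM2_def)
  then show ?thesis by simp
qed

lemma space_haar: "space haar = carrier SIM2"
  by (simp add: haar_def space_restrict_space)

lemma sets_haar: "sets haar = sets (restrict_space borel (carrier SIM2))"
  by (simp add: haar_def sets_restrict_space)

lemma borel_measurable_haarI: "f \<in> measurable borel N \<Longrightarrow> f \<in> measurable haar N"
  unfolding measurable_cong_sets[OF sets_haar refl] by (rule measurable_restrict_space1)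

lemma measurable_haar_id [measurable]: "(\<lambda>z. z) \<in> measurable haar borel"
  by (rule borel_measurable_haarI) simp

lemma haar_density_measurable: 
  "(\<lambda>(b, a, \<theta>). ennreal (1 / a ^ 3)) \<in> borel_measurable (borel :: sim2 measure)"
proof -
  have "(\<lambda>(b, a, \<theta>). ennreal (1 / a ^ 3)) = (\<lambda>z :: sim2. ennreal (1 / fst (snd z) ^ 3))" by auto
  then show ?thesis by simp
qed

lemma haar_density_measurable': 
  "(\<lambda>(b, a, \<theta>). ennreal (1 / a ^ 3)) \<in> borel_measurable (restrict_space lborel (carrier SIM2))"
  using haar_density_measurable by (intro measurable_restrict_space1) simp

lemma nn_integral_haar:
  assumes [measurable]: "F \<in> borel_measurable borel"
  shows "(\<integral>\<^sup>+z. F z \<partial>haar) = (\<integral>\<^sup>+z. indicator (carrier SIM2) z * ennreal (1 / fst (snd z) ^ 3) * F z \<partial>lborel)"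
proof -
  have "(\<integral>\<^sup>+z. F z \<partial>haar) = (\<integral>\<^sup>+z. (case z of (b, a, \<theta>) \<Rightarrow> ennreal (1 / a ^ 3)) * F z \<partial>restrict_space lborel (carrier SIM2))"
    unfolding haar_def
    by (rule nn_integral_density[OF haar_density_measurable']) (intro measurable_restrict_space1, simp)
  also have "\<dots> = (\<integral>\<^sup>+z. (case z of (b, a, \<theta>) \<Rightarrow> ennreal (1 / a ^ 3)) * F z * indicator (carrier SIM2) z \<partial>lborel)"
    by (subst nn_integral_restrict_space) auto
  also have "\<dots> = (\<integral>\<^sup>+z. indicator (carrier SIM2) z * ennreal (1 / fst (snd z) ^ 3) * F z \<partial>lborel)"
    by (intro nn_integral_cong) (auto simp: mult_ac)
  finally show ?thesis .
qed

lemma integral_haar: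
  fixes F :: "sim2 \<Rightarrow> complex"
  assumes [measurable]: "F \<in> borel_measurable borel"
  shows "(\<integral>z. F z \<partial>haar) = (\<integral>z. (indicator (carrier SIM2) z * (1 / fst (snd z) ^ 3)) *\<^sub>R F z \<partial>lborel)"
proof -
  have eq: "haar = density (restrict_space lborel (carrier SIM2)) (\<lambda>z. ennreal (1 / fst (snd z) ^ 3))"
    unfolding haar_def by (rule arg_cong[where f = "density _"]) auto
  have "(\<integral>z. F z \<partial>haar) = (\<integral>z. (1 / fst (snd z) ^ 3) *\<^sub>R F z \<partial>restrict_space lborel (carrier SIM2))"
    unfolding eq
    by (rule integral_density) (auto intro!: measurable_restrict_space1 AE_I2 simp: space_restrict_space SIM2_def)
  also have "\<dots> = (\<integral>z. indicator (carrier SIM2) z *\<^sub>R ((1 / fst (snd z) ^ 3) *\<^sub>R F z) \<partial>lborel)"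
    by (subst integral_restrict_space) auto
  finally show ?thesis by simp
qed

lemma sigma_finite_haar: "sigma_finite_measure haar"
proof -
  interpret R: sigma_finite_measure "restrict_space lborel (carrier SIM2)"
    by (rule sigma_finite_measure_restrict_space) (auto intro: lborel.sigma_finite_measure_axioms)
  show ?thesis
    unfolding haar_def using haar_density_measurable'
    by (subst R.sigma_finite_iff_density_finite) (auto split: prod.split)
qed

interpretation haar: sigma_finite_measure haar by (rule sigma_finite_haar)

interpretation haar_lborel: pair_sigma_finite haar "lborel :: (real^2) measure" ..

text \<open>The representation on functions rather than on classes, so that Fubini's theorem can be applied
  pointwise.\<close>

definition irrep_fun :: "sim2 \<Rightarrow> (real^2 \<Rightarrow> complex) \<Rightarrow> real^2 \<Rightarrow> complex" where
  "irrep_fun z F \<xi> = of_real (fst (snd z)) * cis (- (fst z \<bullet> \<xi>)) * F (act (fst (snd z)) (snd (snd z)) \<xi>)"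

lemma irrep_eq: "irrep z \<phi> = abs_l2 (irrep_fun z (rep_l2 \<phi>))"
  by (cases z) (simp add: irrep_def irrep_fun_def[abs_def] act_def)

lemma irrep_fun_measurable [measurable (raw)]:
  assumes [measurable]: "F \<in> borel_measurable borel" "f \<in> borel_measurable M" "g \<in> borel_measurable M"
  shows "(\<lambda>x. irrep_fun (f x) F (g x)) \<in> borel_measurable M"
  unfolding irrep_fun_def cis_conv_exp by measurable

lemma nn_integral_irrep_fun:
  assumes [measurable]: "F \<in> borel_measurable borel" and z: "z \<in> carrier SIM2"
  shows "sq_norm (irrep_fun z F) = sq_norm F"
proof -
  obtain b a \<theta> where z: "z = (b, a, \<theta>)" "0 < a"
    using z by (auto simp: SIM2_def)
  have "sq_norm (irrep_fun z F)
      = (\<integral>\<^sup>+\<xi>. ennreal (a\<^sup>2) * ennreal ((cmod (F (act a \<theta> \<xi>)))\<^sup>2) \<partial>lborel)"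
    using z by (simp add: irrep_fun_def norm_mult power_mult_distrib ennreal_mult)
  also have "\<dots> = ennreal (a\<^sup>2) * (ennreal (1 / a\<^sup>2) * sq_norm F)"
    using z by (subst nn_integral_cmult) (auto simp: nn_integral_act[of a "\<lambda>\<xi>. ennreal ((cmod (F \<xi>))\<^sup>2)"])
  also have "\<dots> = sq_norm F"
    using z by (simp add: mult.assoc[symmetric] ennreal_mult[symmetric])
  finally show ?thesis .
qed

lemma square_integrable_irrep_fun:
  assumes F: "square_integrable lborel F" and z: "z \<in> carrier SIM2"
  shows "square_integrable lborel (irrep_fun z F)"
proof -
  have F': "F \<in> borel_measurable borel"
    by (rule square_integrable_measurable[OF F])
  have "(\<lambda>_. z) \<in> borel_measurable borel" "(\<lambda>\<xi>. \<xi>) \<in> borel_measurable borel" by simp_all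
  then have "irrep_fun z F \<in> borel_measurable borel"
    using irrep_fun_measurable[of F "\<lambda>_. z" borel "\<lambda>\<xi>. \<xi>", OF F'] by blast
  then show ?thesis
    using square_integrable_finite[OF F]
    unfolding square_integrable_iff_nn_integral nn_integral_irrep_fun[OF F' z] by simp
qed

text \<open>The integrated representation $\pi(h) = \int h(z) \pi(z)\,d\mu(z)$, on functions.\<close>

definition pi_fun :: "(sim2 \<Rightarrow> complex) \<Rightarrow> (real^2 \<Rightarrow> complex) \<Rightarrow> real^2 \<Rightarrow> complex" where
  "pi_fun h F \<xi> = (\<integral>z. h z * irrep_fun z F \<xi> \<partial>haar)"

definition pi_op :: "(sim2 \<Rightarrow> complex) \<Rightarrow> l2 \<Rightarrow> l2" where
  "pi_op h \<phi> = abs_l2 (pi_fun h (rep_l2 \<phi>))"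

context
  fixes h :: "sim2 \<Rightarrow> complex"
  assumes h_borel [measurable]: "h \<in> borel_measurable borel"
    and h_int: "integrable haar h"
begin

lemma h_measurable_haar [measurable]: "h \<in> borel_measurable haar"
  by (rule borel_measurable_haarI) simp

lemma pi_fun_measurable [measurable]:
  assumes [measurable]: "F \<in> borel_measurable borel"
  shows "pi_fun h F \<in> borel_measurable borel"
proof -
  have "(\<lambda>\<xi>. \<integral>z. h z * irrep_fun z F \<xi> \<partial>haar) \<in> borel_measurable borel"
    by (rule haar.borel_measurable_lebesgue_integral) measurable
  then show ?thesis by (simp add: pi_fun_def[abs_def])
qed

text \<open>Cauchy--Schwarz for the measure $|h|\,d\mu$, then Fubini and unitarity of $\pi$.\<close>

lemma nn_integral_norm_pi_fun_le:
  assumes [measurable]: "F \<in> borel_measurable borel"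
  shows "(\<integral>\<^sup>+\<xi>. (\<integral>\<^sup>+z. ennreal (cmod (h z)) * ennreal (cmod (irrep_fun z F \<xi>)) \<partial>haar)\<^sup>2 \<partial>lborel)
      \<le> (\<integral>\<^sup>+z. ennreal (cmod (h z)) \<partial>haar)\<^sup>2 * sq_norm F"
proof -
  let ?H = "\<integral>\<^sup>+z. ennreal (cmod (h z)) \<partial>haar"
  have "(\<integral>\<^sup>+z. ennreal (cmod (h z)) * ennreal (cmod (irrep_fun z F \<xi>)) \<partial>haar)\<^sup>2
      \<le> ?H * (\<integral>\<^sup>+z. ennreal (cmod (h z)) * ennreal ((cmod (irrep_fun z F \<xi>))\<^sup>2) \<partial>haar)" for \<xi>
  proof -
    \<comment> \<open>Split $|h| \, |\pi(z)F|$ as $|h|^{1/2} \cdot |h|^{1/2} |\pi(z)F|$.\<close>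
    have eq: "ennreal (cmod (h z)) * ennreal (cmod (irrep_fun z F \<xi>))
        = ennreal (sqrt (cmod (h z))) * ennreal (sqrt (cmod (h z)) * cmod (irrep_fun z F \<xi>))" for z
      by (simp add: ennreal_mult[symmetric] mult.assoc[symmetric])
    show ?thesis
      unfolding eq
      by (rule order_trans[OF Cauchy_Schwarz_nn_integral])
         (simp_all add: ennreal_power power_mult_distrib ennreal_mult)
  qed
  then have "(\<integral>\<^sup>+\<xi>. (\<integral>\<^sup>+z. ennreal (cmod (h z)) * ennreal (cmod (irrep_fun z F \<xi>)) \<partial>haar)\<^sup>2 \<partial>lborel)
      \<le> (\<integral>\<^sup>+\<xi>. ?H * (\<integral>\<^sup>+z. ennreal (cmod (h z)) * ennreal ((cmod (irrep_fun z F \<xi>))\<^sup>2) \<partial>haar) \<partial>lborel)"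
    by (intro nn_integral_mono)
  also have "\<dots> = ?H * (\<integral>\<^sup>+\<xi>. (\<integral>\<^sup>+z. ennreal (cmod (h z)) * ennreal ((cmod (irrep_fun z F \<xi>))\<^sup>2) \<partial>haar) \<partial>lborel)"
    by (rule nn_integral_cmult) (rule haar.borel_measurable_nn_integral, measurable)
  also have "(\<integral>\<^sup>+\<xi>. (\<integral>\<^sup>+z. ennreal (cmod (h z)) * ennreal ((cmod (irrep_fun z F \<xi>))\<^sup>2) \<partial>haar) \<partial>lborel)
      = (\<integral>\<^sup>+z. (\<integral>\<^sup>+\<xi>. ennreal (cmod (h z)) * ennreal ((cmod (irrep_fun z F \<xi>))\<^sup>2) \<partial>lborel) \<partial>haar)"
    by (rule haar_lborel.Fubini'[of "\<lambda>z \<xi>. ennreal (cmod (h z)) * ennreal ((cmod (irrep_fun z F \<xi>))\<^sup>2)"]) measurable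
  also have "\<dots> = (\<integral>\<^sup>+z. ennreal (cmod (h z)) * sq_norm F \<partial>haar)"
    by (intro nn_integral_cong) (auto simp: nn_integral_cmult nn_integral_irrep_fun space_haar)
  also have "\<dots> = ?H * sq_norm F"
    by (rule nn_integral_multc) measurable
  finally show ?thesis by (simp add: power2_eq_square mult.assoc)
qed

lemma h_norm_finite: "(\<integral>\<^sup>+z. ennreal (cmod (h z)) \<partial>haar) < \<infinity>"
  using h_int by (simp add: integrable_iff_bounded)

lemma norm_pi_fun_le: "ennreal (cmod (pi_fun h F \<xi>))
      \<le> (\<integral>\<^sup>+z. ennreal (cmod (h z)) * ennreal (cmod (irrep_fun z F \<xi>)) \<partial>haar)"
  unfolding pi_fun_def
  by (cases "integrable haar (\<lambda>z. h z * irrep_fun z F \<xi>)")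
     (auto intro: order_trans[OF integral_norm_bound_ennreal] simp: norm_mult ennreal_mult not_integrable_integral_eq)

lemma pi_fun_bound:
  assumes [measurable]: "F \<in> borel_measurable borel"
  shows "sq_norm (pi_fun h F)
      \<le> (\<integral>\<^sup>+z. ennreal (cmod (h z)) \<partial>haar)\<^sup>2 * sq_norm F"
  by (rule order_trans[OF nn_integral_mono nn_integral_norm_pi_fun_le])
     (auto simp: ennreal_power[symmetric] intro!: power_mono norm_pi_fun_le)

lemma square_integrable_pi_fun:
  assumes "square_integrable lborel F"
  shows "square_integrable lborel (pi_fun h F)"
proof -
  have [measurable]: "F \<in> borel_measurable borel" by (rule square_integrable_measurable[OF assms])
  have "(\<integral>\<^sup>+z. ennreal (cmod (h z)) \<partial>haar)\<^sup>2 * sq_norm F < \<infinity>"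
    using square_integrable_finite[OF assms] h_norm_finite by (auto simp: ennreal_mult_less_top power2_eq_square)
  with pi_fun_bound[of F] have "sq_norm (pi_fun h F) < \<infinity>"
    by (rule order.strict_trans1) simp
  then show ?thesis
    unfolding square_integrable_iff_nn_integral by simp
qed

lemma AE_integrable_pi_fun:
  assumes "square_integrable lborel F"
  shows "AE \<xi> in lborel. integrable haar (\<lambda>z. h z * irrep_fun z F \<xi>)"
proof -
  have [measurable]: "F \<in> borel_measurable borel" by (rule square_integrable_measurable[OF assms])
  let ?I = "\<lambda>\<xi>. \<integral>\<^sup>+z. ennreal (cmod (h z)) * ennreal (cmod (irrep_fun z F \<xi>)) \<partial>haar"
  have "(\<integral>\<^sup>+z. ennreal (cmod (h z)) \<partial>haar)\<^sup>2 * sq_norm F < \<infinity>"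
    using square_integrable_finite[OF assms] h_norm_finite by (auto simp: ennreal_mult_less_top power2_eq_square)
  with nn_integral_norm_pi_fun_le[of F] have "(\<integral>\<^sup>+\<xi>. (?I \<xi>)\<^sup>2 \<partial>lborel) < \<infinity>"
    by (rule order.strict_trans1) simp
  then have fin: "(\<integral>\<^sup>+\<xi>. (?I \<xi>)\<^sup>2 \<partial>lborel) \<noteq> \<infinity>" by simp
  have m: "?I \<in> borel_measurable lborel"
    by (rule haar.borel_measurable_nn_integral) measurable
  have "AE \<xi> in lborel. (?I \<xi>)\<^sup>2 \<noteq> \<infinity>"
    by (rule nn_integral_PInf_AE[OF _ fin]) (use m in measurable)
  then show ?thesis
    by eventually_elim
       (auto simp: integrable_iff_bounded norm_mult ennreal_mult power2_eq_square ennreal_mult_less_top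
         top.not_eq_extremum intro!: borel_measurable_times)
qed

text \<open>The norm bound, applied to the difference, makes $\pi(h)$ well defined on classes.\<close>

lemma pi_fun_cong_AE:
  assumes F: "square_integrable lborel F" and G: "square_integrable lborel G" and eq: "AE \<xi> in lborel. F \<xi> = G \<xi>"
  shows "AE \<xi> in lborel. pi_fun h F \<xi> = pi_fun h G \<xi>"
proof -
  have [measurable]: "F \<in> borel_measurable borel" "G \<in> borel_measurable borel"
    by (rule square_integrable_measurable[OF F] square_integrable_measurable[OF G])+
  have "sq_norm (\<lambda>\<xi>. F \<xi> - G \<xi>) = (\<integral>\<^sup>+\<xi>. 0 \<partial>(lborel :: (real^2) measure))"
    by (rule nn_integral_cong_AE) (use eq in auto)
  then have "sq_norm (\<lambda>\<xi>. pi_fun h (\<lambda>\<xi>. F \<xi> - G \<xi>) \<xi>) = 0"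
    using pi_fun_bound[of "\<lambda>\<xi>. F \<xi> - G \<xi>"] by simp
  then have "AE \<xi> in lborel. ennreal ((cmod (pi_fun h (\<lambda>\<xi>. F \<xi> - G \<xi>) \<xi>))\<^sup>2) = 0"
    by (subst (asm) nn_integral_0_iff_AE) auto
  then show ?thesis
    using AE_integrable_pi_fun[OF F] AE_integrable_pi_fun[OF G]
    by eventually_elim (simp add: pi_fun_def irrep_fun_def right_diff_distrib)
qed

lemma pi_op_abs:
  assumes "square_integrable lborel F"
  shows "pi_op h (abs_l2 F) = abs_l2 (pi_fun h F)"
  unfolding pi_op_def
  by (intro abs_l2_eqI square_integrable_pi_fun pi_fun_cong_AE assms square_integrable_rep_l2 rep_abs_l2)

lemma bounded_clinear_pi_op: "bounded_clinear (pi_op h)"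
proof (rule bounded_clinearI)
  fix \<phi> \<psi> :: l2 and c :: complex
  note sq = square_integrable_rep_l2 square_integrable_add square_integrable_cmult square_integrable_pi_fun
  have "AE \<xi> in lborel. pi_fun h (\<lambda>x. rep_l2 \<phi> x + rep_l2 \<psi> x) \<xi> = pi_fun h (rep_l2 \<phi>) \<xi> + pi_fun h (rep_l2 \<psi>) \<xi>"
    using AE_integrable_pi_fun[OF square_integrable_rep_l2[of \<phi>]] AE_integrable_pi_fun[OF square_integrable_rep_l2[of \<psi>]]
    by eventually_elim (simp add: pi_fun_def irrep_fun_def distrib_left)
  then have "abs_l2 (pi_fun h (\<lambda>x. rep_l2 \<phi> x + rep_l2 \<psi> x)) = pi_op h \<phi> + pi_op h \<psi>"
    unfolding pi_op_def by (simp add: add_abs_l2 sq abs_l2_eqI)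
  moreover have "\<phi> + \<psi> = abs_l2 (\<lambda>x. rep_l2 \<phi> x + rep_l2 \<psi> x)"
    using add_abs_l2[OF square_integrable_rep_l2 square_integrable_rep_l2, of \<phi> \<psi>] by simp
  ultimately show "pi_op h (\<phi> + \<psi>) = pi_op h \<phi> + pi_op h \<psi>"
    by (simp add: pi_op_abs sq)
  have "pi_fun h (\<lambda>x. c * rep_l2 \<phi> x) = (\<lambda>\<xi>. c * pi_fun h (rep_l2 \<phi>) \<xi>)"
    by (simp add: pi_fun_def irrep_fun_def fun_eq_iff mult_ac flip: integral_mult_right_zero)
  moreover have "cscale c \<phi> = abs_l2 (\<lambda>x. c * rep_l2 \<phi> x)"
    using cscale_abs_l2[OF square_integrable_rep_l2, of c \<phi>] by simp
  ultimately have "pi_op h (cscale c \<phi>) = abs_l2 (\<lambda>\<xi>. c * pi_fun h (rep_l2 \<phi>) \<xi>)"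
    by (simp add: pi_op_abs sq)
  also have "\<dots> = cscale c (pi_op h \<phi>)"
    unfolding pi_op_def by (simp add: cscale_abs_l2 sq)
  finally show "pi_op h (cscale c \<phi>) = cscale c (pi_op h \<phi>)" .
  define H where "H = (\<integral>\<^sup>+z. ennreal (cmod (h z)) \<partial>haar)"
  have H: "H = ennreal (enn2real H)" using h_norm_finite by (simp add: H_def)
  have "ennreal ((norm (pi_op h \<phi>))\<^sup>2) = sq_norm (pi_fun h (rep_l2 \<phi>))"
    unfolding pi_op_def by (rule norm_abs_l2[OF square_integrable_pi_fun[OF square_integrable_rep_l2]])
  also have "\<dots> \<le> H\<^sup>2 * ennreal ((norm \<phi>)\<^sup>2)"
    using pi_fun_bound[of "rep_l2 \<phi>"] by (simp add: H_def nn_integral_rep_l2)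
  also have "\<dots> = ennreal ((enn2real H * norm \<phi>)\<^sup>2)"
    by (subst H) (simp add: ennreal_power ennreal_mult power_mult_distrib)
  finally have "(norm (pi_op h \<phi>))\<^sup>2 \<le> (enn2real H * norm \<phi>)\<^sup>2" by simp
  then show "norm (pi_op h \<phi>) \<le> enn2real H * norm \<phi>"
    by (rule power2_le_imp_le) simp
qed

lemma cinner_pi_op: "cinner (pi_op h \<phi>) \<psi> = (\<integral>z. h z * cinner (irrep z \<phi>) \<psi> \<partial>haar)"
proof -
  let ?F = "\<lambda>z \<xi>. h z * irrep_fun z (rep_l2 \<phi>) \<xi> * cnj (rep_l2 \<psi> \<xi>)"
  have m: "(\<lambda>(z, \<xi>). ?F z \<xi>) \<in> borel_measurable (haar \<Otimes>\<^sub>M lborel)" by measurable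
  have "integrable (haar \<Otimes>\<^sub>M lborel) (\<lambda>(z, \<xi>). ?F z \<xi>)"
  proof (rule integrableI_bounded[OF m])
    have "(\<integral>\<^sup>+p. ennreal (norm (case p of (z, \<xi>) \<Rightarrow> ?F z \<xi>)) \<partial>(haar \<Otimes>\<^sub>M lborel))
        = (\<integral>\<^sup>+z. (\<integral>\<^sup>+\<xi>. ennreal (cmod (?F z \<xi>)) \<partial>lborel) \<partial>haar)"
      by (subst lborel.nn_integral_fst[symmetric])
         (rule measurable_compose[OF measurable_compose[OF m borel_measurable_norm] measurable_ennreal], simp)
    also have "\<dots> \<le> (\<integral>\<^sup>+z. ennreal (cmod (h z)) * (ennreal ((norm \<phi>)\<^sup>2) + ennreal ((norm \<psi>)\<^sup>2)) \<partial>haar)"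
    proof (rule nn_integral_mono)
      fix z assume "z \<in> space haar"
      then have z: "z \<in> carrier SIM2" by (simp add: space_haar)
      have "cmod a * cmod b \<le> (cmod a)\<^sup>2 + (cmod b)\<^sup>2" for a b
        using sum_squares_bound[of "cmod a" "cmod b"] mult_nonneg_nonneg[OF norm_ge_zero norm_ge_zero, of a b]
        by linarith
      then have "cmod (?F z \<xi>) \<le> cmod (h z) * ((cmod (irrep_fun z (rep_l2 \<phi>) \<xi>))\<^sup>2 + (cmod (rep_l2 \<psi> \<xi>))\<^sup>2)" for \<xi>
        by (simp add: norm_mult mult.assoc mult_left_mono)
      then have "(\<integral>\<^sup>+\<xi>. ennreal (cmod (?F z \<xi>)) \<partial>lborel)
          \<le> (\<integral>\<^sup>+\<xi>. ennreal (cmod (h z)) * (ennreal ((cmod (irrep_fun z (rep_l2 \<phi>) \<xi>))\<^sup>2) + ennreal ((cmod (rep_l2 \<psi> \<xi>))\<^sup>2)) \<partial>lborel)"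
        by (intro nn_integral_mono) (simp add: ennreal_mult[symmetric] ennreal_plus[symmetric] ennreal_leI del: ennreal_plus)
      also have "\<dots> = ennreal (cmod (h z)) * (ennreal ((norm \<phi>)\<^sup>2) + ennreal ((norm \<psi>)\<^sup>2))"
        by (subst nn_integral_cmult, simp, subst nn_integral_add)
           (simp_all add: nn_integral_irrep_fun[OF _ z] nn_integral_rep_l2)
      finally show "(\<integral>\<^sup>+\<xi>. ennreal (cmod (?F z \<xi>)) \<partial>lborel)
          \<le> ennreal (cmod (h z)) * (ennreal ((norm \<phi>)\<^sup>2) + ennreal ((norm \<psi>)\<^sup>2))" .
    qed
    also have "\<dots> = (\<integral>\<^sup>+z. ennreal (cmod (h z)) \<partial>haar) * (ennreal ((norm \<phi>)\<^sup>2) + ennreal ((norm \<psi>)\<^sup>2))"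
      by (rule nn_integral_multc) measurable
    also have "\<dots> < \<infinity>" using h_norm_finite by (auto simp: ennreal_mult_less_top)
    finally show "(\<integral>\<^sup>+p. ennreal (norm (case p of (z, \<xi>) \<Rightarrow> ?F z \<xi>)) \<partial>(haar \<Otimes>\<^sub>M lborel)) < \<infinity>" .
  qed
  from haar_lborel.Fubini_integral[OF this]
  have "(\<integral>\<xi>. (\<integral>z. ?F z \<xi> \<partial>haar) \<partial>lborel) = (\<integral>z. (\<integral>\<xi>. ?F z \<xi> \<partial>lborel) \<partial>haar)" .
  moreover have "cinner (pi_op h \<phi>) \<psi> = (\<integral>\<xi>. (\<integral>z. ?F z \<xi> \<partial>haar) \<partial>lborel)"
    using cinner_abs[OF square_integrable_pi_fun[OF square_integrable_rep_l2] square_integrable_rep_l2, of \<phi> \<psi>]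
    by (simp add: pi_op_def pi_fun_def)
  moreover have "(\<integral>z. h z * cinner (irrep z \<phi>) \<psi> \<partial>haar) = (\<integral>z. (\<integral>\<xi>. ?F z \<xi> \<partial>lborel) \<partial>haar)"
  proof (rule Bochner_Integration.integral_cong[OF refl])
    fix z assume "z \<in> space haar"
    then have "square_integrable lborel (irrep_fun z (rep_l2 \<phi>))"
      by (intro square_integrable_irrep_fun square_integrable_rep_l2) (simp add: space_haar)
    from cinner_abs[OF this square_integrable_rep_l2, of \<psi>]
    show "h z * cinner (irrep z \<phi>) \<psi> = (\<integral>\<xi>. ?F z \<xi> \<partial>lborel)"
      by (simp add: irrep_eq mult.assoc)
  qed
  ultimately show ?thesis by simp
qed

text \<open>The operator-valued integral $W(f,g)(x,\pi)$ is $\pi(h)$ for $h(x') = f(x') g(x'^{-1} x)$; a bounded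
  operator is determined by its matrix coefficients.\<close>

lemma wigner_Cc_eq_pi_op:
  assumes "\<And>x'. x' \<in> carrier SIM2 \<Longrightarrow> f x' * g (inv\<^bsub>SIM2\<^esub> x' \<otimes>\<^bsub>SIM2\<^esub> x) = h x'"
  shows "wigner_Cc f g x = pi_op h"
proof -
  have eq: "(\<integral>x'. f x' * g (inv\<^bsub>SIM2\<^esub> x' \<otimes>\<^bsub>SIM2\<^esub> x) * cinner (irrep x' \<phi>) \<psi> \<partial>haar) = cinner (pi_op h \<phi>) \<psi>" for \<phi> \<psi>
    unfolding cinner_pi_op by (rule Bochner_Integration.integral_cong) (auto simp: assms space_haar)
  show ?thesis
    unfolding wigner_Cc_def eq
  proof (rule the_equality)
    show "T = pi_op h" if "bounded_clinear T \<and> (\<forall>\<phi> \<psi>. cinner (T \<phi>) \<psi> = cinner (pi_op h \<phi>) \<psi>)" for T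
      using that by (intro ext cinner_right_eqI) blast
  qed (simp add: bounded_clinear_pi_op)
qed

end

section \<open>Fourier transforms on the plane\<close>

lemma integral_vec2:
  fixes F :: "real^2 \<Rightarrow> complex"
  assumes [measurable]: "F \<in> borel_measurable borel"
  shows "(\<integral>v. F v \<partial>lborel) = (\<integral>z. F (vector [fst z, snd z]) \<partial>lborel)"
    and "integrable lborel F \<longleftrightarrow> integrable lborel (\<lambda>z. F (vector [fst z, snd z]))"
proof -
  have m: "(\<lambda>(x, y). vector [x, y]) \<in> measurable (lborel :: (real \<times> real) measure) (borel :: (real^2) measure)"
    using borel_measurable_vector2 by (simp add: borel_prod)
  show "(\<integral>v. F v \<partial>lborel) = (\<integral>z. F (vector [fst z, snd z]) \<partial>lborel)"
    unfolding lborel_vec2 by (subst integral_distr[OF m]) (simp_all add: split_beta')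
  show "integrable lborel F \<longleftrightarrow> integrable lborel (\<lambda>z. F (vector [fst z, snd z]))"
    unfolding lborel_vec2 by (subst integrable_distr_eq[OF m]) (simp_all add: split_beta')
qed

lemma integral_product_vec2:
  fixes p q :: "real \<Rightarrow> complex"
  assumes p: "integrable lborel p" and q: "integrable lborel q"
  shows "integrable lborel (\<lambda>v::real^2. p (v $ 1) * q (v $ 2))"
    and "(\<integral>v. p ((v :: real^2) $ 1) * q (v $ 2) \<partial>lborel) = (\<integral>x. p x \<partial>lborel) * (\<integral>y. q y \<partial>lborel)"
proof -
  have [measurable]: "p \<in> borel_measurable borel" "q \<in> borel_measurable borel"
    using borel_measurable_integrable[OF p] borel_measurable_integrable[OF q] by simp_all
  have m: "(\<lambda>v::real^2. p (v $ 1) * q (v $ 2)) \<in> borel_measurable borel" by measurable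
  have int: "integrable (lborel \<Otimes>\<^sub>M lborel) (\<lambda>(x, y). p x * q y)"
  proof (rule lborel_pair.Fubini_integrable)
    show "integrable lborel (\<lambda>x. \<integral>y. norm (case (x, y) of (x, y) \<Rightarrow> p x * q y) \<partial>lborel)"
      using p by (simp add: norm_mult)
    show "AE x in lborel. integrable lborel (\<lambda>y. case (x, y) of (x, y) \<Rightarrow> p x * q y)"
      using q by simp
  qed measurable
  show "integrable lborel (\<lambda>v::real^2. p (v $ 1) * q (v $ 2))"
    unfolding integral_vec2(2)[OF m] using int by (simp add: lborel_prod split_beta')
  have "(\<integral>v. p ((v :: real^2) $ 1) * q (v $ 2) \<partial>lborel) = (\<integral>z. p (fst z) * q (snd z) \<partial>lborel)"
    unfolding integral_vec2(1)[OF m] by simp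
  also have "\<dots> = (\<integral>x. (\<integral>y. p x * q y \<partial>lborel) \<partial>lborel)"
    using lborel_pair.integral_fst'[OF int] by (simp add: lborel_prod split_beta')
  finally show "(\<integral>v. p ((v :: real^2) $ 1) * q (v $ 2) \<partial>lborel) = (\<integral>x. p x \<partial>lborel) * (\<integral>y. q y \<partial>lborel)"
    by simp
qed

abbreviation unit_square :: "(real^2) set" where
  "unit_square \<equiv> {b. \<bar>b $ 1\<bar> \<le> 1 \<and> \<bar>b $ 2\<bar> \<le> 1}"

lemma emeasure_vec2:
  assumes [measurable]: "A \<in> sets borel" "B \<in> sets borel"
  shows "emeasure lborel {v :: real^2. v $ 1 \<in> A \<and> v $ 2 \<in> B} = emeasure lborel A * emeasure lborel B"
proof -
  have "emeasure lborel {v :: real^2. v $ 1 \<in> A \<and> v $ 2 \<in> B}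
      = (\<integral>\<^sup>+v. indicator {v :: real^2. v $ 1 \<in> A \<and> v $ 2 \<in> B} v \<partial>lborel)"
    by simp
  also have "\<dots> = (\<integral>\<^sup>+z. indicator {v :: real^2. v $ 1 \<in> A \<and> v $ 2 \<in> B} (vector [fst z, snd z]) \<partial>lborel)"
    by (rule nn_integral_vec2) simp
  also have "\<dots> = (\<integral>\<^sup>+z. indicator (A \<times> B) z \<partial>lborel)"
    by (intro nn_integral_cong) (auto simp: indicator_def)
  also have "\<dots> = emeasure (lborel \<Otimes>\<^sub>M lborel) (A \<times> B)"
    by (simp add: lborel_prod borel_Times)
  also have "\<dots> = emeasure lborel A * emeasure lborel B"
    by (rule lborel.emeasure_pair_measure_Times) auto
  finally show ?thesis .
qed

lemma emeasure_unit_square: "emeasure lborel unit_square = 4"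
proof -
  have "unit_square = {v. v $ 1 \<in> {-1..1} \<and> v $ 2 \<in> {-1..1}}" by (auto simp: abs_le_iff)
  then show ?thesis using emeasure_vec2[of "{-1..1}" "{-1..1}"] by (simp add: ennreal_mult[symmetric] del: ennreal_numeral) simp
qed

lemma square_integrable_bounded_supp:
  fixes u :: "real^2 \<Rightarrow> complex"
  assumes u [measurable]: "u \<in> borel_measurable borel" and bd: "\<And>b. cmod (u b) \<le> B"
    and supp: "\<And>b. b \<notin> unit_square \<Longrightarrow> u b = 0"
  shows "sq_norm u \<le> ennreal (4 * B\<^sup>2)" and "square_integrable lborel u"
proof -
  have "sq_norm u \<le> (\<integral>\<^sup>+b. ennreal (B\<^sup>2) * indicator unit_square b \<partial>lborel)"
    using bd supp by (intro nn_integral_mono) (auto simp: indicator_def intro!: ennreal_leI power_mono)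
  also have "\<dots> = ennreal (B\<^sup>2) * emeasure lborel unit_square"
    by (rule nn_integral_cmult_indicator) simp
  also have "\<dots> = ennreal (4 * B\<^sup>2)"
    by (simp add: emeasure_unit_square ennreal_mult mult.commute)
  finally show 1: "sq_norm u \<le> ennreal (4 * B\<^sup>2)" .
  have "ennreal (4 * B\<^sup>2) < \<infinity>" by simp
  with 1 have "sq_norm u < \<infinity>" by (rule order.strict_trans1)
  then show "square_integrable lborel u"
    unfolding square_integrable_iff_nn_integral by simp
qed

definition fourier :: "(real^2 \<Rightarrow> complex) \<Rightarrow> real^2 \<Rightarrow> complex" where
  "fourier u \<xi> = (\<integral>b. u b * cis (- (b \<bullet> \<xi>)) \<partial>lborel)"

lemma inner_vec2: "x \<bullet> (y :: real^2) = x $ 1 * y $ 1 + x $ 2 * y $ 2"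
  by (simp add: inner_vec_def sum_2)

lemma borel_measurable_cis [measurable (raw)]:
  assumes [measurable]: "f \<in> borel_measurable M"
  shows "(\<lambda>x. cis (f x)) \<in> borel_measurable M"
  unfolding cis_conv_exp by measurable

lemma fourier_measurable [measurable]:
  assumes [measurable]: "u \<in> borel_measurable borel"
  shows "fourier u \<in> borel_measurable borel"
proof -
  have "(\<lambda>\<xi>. \<integral>b. u b * cis (- (b \<bullet> \<xi>)) \<partial>lborel) \<in> borel_measurable borel"
    by measurable
  then show ?thesis by (simp add: fourier_def[abs_def])
qed

subsection \<open>The Plancherel inequality\<close>

lemma integral_cis_Icc:
  "integrable lborel (\<lambda>t. indicator {-1..1} t *\<^sub>R cis (pi * real_of_int m * t))"
  "(\<integral>t. indicator {-1..1} t *\<^sub>R cis (pi * real_of_int m * t) \<partial>lborel) = (if m = 0 then 2 else 0)"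
proof -
  have "has_bochner_integral lborel (\<lambda>t. indicator {-1..1} t *\<^sub>R cis (pi * real_of_int m * t)) (if m = 0 then 2 else 0)"
  proof (cases "m = 0")
    case True
    have "has_bochner_integral lborel (\<lambda>t. indicator {-1..1::real} t *\<^sub>R (1::complex)) (of_real 1 - of_real (-1))"
      by (rule has_bochner_integral_FTC_Icc) (auto intro!: derivative_eq_intros)
    then show ?thesis using True by simp
  next
    case False
    define w where "w = pi * real_of_int m"
    have w: "w \<noteq> 0" using False by (simp add: w_def)
    have "has_bochner_integral lborel (\<lambda>t. indicator {-1..1} t *\<^sub>R cis (w * t))
        (cis (w * 1) / (\<i> * of_real w) - cis (w * - 1) / (\<i> * of_real w))"
    proof (rule has_bochner_integral_FTC_Icc)
      show "((\<lambda>t. cis (w * t) / (\<i> * of_real w)) has_vector_derivative cis (w * t)) (at t within {-1..1})" for t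
      proof -
        have "((\<lambda>z. exp (\<i> * of_real w * z) / (\<i> * of_real w)) has_field_derivative
            exp (\<i> * of_real w * of_real t)) (at (of_real t))"
          using w by (auto intro!: derivative_eq_intros)
        from has_vector_derivative_real_field[OF this, of "{-1..1}"] show ?thesis
          by (simp add: cis_conv_exp mult.assoc)
      qed
    qed (auto intro!: continuous_intros)
    moreover have "cis (w * 1) = cis (w * - 1)"
      using sin_int_2pin[of m] sin_npi_int[of m] by (simp add: complex_eq_iff w_def mult.commute)
    ultimately show ?thesis using False by (simp add: w_def)
  qed
  then show "integrable lborel (\<lambda>t. indicator {-1..1} t *\<^sub>R cis (pi * real_of_int m * t))"
    "(\<integral>t. indicator {-1..1} t *\<^sub>R cis (pi * real_of_int m * t) \<partial>lborel) = (if m = 0 then 2 else 0)"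
    by (auto simp: has_bochner_integral_iff)
qed

text \<open>The exponentials with period $2$ in both variables, normalised in $L^2([-1,1]^2)$.\<close>

definition fourier_mode :: "int \<times> int \<Rightarrow> real^2 \<Rightarrow> complex" where
  "fourier_mode k b = (1 / 2) * (indicator {-1..1} (b $ 1) *\<^sub>R cis (pi * real_of_int (fst k) * b $ 1))
     * (indicator {-1..1} (b $ 2) *\<^sub>R cis (pi * real_of_int (snd k) * b $ 2))"

lemma fourier_mode_product:
  "integrable lborel (\<lambda>b. fourier_mode k b * cnj (fourier_mode l b))"
  "(\<integral>b. fourier_mode k b * cnj (fourier_mode l b) \<partial>lborel) = (if k = l then 1 else 0)"
proof -
  let ?p = "\<lambda>m t. indicator {-1..1} t *\<^sub>R cis (pi * real_of_int m * t)"
  have eq: "fourier_mode k b * cnj (fourier_mode l b)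
      = (1 / 4) * (?p (fst k - fst l) (b $ 1) * ?p (snd k - snd l) (b $ 2))" for b
    by (auto simp: fourier_mode_def indicator_def cis_cnj cis_mult algebra_simps)
  note P = integral_product_vec2[OF integral_cis_Icc(1)[of "fst k - fst l"] integral_cis_Icc(1)[of "snd k - snd l"]]
  show "integrable lborel (\<lambda>b. fourier_mode k b * cnj (fourier_mode l b))"
    unfolding eq by (rule integrable_mult_right[OF P(1)])
  show "(\<integral>b. fourier_mode k b * cnj (fourier_mode l b) \<partial>lborel) = (if k = l then 1 else 0)"
    unfolding eq integral_mult_right_zero P(2) integral_cis_Icc(2) by (auto simp: prod_eq_iff)
qed

lemma fourier_mode_measurable [measurable]: "fourier_mode k \<in> borel_measurable borel"
  unfolding fourier_mode_def[abs_def] by measurable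

lemma square_integrable_fourier_mode: "square_integrable lborel (fourier_mode k)"
proof -
  have "integrable lborel (\<lambda>b. of_real ((cmod (fourier_mode k b))\<^sup>2) :: complex)"
    using fourier_mode_product(1)[of k k] by (simp only: complex_norm_square)
  from integrable_Re[OF this] have "integrable lborel (\<lambda>b. (cmod (fourier_mode k b))\<^sup>2)"
    by (simp only: Re_complex_of_real)
  moreover have "fourier_mode k \<in> borel_measurable lborel" by simp
  ultimately show ?thesis
    unfolding square_integrable_def by blast
qed

lemma orthonormal_fourier_modes:
  "cinner (abs_l2 (fourier_mode k)) (abs_l2 (fourier_mode l)) = (if k = l then 1 else 0)"
  using cinner_abs[OF square_integrable_fourier_mode square_integrable_fourier_mode] fourier_mode_product(2)
  by simp

definition lattice_shift :: "int \<times> int \<Rightarrow> real^2" where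
  "lattice_shift k = vector [pi * real_of_int (fst k), pi * real_of_int (snd k)]"

definition cell :: "int \<times> int \<Rightarrow> (real^2) set" where
  "cell k = {\<xi>. \<lfloor>\<xi> $ 1 / pi\<rfloor> = fst k \<and> \<lfloor>\<xi> $ 2 / pi\<rfloor> = snd k}"

lemma cell_measurable [measurable]: "cell k \<in> sets borel"
  unfolding cell_def by measurable

lemma emeasure_cell_0: "emeasure lborel (cell 0) = ennreal (pi\<^sup>2)"
proof -
  have "cell 0 = {v. v $ 1 \<in> {0..<pi} \<and> v $ 2 \<in> {0..<pi}}"
    by (auto simp: cell_def floor_eq_iff field_simps)
  then show ?thesis
    using emeasure_vec2[of "{0..<pi}" "{0..<pi}"] by (simp add: ennreal_mult[symmetric] power2_eq_square)
qed

context
  fixes u :: "real^2 \<Rightarrow> complex"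
  assumes u: "square_integrable lborel u" and supp: "\<And>b. b \<notin> unit_square \<Longrightarrow> u b = 0"
begin

lemma u_measurable [measurable]: "u \<in> borel_measurable borel"
  using u unfolding square_integrable_def by simp

text \<open>The values of $\hat u$ on the lattice $\xi + \pi \mathbb{Z}^2$ are twice the Fourier coefficients of
  $u(b) e^{-i b \cdot \xi}$ on the square that contains its support, so that Bessel's inequality applies.\<close>

lemma sum_fourier_lattice_le:
  assumes "finite K"
  shows "(\<Sum>k\<in>K. ennreal ((cmod (fourier u (\<xi> + lattice_shift k)))\<^sup>2)) \<le> 4 * sq_norm u"
proof -
  define v where "v = (\<lambda>b. u b * cis (- (b \<bullet> \<xi>)))"
  have v: "square_integrable lborel v" "sq_norm v = sq_norm u"
    using u unfolding square_integrable_iff_nn_integral v_def by (simp_all add: norm_mult)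
  have coeff: "fourier u (\<xi> + lattice_shift k) = 2 * cinner (abs_l2 v) (abs_l2 (fourier_mode k))" for k
  proof -
    have "u b * cis (- (b \<bullet> (\<xi> + lattice_shift k))) = 2 * (v b * cnj (fourier_mode k b))" for b
    proof (cases "b \<in> unit_square")
      case True
      then show ?thesis
        by (simp add: v_def fourier_mode_def lattice_shift_def inner_vec2 inner_add_right indicator_def
            cis_cnj cis_mult abs_le_iff algebra_simps)
    next
      case False
      then show ?thesis by (simp add: supp v_def)
    qed
    then show ?thesis
      unfolding cinner_abs[OF v(1) square_integrable_fourier_mode] fourier_def by simp
  qed
  let ?e = "\<lambda>k. abs_l2 (fourier_mode k)"
  have e_eq: "?e k = ?e l \<longleftrightarrow> k = l" for k l
    using orthonormal_fourier_modes[of k l] orthonormal_fourier_modes[of k k] by (auto split: if_splits)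
  then have inj: "inj_on ?e K"
    by (simp add: inj_on_def)
  have "orthonormal_set (?e ` K)"
    unfolding orthonormal_set_def by (auto simp: orthonormal_fourier_modes e_eq)
  from bessel_inequality[OF finite_imageI[OF assms] this, of "abs_l2 v"]
  have "(\<Sum>k\<in>K. (cmod (cinner (abs_l2 v) (?e k)))\<^sup>2) \<le> (norm (abs_l2 v))\<^sup>2"
    by (simp add: sum.reindex[OF inj])
  then have "(\<Sum>k\<in>K. (cmod (fourier u (\<xi> + lattice_shift k)))\<^sup>2) \<le> 4 * (norm (abs_l2 v))\<^sup>2"
    unfolding coeff by (simp add: norm_mult power_mult_distrib flip: sum_distrib_left)
  then have "ennreal (\<Sum>k\<in>K. (cmod (fourier u (\<xi> + lattice_shift k)))\<^sup>2) \<le> ennreal (4 * (norm (abs_l2 v))\<^sup>2)"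
    by (rule ennreal_leI)
  then show ?thesis
    by (simp add: ennreal_mult norm_abs_l2[OF v(1)] v(2))
qed

text \<open>Tile the plane by the translates of a cell of the lattice $\pi \mathbb{Z}^2$, of area $\pi^2$, and sum
  over the lattice before integrating over the cell.\<close>

theorem plancherel_le:
  "sq_norm (fourier u) \<le> ennreal (4 * pi\<^sup>2) * sq_norm u"
proof -
  let ?f = "\<lambda>\<xi>. ennreal ((cmod (fourier u \<xi>))\<^sup>2)" and ?N = "\<integral>\<^sup>+b. ennreal ((cmod (u b))\<^sup>2) \<partial>lborel"
  \<comment> \<open>An enumeration of the lattice, so that sums over it are series.\<close>
  obtain k :: "nat \<Rightarrow> int \<times> int" where k: "bij k"
    using bij_betw_from_nat_into[of "UNIV :: (int \<times> int) set"] by (auto simp: finite_prod)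
  have split: "?f \<xi> = (\<Sum>n. indicator (cell (k n)) \<xi> * ?f \<xi>)" for \<xi>
  proof -
    obtain m where m: "k m = (\<lfloor>\<xi> $ 1 / pi\<rfloor>, \<lfloor>\<xi> $ 2 / pi\<rfloor>)"
      using k by (metis bij_pointE)
    have "indicator (cell (k n)) \<xi> * ?f \<xi> = (if n = m then ?f \<xi> else 0)" for n
      using m k by (auto simp: cell_def indicator_def bij_def inj_eq)
    then show ?thesis using sums_unique[OF sums_single[of m "\<lambda>_. ?f \<xi>"]] by simp
  qed
  have shift: "(\<integral>\<^sup>+\<xi>. indicator (cell l) \<xi> * ?f \<xi> \<partial>lborel)
      = (\<integral>\<^sup>+\<xi>. indicator (cell 0) \<xi> * ?f (\<xi> + lattice_shift l) \<partial>lborel)" for l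
  proof -
    have "(\<integral>\<^sup>+\<xi>. indicator (cell l) \<xi> * ?f \<xi> \<partial>lborel)
        = (\<integral>\<^sup>+\<xi>. indicator (cell l) \<xi> * ?f \<xi> \<partial>distr lborel borel ((+) (lattice_shift l)))"
      by (simp only: lborel_distr_plus)
    also have "\<dots> = (\<integral>\<^sup>+\<xi>. indicator (cell l) (lattice_shift l + \<xi>) * ?f (lattice_shift l + \<xi>) \<partial>lborel)"
      by (rule nn_integral_distr) simp_all
    also have "\<dots> = (\<integral>\<^sup>+\<xi>. indicator (cell 0) \<xi> * ?f (\<xi> + lattice_shift l) \<partial>lborel)"
      by (intro nn_integral_cong)
         (auto simp: cell_def indicator_def lattice_shift_def add.commute add_divide_distrib)
    finally show ?thesis .
  qed
  have "(\<integral>\<^sup>+\<xi>. ?f \<xi> \<partial>lborel) = (\<Sum>n. \<integral>\<^sup>+\<xi>. indicator (cell (k n)) \<xi> * ?f \<xi> \<partial>lborel)"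
    by (subst split, subst nn_integral_suminf) simp_all
  also have "\<dots> = (\<integral>\<^sup>+\<xi>. (\<Sum>n. indicator (cell 0) \<xi> * ?f (\<xi> + lattice_shift (k n))) \<partial>lborel)"
    unfolding shift by (subst nn_integral_suminf) simp_all
  also have "\<dots> \<le> (\<integral>\<^sup>+\<xi>. (4 * ?N) * indicator (cell 0) \<xi> \<partial>lborel)"
  proof (rule nn_integral_mono)
    fix \<xi>
    have "(\<Sum>n. ?f (\<xi> + lattice_shift (k n))) \<le> 4 * ?N"
    proof (rule suminf_le_const)
      fix n
      have "(\<Sum>i<n. ?f (\<xi> + lattice_shift (k i))) = (\<Sum>l\<in>k ` {..<n}. ?f (\<xi> + lattice_shift l))"
        using k by (subst sum.reindex) (auto intro: inj_on_subset simp: bij_def)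
      also have "\<dots> \<le> 4 * ?N" by (rule sum_fourier_lattice_le) simp
      finally show "(\<Sum>i<n. ?f (\<xi> + lattice_shift (k i))) \<le> 4 * ?N" .
    qed simp
    then show "(\<Sum>n. indicator (cell 0) \<xi> * ?f (\<xi> + lattice_shift (k n))) \<le> (4 * ?N) * indicator (cell 0) \<xi>"
      by (simp add: indicator_def)
  qed
  also have "\<dots> = ennreal (4 * pi\<^sup>2) * ?N"
    by (subst nn_integral_cmult_indicator) (simp_all add: emeasure_cell_0 ennreal_mult mult_ac)
  finally show ?thesis .
qed

end

subsection \<open>The hat function\<close>

definition tent :: "real \<Rightarrow> real" where
  "tent t = max 0 (1 - \<bar>t\<bar>)"

text \<open>The Fourier transform of the hat function.  It is nonnegative, so that the terms of
  \<open>lacunary_hat\<close> below cannot cancel.\<close>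

definition tau :: "real \<Rightarrow> real" where
  "tau \<omega> = (\<integral>t. tent t * cos (t * \<omega>) \<partial>lborel)"

lemma tent_nonneg: "0 \<le> tent t"
  by (simp add: tent_def)

lemma tent_le_1: "tent t \<le> 1"
  by (simp add: tent_def)

lemma tent_measurable [measurable]: "tent \<in> borel_measurable borel"
  unfolding tent_def[abs_def] by measurable

lemma tent_cos_Icc:
  fixes \<omega> :: real
  shows "has_bochner_integral lborel (\<lambda>t. indicator {0..1} t *\<^sub>R ((1 - t) * cos (t * \<omega>)))
     (if \<omega> = 0 then 1 / 2 else (1 - cos \<omega>) / \<omega>\<^sup>2)"
proof (cases "\<omega> = 0")
  case True
  have "has_bochner_integral lborel (\<lambda>t. indicator {0..1} t *\<^sub>R (1 - t)) ((1 - 1\<^sup>2 / 2) - (0 - 0\<^sup>2 / 2) :: real)"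
    by (rule has_bochner_integral_FTC_Icc)
       (auto intro!: derivative_eq_intros continuous_intros simp: has_real_derivative_iff_has_vector_derivative[symmetric])
  then show ?thesis using True by simp
next
  case False
  have "has_bochner_integral lborel (\<lambda>t. indicator {0..1} t *\<^sub>R ((1 - t) * cos (t * \<omega>)))
      (((1 - 1) * sin (1 * \<omega>) / \<omega> - cos (1 * \<omega>) / \<omega>\<^sup>2) - ((1 - 0) * sin (0 * \<omega>) / \<omega> - cos (0 * \<omega>) / \<omega>\<^sup>2))"
    by (rule has_bochner_integral_FTC_Icc)
       (use False in \<open>auto intro!: derivative_eq_intros continuous_intros
          simp: has_real_derivative_iff_has_vector_derivative[symmetric] power2_eq_square field_simps\<close>)
  then show ?thesis using False by (simp add: diff_divide_distrib)
qed

text \<open>The closed form $2(1 - \cos\omega)/\omega^2$, which shows nonnegativity: twice the integral over the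
  positive half, by evenness.\<close>

lemma tent_cos: "has_bochner_integral lborel (\<lambda>t. tent t * cos (t * \<omega>))
    (if \<omega> = 0 then 1 else 2 * (1 - cos \<omega>) / \<omega>\<^sup>2)"
proof -
  let ?f = "\<lambda>t. indicator {0..1} t *\<^sub>R ((1 - t) * cos (t * \<omega>))"
  let ?I = "if \<omega> = 0 then 1 / 2 else (1 - cos \<omega>) / \<omega>\<^sup>2"
  have "has_bochner_integral lborel (\<lambda>t. ?f (0 + (-1) * t)) (?I /\<^sub>R \<bar>-1\<bar>)"
    by (rule lborel_has_bochner_integral_real_affine_iff[THEN iffD1, OF _ tent_cos_Icc]) simp
  from has_bochner_integral_add[OF tent_cos_Icc[of \<omega>] this]
  have "has_bochner_integral lborel (\<lambda>t. ?f t + ?f (- t)) (?I + ?I)" by simp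
  moreover have "AE t in lborel. ?f t + ?f (- t) = tent t * cos (t * \<omega>)"
  proof (rule AE_mp[OF AE_lborel_singleton[of 0]], rule AE_I2, rule impI)
    fix t :: real assume "t \<noteq> 0"
    then show "?f t + ?f (- t) = tent t * cos (t * \<omega>)"
      by (auto simp: tent_def indicator_def)
  qed
  ultimately have "has_bochner_integral lborel (\<lambda>t. tent t * cos (t * \<omega>)) (?I + ?I)"
    by (subst has_bochner_integral_cong_AE[symmetric]) auto
  moreover have "?I + ?I = (if \<omega> = 0 then 1 else 2 * (1 - cos \<omega>) / \<omega>\<^sup>2)" by simp
  ultimately show ?thesis by simp
qed

lemma tau_0: "tau 0 = 1" and tau_eq: "\<omega> \<noteq> 0 \<Longrightarrow> tau \<omega> = 2 * (1 - cos \<omega>) / \<omega>\<^sup>2"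
  using tent_cos[of 0] tent_cos[of \<omega>] unfolding tau_def by (auto simp: has_bochner_integral_iff)

lemma integrable_tent_cos: "integrable lborel (\<lambda>t. tent t * cos (t * \<omega>))"
  using tent_cos by (auto simp: has_bochner_integral_iff)

lemma integrable_tent: "integrable lborel tent" and integral_tent: "(\<integral>t. tent t \<partial>lborel) = 1"
  using integrable_tent_cos[of 0] tau_0 by (auto simp: tau_def)

lemma tau_nonneg: "0 \<le> tau \<omega>"
  by (cases "\<omega> = 0") (simp_all add: tau_0 tau_eq)

lemma tau_le_1: "tau \<omega> \<le> 1"
  unfolding tau_def integral_tent[symmetric]
  by (intro integral_mono integrable_tent integrable_tent_cos)
     (metis cos_le_one mult.right_neutral mult_left_mono tent_nonneg)

lemma tau_ge_half:
  assumes "\<bar>\<omega>\<bar> \<le> 1"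
  shows "1 / 2 \<le> tau \<omega>"
proof -
  have "(\<integral>t. tent t * (1 / 2) \<partial>lborel) \<le> (\<integral>t. tent t * cos (t * \<omega>) \<partial>lborel)"
  proof (intro integral_mono integrable_tent_cos)
    fix t :: real
    show "tent t * (1 / 2) \<le> tent t * cos (t * \<omega>)"
    proof (cases "\<bar>t\<bar> \<le> 1")
      case True
      then have "\<bar>t * \<omega>\<bar> \<le> 1" using assms by (simp add: abs_mult mult_le_one)
      then have "cos (pi / 3) \<le> cos \<bar>t * \<omega>\<bar>"
        using pi_gt3 by (intro cos_monotone_0_pi_le) auto
      then have "1 / 2 \<le> cos (t * \<omega>)" by (simp add: cos_60)
      then show ?thesis by (intro mult_left_mono tent_nonneg)
    qed (simp add: tent_def)
  qed (use integrable_tent in simp)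
  then show ?thesis by (simp add: tau_def integral_tent)
qed

lemma tent_fourier:
  "integrable lborel (\<lambda>t. of_real (tent t) * cis (- (t * \<omega>)))"
  "(\<integral>t. of_real (tent t) * cis (- (t * \<omega>)) \<partial>lborel) = of_real (tau \<omega>)"
proof -
  have s: "integrable lborel (\<lambda>t. tent t * sin (t * \<omega>))"
  proof (rule Bochner_Integration.integrable_bound[OF integrable_tent])
    show "AE t in lborel. norm (tent t * sin (t * \<omega>)) \<le> norm (tent t)"
      by (auto simp: abs_mult intro!: AE_I2 mult_left_le)
  qed simp
  have "(\<integral>t. tent t * sin (t * \<omega>) \<partial>lborel) = (\<integral>t. tent (- t) * sin (- t * \<omega>) \<partial>lborel)"
    using lborel_integral_real_affine[of "-1" "\<lambda>t. tent t * sin (t * \<omega>)" 0] by simp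
  also have "\<dots> = - (\<integral>t. tent t * sin (t * \<omega>) \<partial>lborel)"
    by (simp add: tent_def)
  finally have s0: "(\<integral>t. tent t * sin (t * \<omega>) \<partial>lborel) = 0" by simp
  have eq: "complex_of_real (tent t) * cis (- (t * \<omega>))
      = of_real (tent t * cos (t * \<omega>)) - \<i> * of_real (tent t * sin (t * \<omega>))" for t
    by (simp add: complex_eq_iff)
  note int = integrable_of_real[OF integrable_tent_cos[of \<omega>], where 'a = complex]
    integrable_mult_right[OF integrable_of_real[OF s, where 'a = complex], of "\<i>"]
  show "integrable lborel (\<lambda>t. complex_of_real (tent t) * cis (- (t * \<omega>)))"
    unfolding eq by (intro Bochner_Integration.integrable_diff int)
  have "(\<integral>t. of_real (tent t) * cis (- (t * \<omega>)) \<partial>lborel)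
      = (\<integral>t. of_real (tent t * cos (t * \<omega>)) \<partial>lborel) - (\<integral>t. \<i> * of_real (tent t * sin (t * \<omega>)) \<partial>lborel)"
    unfolding eq by (intro Bochner_Integration.integral_diff int)
  also have "\<dots> = of_real (tau \<omega>)"
    by (simp only: integral_mult_right_zero integral_complex_of_real s0 tau_def) simp
  finally show "(\<integral>t. of_real (tent t) * cis (- (t * \<omega>)) \<partial>lborel) = of_real (tau \<omega>)" .
qed

subsection \<open>A lacunary function\<close>

text \<open>A function of Weierstrass type: continuous with compact support, but with frequencies $2^n$ whose
  amplitudes $r^n$ decay slowly when $r$ is close to $1$.\<close>

definition lacunary :: "real \<Rightarrow> real^2 \<Rightarrow> complex" where
  "lacunary r b = of_real (tent (b $ 1) * tent (b $ 2)) * (\<Sum>n. of_real (r ^ n) * cis (2 ^ n * b $ 1))"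

definition lacunary_hat :: "real \<Rightarrow> real^2 \<Rightarrow> real" where
  "lacunary_hat r \<xi> = (\<Sum>n. r ^ n * (tau (\<xi> $ 1 - 2 ^ n) * tau (\<xi> $ 2)))"

context
  fixes r :: real
  assumes r: "0 < r" "r < 1"
begin

lemma summable_r: "summable (\<lambda>n. r ^ n)"
  using r by (intro summable_geometric) simp

lemma summable_lacunary: "summable (\<lambda>n. complex_of_real (r ^ n) * cis (2 ^ n * t))"
  by (rule summable_comparison_test'[OF summable_r]) (use r in \<open>simp add: norm_mult norm_power\<close>)

lemma continuous_lacunary: "continuous_on UNIV (lacunary r)"
proof -
  have "uniform_limit UNIV (\<lambda>n t. \<Sum>i<n. complex_of_real (r ^ i) * cis (2 ^ i * t))
      (\<lambda>t. \<Sum>i. complex_of_real (r ^ i) * cis (2 ^ i * t)) sequentially"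
    by (rule Weierstrass_m_test[OF _ summable_r]) (use r in \<open>simp add: norm_mult norm_power\<close>)
  then have cont: "continuous_on UNIV (\<lambda>t. \<Sum>i. complex_of_real (r ^ i) * cis (2 ^ i * t))"
    by (rule uniform_limit_theorem[rotated]) (auto intro!: always_eventually continuous_intros)
  have "continuous_on UNIV (\<lambda>b::real^2. \<Sum>i. complex_of_real (r ^ i) * cis (2 ^ i * b $ 1))"
    by (rule continuous_on_compose2[OF cont]) (auto intro!: continuous_intros)
  then show ?thesis
    unfolding lacunary_def[abs_def] tent_def by (intro continuous_intros)
qed

lemma lacunary_measurable [measurable]: "lacunary r \<in> borel_measurable borel"
  by (rule borel_measurable_continuous_onI[OF continuous_lacunary])

lemma norm_lacunary_le: "cmod (lacunary r b) \<le> 1 / (1 - r)"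
proof -
  have "cmod (\<Sum>n. of_real (r ^ n) * cis (2 ^ n * b $ 1)) \<le> (\<Sum>n. cmod (of_real (r ^ n) * cis (2 ^ n * b $ 1)))"
    by (rule summable_norm) (use r summable_r in \<open>simp add: norm_mult norm_power\<close>)
  also have "\<dots> = 1 / (1 - r)"
    using r by (simp add: norm_mult norm_power suminf_geometric)
  finally have 1: "cmod (\<Sum>n. of_real (r ^ n) * cis (2 ^ n * b $ 1)) \<le> 1 / (1 - r)" .
  have "tent (b $ 1) * tent (b $ 2) \<le> 1"
    by (intro mult_le_one tent_le_1 tent_nonneg)
  then have "cmod (lacunary r b) \<le> 1 * cmod (\<Sum>n. of_real (r ^ n) * cis (2 ^ n * b $ 1))"
    unfolding lacunary_def norm_mult[of "of_real (tent (b $ 1) * tent (b $ 2))"]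
    by (intro mult_right_mono) (simp_all add: tent_nonneg norm_mult)
  then show ?thesis using 1 by simp
qed

lemma lacunary_supp: "b \<notin> unit_square \<Longrightarrow> lacunary r b = 0"
  by (auto simp: lacunary_def tent_def)

lemma summable_lacunary_hat: "summable (\<lambda>n. r ^ n * (tau (x - 2 ^ n) * tau y))"
proof (rule summable_comparison_test'[OF summable_r])
  fix n
  have "tau (x - 2 ^ n) * tau y \<le> 1" by (intro mult_le_one tau_le_1 tau_nonneg)
  then show "norm (r ^ n * (tau (x - 2 ^ n) * tau y)) \<le> r ^ n"
    using r tau_nonneg by (simp add: abs_mult mult_left_le)
qed

text \<open>Modulation by $e^{i 2^n b_1}$ shifts the Fourier transform by $2^n$ in the first variable.\<close>

lemma fourier_lacunary: "fourier (lacunary r) \<xi> = of_real (lacunary_hat r \<xi>)"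
proof -
  define f where "f n b = complex_of_real (r ^ n) * ((of_real (tent (b $ 1)) * cis (- (b $ 1 * (\<xi> $ 1 - 2 ^ n))))
    * (of_real (tent (b $ 2)) * cis (- (b $ 2 * \<xi> $ 2))))" for n and b :: "real^2"
  note P = integral_product_vec2[OF tent_fourier(1) tent_fourier(1)]
  have int: "integrable lborel (f n)" for n
    unfolding f_def by (rule integrable_mult_right[OF P(1)])
  have norm_f: "cmod (f n b) = r ^ n * (tent (b $ 1) * tent (b $ 2))" for n b
    using r by (simp add: f_def norm_mult norm_power tent_nonneg)
  have "(\<lambda>n. \<integral>b. f n b \<partial>lborel) sums (\<integral>b. (\<Sum>n. f n b) \<partial>lborel)"
  proof (rule sums_integral[OF int])
    show "AE b in lborel. summable (\<lambda>n. norm (f n b))"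
      unfolding norm_f using summable_mult2[OF summable_r] by simp
    show "summable (\<lambda>n. \<integral>b. norm (f n b) \<partial>lborel)"
      unfolding norm_f using summable_mult2[OF summable_r] by simp
  qed
  moreover have "(\<integral>b. f n b \<partial>lborel) = of_real (r ^ n * (tau (\<xi> $ 1 - 2 ^ n) * tau (\<xi> $ 2)))" for n
    unfolding f_def integral_mult_right_zero P(2) tent_fourier(2) by simp
  ultimately have "(\<lambda>n. complex_of_real (r ^ n * (tau (\<xi> $ 1 - 2 ^ n) * tau (\<xi> $ 2)))) sums (\<integral>b. (\<Sum>n. f n b) \<partial>lborel)"
    by simp
  moreover have "(\<lambda>n. complex_of_real (r ^ n * (tau (\<xi> $ 1 - 2 ^ n) * tau (\<xi> $ 2)))) sums of_real (lacunary_hat r \<xi>)"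
    unfolding sums_of_real_iff lacunary_hat_def by (rule summable_sums[OF summable_lacunary_hat])
  ultimately have "(\<integral>b. (\<Sum>n. f n b) \<partial>lborel) = of_real (lacunary_hat r \<xi>)"
    by (rule sums_unique2)
  moreover have "lacunary r b * cis (- (b \<bullet> \<xi>)) = (\<Sum>n. f n b)" for b
  proof -
    let ?c = "of_real (tent (b $ 1) * tent (b $ 2)) * cis (- (b \<bullet> \<xi>))"
    have "f n b = ?c * (of_real (r ^ n) * cis (2 ^ n * b $ 1))" for n
      unfolding f_def inner_vec2 by (simp add: cis_mult mult_ac) (simp add: cis_mult algebra_simps)
    then have "(\<Sum>n. f n b) = ?c * (\<Sum>n. of_real (r ^ n) * cis (2 ^ n * b $ 1))"
      using suminf_mult[OF summable_lacunary, of ?c "b $ 1"] by simp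
    then show ?thesis by (simp add: lacunary_def mult_ac)
  qed
  ultimately show ?thesis by (simp add: fourier_def)
qed

lemma lacunary_hat_ge:
  assumes "\<xi> $ 1 \<in> {2 ^ n..2 ^ n + 1}" "\<xi> $ 2 \<in> {0..1}"
  shows "r ^ n / 4 \<le> lacunary_hat r \<xi>"
proof -
  have "1 / 2 * (1 / 2) \<le> tau (\<xi> $ 1 - 2 ^ n) * tau (\<xi> $ 2)"
    by (intro mult_mono tau_ge_half) (use assms tau_nonneg in auto)
  then have "r ^ n / 4 \<le> r ^ n * (tau (\<xi> $ 1 - 2 ^ n) * tau (\<xi> $ 2))"
    using r mult_left_mono[of "1 / 4" _ "r ^ n"] by simp
  also have "\<dots> = (\<Sum>i\<in>{n}. r ^ i * (tau (\<xi> $ 1 - 2 ^ i) * tau (\<xi> $ 2)))" by simp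
  also have "\<dots> \<le> lacunary_hat r \<xi>"
    unfolding lacunary_hat_def
    by (rule sum_le_suminf[OF summable_lacunary_hat]) (use r tau_nonneg in auto)
  finally show ?thesis .
qed

end

section \<open>Amplitudes independent of the angle\<close>

abbreviation half_strip :: "(real \<times> real) set" where
  "half_strip \<equiv> {0<..} \<times> {0..<2 * pi}"

text \<open>An amplitude $G(b,a)$ stands for the function $(b,a,\theta) \mapsto G(b,a)$ on the group.  The support in
  $[-1,1]^2 \times [1,2]$ makes the scales of $\xi$ and $a R_{-\theta} \xi$ comparable.\<close>

definition amplitude :: "real \<Rightarrow> ((real^2) \<times> real \<Rightarrow> complex) \<Rightarrow> bool" where
  "amplitude M G \<longleftrightarrow> G \<in> borel_measurable borel \<and> (\<forall>z. cmod (G z) \<le> M) \<and>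
     (\<forall>b a. b \<notin> unit_square \<or> a \<notin> {1..2} \<longrightarrow> G (b, a) = 0)"

definition lift_amp :: "((real^2) \<times> real \<Rightarrow> complex) \<Rightarrow> sim2 \<Rightarrow> complex" where
  "lift_amp G z = G (fst z, fst (snd z))"

definition amp_hat :: "((real^2) \<times> real \<Rightarrow> complex) \<Rightarrow> real^2 \<Rightarrow> real \<Rightarrow> complex" where
  "amp_hat G \<xi> a = fourier (\<lambda>b. G (b, a)) \<xi>"

text \<open>The kernel of $\pi(h) K_\pi^{1/2}$ for $h(b,a,\theta) = G(b,a)$, obtained from the substitution
  $\eta = a R_{-\theta} \xi$.\<close>

definition amp_kernel :: "((real^2) \<times> real \<Rightarrow> complex) \<Rightarrow> (real^2) \<times> (real^2) \<Rightarrow> complex" where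
  "amp_kernel G = (\<lambda>(\<xi>, \<eta>). amp_hat G \<xi> (norm \<eta> / norm \<xi>) * of_real (norm \<xi> / (norm \<eta>)\<^sup>2))"

lemma borel_measurable_ennreal_cmod:
  assumes "f \<in> borel_measurable M"
  shows "(\<lambda>x. ennreal (cmod (f x))) \<in> borel_measurable M"
  using assms by measurable

lemma borel_measurable_polar_integrand:
  assumes [measurable]: "\<Phi> \<in> borel_measurable borel"
  shows "(\<lambda>z. indicator half_strip z * ennreal (fst z * c) * (\<Phi> (act (fst z) (snd z) \<xi>) :: ennreal)) \<in> borel_measurable borel"
  by measurable

lemma borel_measurable_lift_irrep:
  assumes h: "h \<in> borel_measurable borel" and F: "F \<in> borel_measurable borel"
  shows "(\<lambda>z. h z * irrep_fun z F \<xi>) \<in> borel_measurable borel"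
proof -
  have "(\<lambda>z. z) \<in> borel_measurable (borel :: sim2 measure)" "(\<lambda>z. \<xi>) \<in> borel_measurable (borel :: sim2 measure)"
    by simp_all
  from irrep_fun_measurable[of F "\<lambda>z. z" borel "\<lambda>z. \<xi>", OF F this] show ?thesis
    by (rule borel_measurable_times[OF h])
qed

lemma borel_measurable_fourier_comp:
  fixes U :: "'a \<Rightarrow> real^2 \<Rightarrow> complex"
  assumes [measurable]: "(\<lambda>(x, b). U x b) \<in> borel_measurable (M \<Otimes>\<^sub>M lborel)" "\<xi> \<in> borel_measurable M"
  shows "(\<lambda>x. fourier (U x) (\<xi> x)) \<in> borel_measurable M"
  unfolding fourier_def by measurable

lemma square_integrable_on_ball_finite:
  assumes F: "square_integrable lborel F"
  shows "(\<integral>\<^sup>+\<eta>. indicator (cball 0 R) \<eta> * ennreal (cmod (F \<eta>)) \<partial>(lborel :: (real^2) measure)) < \<infinity>"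
proof -
  have [measurable]: "F \<in> borel_measurable borel" by (rule square_integrable_measurable[OF F])
  have [measurable]: "cball (0 :: real^2) R \<in> sets borel" by simp
  have b: "x \<le> 1 + x\<^sup>2" for x :: real
    using zero_le_power2[of "x - 1 / 2"] by (simp add: power2_eq_square algebra_simps)
  have b': "ennreal x \<le> 1 + ennreal (x\<^sup>2)" for x
  proof -
    have "ennreal x \<le> ennreal (1 + x\<^sup>2)" by (rule ennreal_leI[OF b])
    also have "\<dots> = ennreal 1 + ennreal (x\<^sup>2)" by (rule ennreal_plus) simp_all
    finally show ?thesis by (simp only: ennreal_1)
  qed
  have "(\<integral>\<^sup>+\<eta>. indicator (cball 0 R) \<eta> * ennreal (cmod (F \<eta>)) \<partial>(lborel :: (real^2) measure))
      \<le> (\<integral>\<^sup>+\<eta>. indicator (cball 0 R) \<eta> + ennreal ((cmod (F \<eta>))\<^sup>2) \<partial>lborel)"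
    by (intro nn_integral_mono) (auto simp: indicator_def b')
  also have "\<dots> = emeasure lborel (cball (0 :: real^2) R) + sq_norm F"
    by (subst nn_integral_add) simp_all
  also have "\<dots> < \<infinity>"
    using square_integrable_finite[OF F] emeasure_bounded_finite[of "cball (0 :: real^2) R"] by simp
  finally show ?thesis .
qed

context
  fixes G :: "(real^2) \<times> real \<Rightarrow> complex" and M :: real
  assumes G: "amplitude M G"
begin

lemma amp_borel [measurable]: "G \<in> borel_measurable borel"
  and amp_le: "cmod (G z) \<le> M"
  and amp_0: "b \<notin> unit_square \<or> a \<notin> {1..2} \<Longrightarrow> G (b, a) = 0"
  using G unfolding amplitude_def by blast+

lemma amp_pair:
  assumes "f \<in> borel_measurable N" "g \<in> borel_measurable N"
  shows "(\<lambda>x. G (f x, g x)) \<in> borel_measurable N"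
  by (rule measurable_compose[OF borel_measurable_Pair[OF assms] amp_borel])

lemma M_nonneg: "0 \<le> M"
  using amp_le[of undefined] norm_ge_zero order_trans by blast

lemma lift_amp_borel: "lift_amp G \<in> borel_measurable borel"
  unfolding lift_amp_def[abs_def] by (rule amp_pair) measurable

lemma amp_hat_borel [measurable (raw)]:
  assumes [measurable]: "f \<in> borel_measurable N" "g \<in> borel_measurable N"
  shows "(\<lambda>x. amp_hat G (f x) (g x)) \<in> borel_measurable N"
  unfolding amp_hat_def
proof (rule borel_measurable_fourier_comp)
  show "(\<lambda>(x, b). G (b, g x)) \<in> borel_measurable (N \<Otimes>\<^sub>M lborel)"
    unfolding split_beta' by (rule amp_pair) measurable
qed measurable

lemma amp_hat_0: "a \<notin> {1..2} \<Longrightarrow> amp_hat G \<xi> a = 0"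
  by (simp add: amp_hat_def fourier_def amp_0)

lemma amp_kernel_borel [measurable]: "amp_kernel G \<in> borel_measurable borel"
proof -
  have eq: "amp_kernel G = (\<lambda>z. amp_hat G (fst z) (norm (snd z) / norm (fst z)) * of_real (norm (fst z) / (norm (snd z))\<^sup>2))"
    by (simp add: amp_kernel_def split_beta')
  show ?thesis unfolding eq by measurable
qed

lemma amp_section:
  "square_integrable lborel (\<lambda>b. G (b, a))"
  "sq_norm (\<lambda>\<xi>. amp_hat G \<xi> a) \<le> ennreal (16 * pi\<^sup>2 * M\<^sup>2)"
proof -
  have m: "(\<lambda>b. G (b, a)) \<in> borel_measurable borel" by (rule amp_pair) measurable
  note S = square_integrable_bounded_supp[OF m amp_le, of]
  have 0: "b \<notin> unit_square \<Longrightarrow> G (b, a) = 0" for b using amp_0 by blast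
  from S(2)[OF 0] show sq: "square_integrable lborel (\<lambda>b. G (b, a))" .
  have "sq_norm (\<lambda>\<xi>. amp_hat G \<xi> a)
      \<le> ennreal (4 * pi\<^sup>2) * sq_norm (\<lambda>b. G (b, a))"
    unfolding amp_hat_def by (rule plancherel_le[OF sq 0])
  also have "\<dots> \<le> ennreal (4 * pi\<^sup>2) * ennreal (4 * M\<^sup>2)"
    by (intro mult_left_mono S(1)[OF 0]) simp_all
  also have "\<dots> = ennreal (16 * pi\<^sup>2 * M\<^sup>2)"
    by (simp add: ennreal_mult[symmetric])
  finally show "sq_norm (\<lambda>\<xi>. amp_hat G \<xi> a) \<le> ennreal (16 * pi\<^sup>2 * M\<^sup>2)" .
qed

text \<open>In polar coordinates for $\eta$, the squared norm of the kernel becomes the integral of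
  $|\hat G(\xi,a)|^2 a^{-3}$ over $\xi$, $a$ and $\theta$; integrate over $\xi$ first.\<close>

lemma nn_integral_amp_kernel_le:
  "sq_norm (amp_kernel G) \<le> ennreal (32 * pi ^ 3 * M\<^sup>2)"
proof -
  have k: "(\<lambda>z. ennreal ((cmod (amp_kernel G z))\<^sup>2)) \<in> borel_measurable borel"
    using amp_kernel_borel by measurable
  define T :: "(real \<times> real) set" where "T = {1..2} \<times> {0..<2 * pi}"
  have T [measurable]: "T \<in> sets borel" by (auto simp: T_def borel_prod[symmetric])
  have m: "(\<lambda>(\<xi>, z). indicator T z * ennreal ((cmod (amp_hat G \<xi> (fst z)))\<^sup>2)) \<in> borel_measurable (lborel \<Otimes>\<^sub>M lborel)"
    unfolding split_beta'
  proof (rule borel_measurable_times_ennreal)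
    have hat: "(\<lambda>x. amp_hat G (fst x) (fst (snd x))) \<in> borel_measurable (lborel \<Otimes>\<^sub>M (lborel :: (real \<times> real) measure))"
      by (rule amp_hat_borel) measurable
    show "(\<lambda>x. ennreal ((cmod (amp_hat G (fst x) (fst (snd x))))\<^sup>2)) \<in> borel_measurable (lborel \<Otimes>\<^sub>M (lborel :: (real \<times> real) measure))"
      by (rule measurable_compose[OF hat]) measurable
    show "(\<lambda>x. indicator T (snd x) :: ennreal) \<in> borel_measurable ((lborel :: (real^2) measure) \<Otimes>\<^sub>M lborel)"
      by (rule measurable_compose[OF measurable_snd]) simp
  qed
  have "sq_norm (amp_kernel G)
      = (\<integral>\<^sup>+\<xi>. sq_norm (\<lambda>\<eta>. amp_kernel G (\<xi>, \<eta>)) \<partial>lborel)"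
    by (rule nn_integral_lborel_prod(1)[OF k])
  also have "\<dots> \<le> (\<integral>\<^sup>+\<xi>. (\<integral>\<^sup>+z. indicator T z * ennreal ((cmod (amp_hat G \<xi> (fst z)))\<^sup>2) \<partial>lborel) \<partial>lborel)"
  proof (rule nn_integral_mono_AE)
    show "AE \<xi> in lborel. sq_norm (\<lambda>\<eta>. amp_kernel G (\<xi>, \<eta>))
        \<le> (\<integral>\<^sup>+z. indicator T z * ennreal ((cmod (amp_hat G \<xi> (fst z)))\<^sup>2) \<partial>lborel)"
    proof (rule AE_mp[OF AE_lborel_singleton[of 0]], rule AE_I2, rule impI)
      fix \<xi> :: "real^2" assume \<xi>: "\<xi> \<noteq> 0"
      have mk: "(\<lambda>\<eta>. ennreal ((cmod (amp_kernel G (\<xi>, \<eta>)))\<^sup>2)) \<in> borel_measurable borel"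
        by (rule measurable_compose[OF borel_measurable_Pair k]) simp_all
      have "sq_norm (\<lambda>\<eta>. amp_kernel G (\<xi>, \<eta>))
          = (\<integral>\<^sup>+z. indicator half_strip z * ennreal (fst z * (norm \<xi>)\<^sup>2)
              * ennreal ((cmod (amp_kernel G (\<xi>, act (fst z) (snd z) \<xi>)))\<^sup>2) \<partial>lborel)"
        by (rule nn_integral_polar[OF \<xi> mk])
      also have "\<dots> \<le> (\<integral>\<^sup>+z. indicator T z * ennreal ((cmod (amp_hat G \<xi> (fst z)))\<^sup>2) \<partial>lborel)"
      proof (rule nn_integral_mono)
        fix z :: "real \<times> real"
        obtain a \<theta> where z: "z = (a, \<theta>)" by fastforce
        show "indicator half_strip z * ennreal (fst z * (norm \<xi>)\<^sup>2)
              * ennreal ((cmod (amp_kernel G (\<xi>, act (fst z) (snd z) \<xi>)))\<^sup>2)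
            \<le> indicator T z * ennreal ((cmod (amp_hat G \<xi> (fst z)))\<^sup>2)"
        proof (cases "z \<in> half_strip \<and> a \<in> {1..2}")
          case True
          then have a: "1 \<le> a" and zT: "z \<in> T" "z \<in> half_strip" by (auto simp: z T_def)
          have "(a * (norm \<xi>)\<^sup>2) * (cmod (amp_kernel G (\<xi>, act a \<theta> \<xi>)))\<^sup>2
              = (cmod (amp_hat G \<xi> a))\<^sup>2 * (1 / a ^ 3)"
            using a \<xi> by (simp add: amp_kernel_def norm_act norm_mult norm_divide norm_power power_mult_distrib
                power_divide field_simps eval_nat_numeral)
          also have "\<dots> \<le> (cmod (amp_hat G \<xi> a))\<^sup>2 * 1"
            using a by (intro mult_left_mono) (auto simp: field_simps)
          finally show ?thesis
            using zT a by (simp add: z ennreal_mult[symmetric] ennreal_leI)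
        next
          case False
          then have "indicator half_strip z = (0 :: ennreal) \<or> amp_kernel G (\<xi>, act a \<theta> \<xi>) = 0"
            using \<xi> by (auto simp: amp_kernel_def norm_act z amp_hat_0 indicator_def)
          then show ?thesis by (auto simp: z)
        qed
      qed
      finally show "sq_norm (\<lambda>\<eta>. amp_kernel G (\<xi>, \<eta>))
          \<le> (\<integral>\<^sup>+z. indicator T z * ennreal ((cmod (amp_hat G \<xi> (fst z)))\<^sup>2) \<partial>lborel)" .
    qed
  qed
  also have "\<dots> = (\<integral>\<^sup>+z. (\<integral>\<^sup>+\<xi>. indicator T z * ennreal ((cmod (amp_hat G \<xi> (fst z)))\<^sup>2) \<partial>lborel) \<partial>lborel)"
    by (rule lborel_pair.Fubini'[OF m, symmetric])
  also have "\<dots> \<le> (\<integral>\<^sup>+z. ennreal (16 * pi\<^sup>2 * M\<^sup>2) * indicator T z \<partial>lborel)"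
    by (intro nn_integral_mono) (auto simp: indicator_def amp_section(2))
  also have "\<dots> = ennreal (16 * pi\<^sup>2 * M\<^sup>2) * emeasure lborel T"
    by (rule nn_integral_cmult_indicator) simp
  also have "emeasure lborel T = ennreal (2 * pi)"
    unfolding T_def lborel_prod[symmetric] by (subst lborel.emeasure_pair_measure_Times) auto
  also have "ennreal (16 * pi\<^sup>2 * M\<^sup>2) * ennreal (2 * pi) = ennreal ((16 * pi\<^sup>2 * M\<^sup>2) * (2 * pi))"
    by (rule ennreal_mult[symmetric]) simp_all
  also have "(16 * pi\<^sup>2 * M\<^sup>2) * (2 * pi) = 32 * pi ^ 3 * M\<^sup>2"
    by (simp add: eval_nat_numeral mult_ac)
  finally show ?thesis .
qed

lemma L2_kernel_amp_kernel: "L2_kernel (amp_kernel G)"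
proof -
  have "ennreal (32 * pi ^ 3 * M\<^sup>2) < \<infinity>" by simp
  with nn_integral_amp_kernel_le have "sq_norm (amp_kernel G) < \<infinity>"
    by (rule order.strict_trans1)
  then show ?thesis
    unfolding square_integrable_iff_nn_integral using amp_kernel_borel by simp
qed

text \<open>Integrating over $b$ first turns $h$ into its partial Fourier transform.  Fubini is justified at every
  $\xi \ne 0$: the points $a R_{-\theta}\xi$ with $a \le 2$ stay in a ball, where $F$ is integrable.\<close>

lemma pi_fun_lift_amp:
  assumes F: "square_integrable lborel F" and \<xi>: "\<xi> \<noteq> 0"
  shows "pi_fun (lift_amp G) F \<xi>
      = (\<integral>z. (indicator half_strip z / (fst z)\<^sup>2) *\<^sub>R (amp_hat G \<xi> (fst z) * F (act (fst z) (snd z) \<xi>)) \<partial>lborel)"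
proof -
  have F': "F \<in> borel_measurable borel" by (rule square_integrable_measurable[OF F])
  define \<Phi> where "\<Phi> \<eta> = indicator (cball 0 (2 * norm \<xi>)) \<eta> * ennreal (cmod (F \<eta>))" for \<eta>
  have \<Phi>: "\<Phi> \<in> borel_measurable borel"
    unfolding \<Phi>_def
    by (intro borel_measurable_times_ennreal borel_measurable_indicator borel_measurable_ennreal_cmod F') simp
  define P :: "(real^2) \<times> real \<times> real \<Rightarrow> complex" where
    "P = (\<lambda>(b, z). (indicator half_strip z / (fst z)\<^sup>2) *\<^sub>R (G (b, fst z) * cis (- (b \<bullet> \<xi>)) * F (act (fst z) (snd z) \<xi>)))"
  have P: "P \<in> borel_measurable borel"
  proof -
    have 1: "(\<lambda>x :: (real^2) \<times> real \<times> real. G (fst x, fst (snd x))) \<in> borel_measurable borel"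
      by (rule amp_pair) measurable
    have 2: "(\<lambda>x :: (real^2) \<times> real \<times> real. F (act (fst (snd x)) (snd (snd x)) \<xi>)) \<in> borel_measurable borel"
      by (rule measurable_compose[OF _ F']) measurable
    have 3: "(\<lambda>x :: (real^2) \<times> real \<times> real. indicator half_strip (snd x) / (fst (snd x))\<^sup>2 :: real) \<in> borel_measurable borel"
      by measurable
    have 4: "(\<lambda>x :: (real^2) \<times> real \<times> real. cis (- (fst x \<bullet> \<xi>))) \<in> borel_measurable borel"
      by (intro borel_measurable_continuous_onI continuous_intros)
    show ?thesis
      unfolding P_def split_beta' by (intro borel_measurable_scaleR borel_measurable_times 1 2 3 4)
  qed
  have nnP: "(\<integral>\<^sup>+x. ennreal (cmod (P x)) \<partial>lborel) < \<infinity>"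
  proof -
    let ?I = "\<lambda>z. indicator half_strip z * ennreal (fst z * (norm \<xi>)\<^sup>2) * \<Phi> (act (fst z) (snd z) \<xi>)"
    have I: "?I \<in> borel_measurable borel" by (rule borel_measurable_polar_integrand[OF \<Phi>])
    have "(\<integral>\<^sup>+x. ennreal (cmod (P x)) \<partial>lborel) = (\<integral>\<^sup>+z. (\<integral>\<^sup>+b. ennreal (cmod (P (b, z))) \<partial>lborel) \<partial>lborel)"
      by (rule nn_integral_lborel_prod(2)[OF borel_measurable_ennreal_cmod[OF P]])
    also have "\<dots> \<le> (\<integral>\<^sup>+z. (\<integral>\<^sup>+b. (ennreal (M / (norm \<xi>)\<^sup>2) * ?I z) * indicator unit_square b \<partial>lborel) \<partial>lborel)"
    proof (intro nn_integral_mono)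
      fix z :: "real \<times> real" and b :: "real^2"
      obtain a \<theta> where z: "z = (a, \<theta>)" by fastforce
      show "ennreal (cmod (P (b, z))) \<le> (ennreal (M / (norm \<xi>)\<^sup>2) * ?I z) * indicator unit_square b"
      proof (cases "z \<in> half_strip \<and> b \<in> unit_square \<and> a \<in> {1..2}")
        case True
        then have a: "1 \<le> a" "a \<le> 2" by auto
        have "cmod (P (b, z)) = cmod (G (b, a)) * (1 / a\<^sup>2) * cmod (F (act a \<theta> \<xi>))"
          using True by (simp add: P_def z norm_mult)
        also have "\<dots> \<le> M * a * cmod (F (act a \<theta> \<xi>))"
          using a by (intro mult_right_mono mult_mono amp_le M_nonneg)
            (auto simp: field_simps intro: order_trans[of 1 a] mult_ge1_I one_le_power)
        also have "\<dots> = M / (norm \<xi>)\<^sup>2 * ((a * (norm \<xi>)\<^sup>2) * cmod (F (act a \<theta> \<xi>)))"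
          using \<xi> by simp
        finally have "ennreal (cmod (P (b, z))) \<le> ennreal (M / (norm \<xi>)\<^sup>2 * ((a * (norm \<xi>)\<^sup>2) * cmod (F (act a \<theta> \<xi>))))"
          by (rule ennreal_leI)
        also have "\<dots> = ennreal (M / (norm \<xi>)\<^sup>2) * ennreal ((a * (norm \<xi>)\<^sup>2) * cmod (F (act a \<theta> \<xi>)))"
          using a M_nonneg by (intro ennreal_mult) auto
        also have "ennreal ((a * (norm \<xi>)\<^sup>2) * cmod (F (act a \<theta> \<xi>)))
            = ennreal (a * (norm \<xi>)\<^sup>2) * ennreal (cmod (F (act a \<theta> \<xi>)))"
          using a by (intro ennreal_mult) auto
        also have "\<dots> = ?I z * indicator unit_square b"
        proof -
          have "\<Phi> (act a \<theta> \<xi>) = ennreal (cmod (F (act a \<theta> \<xi>)))"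
            using a by (simp add: \<Phi>_def norm_act mult_right_mono)
          then show ?thesis using True by (simp add: z)
        qed
        finally have "ennreal (cmod (P (b, z))) \<le> ennreal (M / (norm \<xi>)\<^sup>2) * (?I z * indicator unit_square b)" .
        then show ?thesis by (simp only: mult.assoc)
      next
        case False
        then have "P (b, z) = 0"
          using amp_0[of b a] by (auto simp: P_def z)
        then show ?thesis by simp
      qed
    qed
    also have "\<dots> = (\<integral>\<^sup>+z. (ennreal (M / (norm \<xi>)\<^sup>2) * ?I z) * 4 \<partial>lborel)"
      by (intro nn_integral_cong) (subst nn_integral_cmult_indicator, simp_all add: emeasure_unit_square)
    also have "\<dots> = (\<integral>\<^sup>+z. (4 * ennreal (M / (norm \<xi>)\<^sup>2)) * ?I z \<partial>lborel)"
      by (simp only: mult_ac)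
    also have "\<dots> = (4 * ennreal (M / (norm \<xi>)\<^sup>2)) * (\<integral>\<^sup>+z. ?I z \<partial>lborel)"
      by (rule nn_integral_cmult) (simp only: measurable_lborel2 I)
    also have "(\<integral>\<^sup>+z. ?I z \<partial>lborel) = (\<integral>\<^sup>+\<eta>. \<Phi> \<eta> \<partial>lborel)"
      by (rule nn_integral_polar[OF \<xi> \<Phi>, symmetric])
    also have "(4 * ennreal (M / (norm \<xi>)\<^sup>2)) * \<dots> < \<infinity>"
      using square_integrable_on_ball_finite[OF F, of "2 * norm \<xi>"] by (simp add: \<Phi>_def ennreal_mult_less_top)
    finally show ?thesis .
  qed
  have "integrable lborel P"
    by (rule integrableI_bounded) (simp_all only: measurable_lborel2 P nnP)
  then have int: "integrable (lborel \<Otimes>\<^sub>M lborel) P" by (simp add: lborel_prod)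
  have "pi_fun (lift_amp G) F \<xi> = (\<integral>x. (indicator (carrier SIM2) x * (1 / fst (snd x) ^ 3)) *\<^sub>R (lift_amp G x * irrep_fun x F \<xi>) \<partial>lborel)"
    unfolding pi_fun_def by (rule integral_haar) (rule borel_measurable_lift_irrep[OF lift_amp_borel F'])
  also have "\<dots> = (\<integral>x. P x \<partial>lborel)"
  proof (rule Bochner_Integration.integral_cong[OF refl])
    fix x :: sim2
    obtain b a \<theta> where x: "x = (b, a, \<theta>)" by (cases x)
    have ind: "indicator (carrier SIM2) x = (indicator half_strip (a, \<theta>) :: real)"
      by (auto simp: x SIM2_def indicator_def)
    show "(indicator (carrier SIM2) x * (1 / fst (snd x) ^ 3)) *\<^sub>R (lift_amp G x * irrep_fun x F \<xi>) = P x"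
      unfolding ind
      by (auto simp: x P_def lift_amp_def irrep_fun_def indicator_def scaleR_conv_of_real field_simps eval_nat_numeral)
  qed
  also have "\<dots> = (\<integral>z. (\<integral>b. P (b, z) \<partial>lborel) \<partial>lborel)"
    using lborel_pair.integral_snd[of "\<lambda>b z. P (b, z)"] int by (simp add: lborel_prod)
  also have "\<dots> = (\<integral>z. (indicator half_strip z / (fst z)\<^sup>2) *\<^sub>R (amp_hat G \<xi> (fst z) * F (act (fst z) (snd z) \<xi>)) \<partial>lborel)"
  proof (rule Bochner_Integration.integral_cong[OF refl])
    fix z :: "real \<times> real"
    have "(\<integral>b. P (b, z) \<partial>lborel)
        = (\<integral>b. (G (b, fst z) * cis (- (b \<bullet> \<xi>))) * ((indicator half_strip z / (fst z)\<^sup>2) *\<^sub>R F (act (fst z) (snd z) \<xi>)) \<partial>lborel)"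
      by (simp add: P_def)
    also have "\<dots> = amp_hat G \<xi> (fst z) * ((indicator half_strip z / (fst z)\<^sup>2) *\<^sub>R F (act (fst z) (snd z) \<xi>))"
      unfolding amp_hat_def fourier_def by (rule integral_mult_left_zero)
    finally show "(\<integral>b. P (b, z) \<partial>lborel)
        = (indicator half_strip z / (fst z)\<^sup>2) *\<^sub>R (amp_hat G \<xi> (fst z) * F (act (fst z) (snd z) \<xi>))"
      by simp
  qed
  finally show ?thesis .
qed

lemma integrable_lift_amp: "integrable haar (lift_amp G)"
proof (rule integrableI_bounded)
  show "lift_amp G \<in> borel_measurable haar"
    by (rule borel_measurable_haarI[OF lift_amp_borel])
  define B :: "sim2 set" where "B = unit_square \<times> {1..2} \<times> {0..2 * pi}"
  have "bounded B"
  proof -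
    have "unit_square = cbox (vector [-1, -1]) (vector [1, 1])"
      by (auto simp: mem_box_cart forall_2 abs_le_iff)
    then show ?thesis unfolding B_def by (auto intro!: bounded_Times)
  qed
  then have "emeasure lborel B < \<infinity>" by (rule emeasure_bounded_finite)
  have B [measurable]: "B \<in> sets borel"
    unfolding B_def borel_prod[symmetric] by measurable
  have "(\<integral>\<^sup>+z. ennreal (norm (lift_amp G z)) \<partial>haar)
      = (\<integral>\<^sup>+z. indicator (carrier SIM2) z * ennreal (1 / fst (snd z) ^ 3) * ennreal (norm (lift_amp G z)) \<partial>lborel)"
    by (rule nn_integral_haar[OF borel_measurable_ennreal_cmod[OF lift_amp_borel]])
  also have "\<dots> \<le> (\<integral>\<^sup>+z. ennreal M * indicator B z \<partial>lborel)"
  proof (rule nn_integral_mono)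
    fix z :: sim2
    obtain b a \<theta> where z: "z = (b, a, \<theta>)" by (cases z)
    show "indicator (carrier SIM2) z * ennreal (1 / fst (snd z) ^ 3) * ennreal (norm (lift_amp G z)) \<le> ennreal M * indicator B z"
    proof (cases "z \<in> carrier SIM2 \<and> b \<in> unit_square \<and> a \<in> {1..2}")
      case True
      then have zB: "z \<in> B" "1 \<le> a" by (auto simp: z B_def SIM2_def)
      then have "1 / a ^ 3 * cmod (lift_amp G z) \<le> 1 * M"
        by (intro mult_mono) (auto simp: z lift_amp_def amp_le)
      then show ?thesis
        using True zB by (simp add: z ennreal_mult[symmetric] ennreal_leI)
    next
      case False
      then have "indicator (carrier SIM2) z = (0::ennreal) \<or> lift_amp G z = 0"
        using amp_0[of b a] by (auto simp: z lift_amp_def)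
      then show ?thesis by auto
    qed
  qed
  also have "\<dots> = ennreal M * emeasure lborel B"
    by (rule nn_integral_cmult_indicator) simp
  also have "\<dots> < \<infinity>"
    using \<open>emeasure lborel B < \<infinity>\<close> by (simp add: ennreal_mult_less_top)
  finally show "(\<integral>\<^sup>+z. ennreal (norm (lift_amp G z)) \<partial>haar) < \<infinity>" .
qed

lemma pi_op_lift_amp:
  assumes F: "square_integrable lborel (\<lambda>\<eta>. of_real (norm \<eta>) * rep_l2 \<phi> \<eta>)"
  shows "pi_op (lift_amp G) (abs_l2 (\<lambda>\<eta>. of_real (norm \<eta>) * rep_l2 \<phi> \<eta>)) = kernel_op (amp_kernel G) \<phi>"
  unfolding pi_op_abs[OF lift_amp_borel integrable_lift_amp F] kernel_op_def
proof (rule abs_l2_eqI)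
  show "square_integrable lborel (pi_fun (lift_amp G) (\<lambda>\<eta>. of_real (norm \<eta>) * rep_l2 \<phi> \<eta>))"
    by (rule square_integrable_pi_fun[OF lift_amp_borel integrable_lift_amp F])
  show "square_integrable lborel (kernel_fun (amp_kernel G) (rep_l2 \<phi>))"
    by (rule square_integrable_kernel_fun[OF L2_kernel_amp_kernel])
  show "AE \<xi> in lborel. pi_fun (lift_amp G) (\<lambda>\<eta>. of_real (norm \<eta>) * rep_l2 \<phi> \<eta>) \<xi>
      = kernel_fun (amp_kernel G) (rep_l2 \<phi>) \<xi>"
  proof (rule AE_mp[OF AE_lborel_singleton[of 0]], rule AE_I2, rule impI)
    fix \<xi> :: "real^2" assume \<xi>: "\<xi> \<noteq> 0"
    have "kernel_fun (amp_kernel G) (rep_l2 \<phi>) \<xi>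
        = (\<integral>z. (indicator half_strip z * (fst z * (norm \<xi>)\<^sup>2)) *\<^sub>R
            (amp_kernel G (\<xi>, act (fst z) (snd z) \<xi>) * rep_l2 \<phi> (act (fst z) (snd z) \<xi>)) \<partial>lborel)"
      unfolding kernel_fun_def by (rule integral_polar[OF \<xi>]) measurable
    also have "\<dots> = (\<integral>z. (indicator half_strip z / (fst z)\<^sup>2) *\<^sub>R (amp_hat G \<xi> (fst z)
          * (of_real (norm (act (fst z) (snd z) \<xi>)) * rep_l2 \<phi> (act (fst z) (snd z) \<xi>))) \<partial>lborel)"
      using \<xi> by (intro Bochner_Integration.integral_cong)
        (auto simp: indicator_def amp_kernel_def norm_act scaleR_conv_of_real field_simps power2_eq_square)
    also have "\<dots> = pi_fun (lift_amp G) (\<lambda>\<eta>. of_real (norm \<eta>) * rep_l2 \<phi> \<eta>) \<xi>"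
      by (rule pi_fun_lift_amp[OF F \<xi>, symmetric])
    finally show "pi_fun (lift_amp G) (\<lambda>\<eta>. of_real (norm \<eta>) * rep_l2 \<phi> \<eta>) \<xi>
        = kernel_fun (amp_kernel G) (rep_l2 \<phi>) \<xi>" by simp
  qed
qed

end

section \<open>Powers of the Duflo--Moore operator\<close>

abbreviation mult_norm_powr :: "real \<Rightarrow> (real^2 \<Rightarrow> complex) \<Rightarrow> real^2 \<Rightarrow> complex" where
  "mult_norm_powr r f \<equiv> (\<lambda>x. of_real (norm x powr (2 * r)) * f x)"

lemma K_power_eq_Some_iff:
  "K_power r \<phi> = Some \<psi> \<longleftrightarrow>
     square_integrable lborel (mult_norm_powr r (rep_l2 \<phi>)) \<and> \<psi> = abs_l2 (mult_norm_powr r (rep_l2 \<phi>))"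
  by (auto simp: K_power_def Let_def)

lemma borel_measurable_mult_norm_powr:
  assumes [measurable]: "f \<in> borel_measurable borel"
  shows "mult_norm_powr r f \<in> borel_measurable borel"
  by measurable

lemma square_integrable_cong_AE:
  assumes f: "square_integrable lborel f" and g: "g \<in> borel_measurable borel" and eq: "AE x in lborel. f x = g x"
  shows "square_integrable lborel g"
proof -
  have "sq_norm g = sq_norm f"
    by (rule nn_integral_cong_AE) (use eq in auto)
  then show ?thesis
    using square_integrable_finite[OF f] unfolding square_integrable_iff_nn_integral measurable_lborel2
    by (simp only: g simp_thms)
qed

lemma square_integrable_dominated:
  assumes f: "square_integrable lborel f" and g: "g \<in> borel_measurable borel"
    and le: "\<And>x. cmod (g x) \<le> C * cmod (f x)"
  shows "square_integrable lborel g"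
proof -
  have f': "f \<in> borel_measurable borel" by (rule square_integrable_measurable[OF f])
  have "sq_norm g \<le> (\<integral>\<^sup>+x. ennreal (C\<^sup>2) * ennreal ((cmod (f x))\<^sup>2) \<partial>lborel)"
  proof (rule nn_integral_mono)
    fix x
    have "(cmod (g x))\<^sup>2 \<le> (C * cmod (f x))\<^sup>2" by (intro power_mono le) simp
    then show "ennreal ((cmod (g x))\<^sup>2) \<le> ennreal (C\<^sup>2) * ennreal ((cmod (f x))\<^sup>2)"
      by (simp add: ennreal_mult[symmetric] power_mult_distrib ennreal_leI)
  qed
  also have "\<dots> = ennreal (C\<^sup>2) * sq_norm f"
    by (rule nn_integral_cmult) (use f' in measurable)
  also have "\<dots> < \<infinity>"
    using square_integrable_finite[OF f] by (simp add: ennreal_mult_less_top)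
  finally show ?thesis
    unfolding square_integrable_iff_nn_integral measurable_lborel2 by (simp only: g simp_thms)
qed

lemma K_power_abs:
  assumes f: "square_integrable lborel f" and g: "square_integrable lborel (mult_norm_powr r f)"
  shows "K_power r (abs_l2 f) = Some (abs_l2 (mult_norm_powr r f))"
proof -
  have eq: "AE x in lborel. mult_norm_powr r f x = mult_norm_powr r (rep_l2 (abs_l2 f)) x"
    using rep_abs_l2[OF f] by eventually_elim simp
  have sq: "square_integrable lborel (mult_norm_powr r (rep_l2 (abs_l2 f)))"
    by (rule square_integrable_cong_AE[OF g _ eq]) (rule borel_measurable_mult_norm_powr[OF borel_measurable_rep_l2])
  show ?thesis
    unfolding K_power_eq_Some_iff using sq abs_l2_eqI[OF g sq eq] by simp
qed

lemma linear_op_K_power: "linear_op (K_power r)"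
  unfolding linear_op_def
proof (intro conjI allI impI)
  show "K_power r 0 = Some 0"
    using K_power_abs[OF square_integrable_0, of r] by (simp add: square_integrable_0 zero_l2_def)
  fix \<phi> \<phi>' assume K: "K_power r \<phi> = Some \<phi>'"
  then have sq: "square_integrable lborel (mult_norm_powr r (rep_l2 \<phi>))" and \<phi>': "\<phi>' = abs_l2 (mult_norm_powr r (rep_l2 \<phi>))"
    unfolding K_power_eq_Some_iff by blast+
  show "K_power r (cscale c \<phi>) = Some (cscale c \<phi>')" for c
  proof -
    have eq: "mult_norm_powr r (\<lambda>x. c * rep_l2 \<phi> x) = (\<lambda>x. c * mult_norm_powr r (rep_l2 \<phi>) x)" by (auto simp: mult_ac)
    show ?thesis
      using K_power_abs[OF square_integrable_cmult[OF square_integrable_rep_l2[of \<phi>], of c], of r]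
      unfolding eq cscale_abs_l2[OF square_integrable_rep_l2, symmetric] cscale_abs_l2[OF sq, symmetric] abs_rep_l2
      by (simp add: square_integrable_cmult[OF sq] \<phi>')
  qed
  fix \<psi> \<psi>' assume "K_power r \<psi> = Some \<psi>'"
  then have sq': "square_integrable lborel (mult_norm_powr r (rep_l2 \<psi>))" and \<psi>': "\<psi>' = abs_l2 (mult_norm_powr r (rep_l2 \<psi>))"
    unfolding K_power_eq_Some_iff by blast+
  have eq: "mult_norm_powr r (\<lambda>x. rep_l2 \<phi> x + rep_l2 \<psi> x)
      = (\<lambda>x. mult_norm_powr r (rep_l2 \<phi>) x + mult_norm_powr r (rep_l2 \<psi>) x)" by (auto simp: distrib_left)
  show "K_power r (\<phi> + \<psi>) = Some (\<phi>' + \<psi>')"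
    using K_power_abs[OF square_integrable_add[OF square_integrable_rep_l2[of \<phi>] square_integrable_rep_l2[of \<psi>]], of r]
    unfolding eq add_abs_l2[OF square_integrable_rep_l2 square_integrable_rep_l2, symmetric] add_abs_l2[OF sq sq', symmetric] abs_rep_l2
    by (simp add: square_integrable_add[OF sq sq'] \<phi>' \<psi>')
qed

lemma linear_op_map_comp:
  assumes "linear_op A" "linear_op B"
  shows "linear_op (A \<circ>\<^sub>m B)"
  unfolding linear_op_def
proof (intro conjI allI impI)
  have "A 0 = Some 0" "B 0 = Some 0" using assms by (auto simp: linear_op_def)
  then show "(A \<circ>\<^sub>m B) 0 = Some 0" by (simp add: map_comp_def)
  fix \<phi> \<phi>' assume "(A \<circ>\<^sub>m B) \<phi> = Some \<phi>'"
  then obtain a where a: "B \<phi> = Some a" "A a = Some \<phi>'" by (auto simp: map_comp_Some_iff)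
  then have "B (cscale c \<phi>) = Some (cscale c a)" "A (cscale c a) = Some (cscale c \<phi>')" for c
    using assms by (simp_all add: linear_op_def)
  then show "(A \<circ>\<^sub>m B) (cscale c \<phi>) = Some (cscale c \<phi>')" for c by (simp add: map_comp_def)
  fix \<psi> \<psi>' assume "(A \<circ>\<^sub>m B) \<psi> = Some \<psi>'"
  then obtain b where "B \<psi> = Some b" "A b = Some \<psi>'" by (auto simp: map_comp_Some_iff)
  with a have "B (\<phi> + \<psi>) = Some (a + b)" "A (a + b) = Some (\<phi>' + \<psi>')"
    using assms by (simp_all add: linear_op_def)
  then show "(A \<circ>\<^sub>m B) (\<phi> + \<psi>) = Some (\<phi>' + \<psi>')" by (simp add: map_comp_def)
qed

lemma linear_op_total: "bounded_clinear T \<Longrightarrow> linear_op (total_op T)"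
  unfolding linear_op_def total_op_def bounded_clinear_def
  by (auto dest: bounded_linear.linear simp: linear_0 linear_add)

lemma linear_op_restrict_dom:
  assumes "linear_op A" "linear_op B"
  shows "linear_op (A |` dom B)"
  using assms unfolding linear_op_def restrict_map_def dom_def
  by (auto split: if_splits)

text \<open>The factors $\|x\|^{2r}$ and $\|x\|^{-2r}$ cancel away from the origin, a null set.\<close>

lemma K_power_inverse:
  assumes "K_power r \<phi> = Some \<psi>"
  shows "K_power (- r) \<psi> = Some \<phi>"
proof -
  have sq: "square_integrable lborel (mult_norm_powr r (rep_l2 \<phi>))" and \<psi>: "\<psi> = abs_l2 (mult_norm_powr r (rep_l2 \<phi>))"
    using assms unfolding K_power_eq_Some_iff by blast+
  have eq: "AE x in lborel. rep_l2 \<phi> x = mult_norm_powr (- r) (mult_norm_powr r (rep_l2 \<phi>)) x"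
  proof (rule AE_mp[OF AE_lborel_singleton[of 0]], rule AE_I2, rule impI)
    fix x :: "real^2" assume "x \<noteq> 0"
    then have "norm x powr (2 * - r) * norm x powr (2 * r) = 1"
      by (simp add: powr_add[symmetric])
    then show "rep_l2 \<phi> x = mult_norm_powr (- r) (mult_norm_powr r (rep_l2 \<phi>)) x"
      by (metis mult.assoc mult_1 of_real_1 of_real_mult)
  qed
  have sq': "square_integrable lborel (mult_norm_powr (- r) (mult_norm_powr r (rep_l2 \<phi>)))"
    by (rule square_integrable_cong_AE[OF square_integrable_rep_l2 _ eq])
       (intro borel_measurable_mult_norm_powr borel_measurable_rep_l2)
  show ?thesis
    unfolding \<psi> K_power_abs[OF sq sq']
    using abs_l2_eqI[OF square_integrable_rep_l2 sq' eq] by simp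
qed

lemma diff_abs_l2:
  assumes "square_integrable lborel f" "square_integrable lborel g"
  shows "abs_l2 f - abs_l2 g = abs_l2 (\<lambda>x. f x - g x)"
  unfolding minus_l2_def uminus_l2_def
  using assms by (simp add: cscale_abs_l2 add_abs_l2 square_integrable_cmult[where c = "-1", simplified])

lemma norm_abs_l2_square:
  assumes f: "square_integrable lborel f"
  shows "(norm (abs_l2 f))\<^sup>2 = (\<integral>x. (cmod (f x))\<^sup>2 \<partial>lborel)"
  unfolding norm_l2_square
proof (rule integral_cong_AE)
  have [measurable]: "f \<in> borel_measurable borel" by (rule square_integrable_measurable[OF f])
  show "(\<lambda>x. (cmod (rep_l2 (abs_l2 f) x))\<^sup>2) \<in> borel_measurable lborel" "(\<lambda>x. (cmod (f x))\<^sup>2) \<in> borel_measurable lborel"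
    by measurable
qed (use rep_abs_l2[OF f] in auto)

text \<open>Truncation to balls of radius $n$.\<close>

lemma closure_dom_K_power:
  assumes r: "0 \<le> r"
  shows "closure (dom (K_power r)) = UNIV"
proof -
  have "\<phi> \<in> closure (dom (K_power r))" for \<phi>
  proof -
    define f where "f n x = indicator (cball 0 (real n)) x * rep_l2 \<phi> x" for n x
    have fm: "f n \<in> borel_measurable borel" for n
    proof -
      have [measurable]: "cball (0 :: real^2) (real n) \<in> sets borel" by simp
      show ?thesis unfolding f_def by measurable
    qed
    have sq: "square_integrable lborel (f n)" for n
      by (rule square_integrable_dominated[OF square_integrable_rep_l2[of \<phi>] fm, of _ 1])
         (simp add: f_def indicator_def)
    have "square_integrable lborel (mult_norm_powr r (f n))" for n
    proof (rule square_integrable_dominated[OF square_integrable_rep_l2[of \<phi>] borel_measurable_mult_norm_powr[OF fm]])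
      show "cmod (mult_norm_powr r (f n) x) \<le> (real n powr (2 * r)) * cmod (rep_l2 \<phi> x)" for x
        using r by (auto simp: f_def indicator_def norm_mult intro!: mult_right_mono powr_mono2)
    qed
    from K_power_abs[OF sq this] have "abs_l2 (f n) \<in> dom (K_power r)" for n by blast
    moreover have "(\<lambda>n. abs_l2 (f n)) \<longlonglongrightarrow> \<phi>"
    proof -
      have sqd: "square_integrable lborel (\<lambda>x. f n x - rep_l2 \<phi> x)" for n
      proof (rule square_integrable_dominated[OF square_integrable_rep_l2[of \<phi>], of _ 1])
        show "(\<lambda>x. f n x - rep_l2 \<phi> x) \<in> borel_measurable borel"
          by (intro borel_measurable_diff fm borel_measurable_rep_l2)
      qed (simp add: f_def indicator_def)
      have nrm: "(norm (abs_l2 (f n) - \<phi>))\<^sup>2 = (\<integral>x. (cmod (f n x - rep_l2 \<phi> x))\<^sup>2 \<partial>lborel)" for n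
        using diff_abs_l2[OF sq square_integrable_rep_l2, of n \<phi>] norm_abs_l2_square[OF sqd, of n] by simp
      have "(\<lambda>n. \<integral>x. (cmod (f n x - rep_l2 \<phi> x))\<^sup>2 \<partial>lborel) \<longlonglongrightarrow> (\<integral>x. 0 \<partial>(lborel :: (real^2) measure))"
      proof (rule integral_dominated_convergence)
        show "integrable lborel (\<lambda>x. (cmod (rep_l2 \<phi> x))\<^sup>2)"
          using square_integrable_rep_l2[of \<phi>] unfolding square_integrable_def by (rule conjunct2)
        show "(\<lambda>x. (cmod (f n x - rep_l2 \<phi> x))\<^sup>2) \<in> borel_measurable lborel" for n
          using sqd[of n] unfolding square_integrable_def by (intro borel_measurable_integrable) blast
        show "AE x in lborel. (\<lambda>n. (cmod (f n x - rep_l2 \<phi> x))\<^sup>2) \<longlonglongrightarrow> 0"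
        proof (rule AE_I2)
          fix x :: "real^2"
          obtain N where "norm x \<le> real N" using real_arch_simple by blast
          then have "\<forall>\<^sub>F n in sequentially. (cmod (f n x - rep_l2 \<phi> x))\<^sup>2 = 0"
            unfolding eventually_sequentially by (intro exI[of _ N]) (auto simp: f_def indicator_def)
          then show "(\<lambda>n. (cmod (f n x - rep_l2 \<phi> x))\<^sup>2) \<longlonglongrightarrow> 0"
            by (rule tendsto_eventually)
        qed
        show "AE x in lborel. norm ((cmod (f n x - rep_l2 \<phi> x))\<^sup>2) \<le> (cmod (rep_l2 \<phi> x))\<^sup>2" for n
          by (intro AE_I2) (simp add: f_def indicator_def)
      qed simp
      then have "(\<lambda>n. (norm (abs_l2 (f n) - \<phi>))\<^sup>2) \<longlonglongrightarrow> 0" by (simp add: nrm)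
      from tendsto_real_sqrt[OF this] have "(\<lambda>n. norm (abs_l2 (f n) - \<phi>)) \<longlonglongrightarrow> 0" by simp
      then show ?thesis by (simp add: LIM_zero_cancel tendsto_norm_zero_iff)
    qed
    ultimately show ?thesis
      unfolding closure_sequential by (intro exI[of _ "\<lambda>n. abs_l2 (f n)"] conjI allI)
  qed
  then show ?thesis by blast
qed

lemma bounded_extension_K_inverse:
  assumes B: "bounded_clinear B" and r: "0 \<le> r"
  shows "bounded_extension ((total_op B \<circ>\<^sub>m K_power (- r)) \<circ>\<^sub>m K_power r) B"
proof -
  have eq: "((total_op B \<circ>\<^sub>m K_power (- r)) \<circ>\<^sub>m K_power r) \<phi> = (case K_power r \<phi> of None \<Rightarrow> None | Some _ \<Rightarrow> Some (B \<phi>))" for \<phi>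
    by (auto simp: map_comp_def total_op_def dest: K_power_inverse split: option.split)
  let ?A = "(total_op B \<circ>\<^sub>m K_power (- r)) \<circ>\<^sub>m K_power r"
  have "dom ?A = dom (K_power r)"
    unfolding dom_def eq by (auto split: option.splits)
  moreover have "?A \<subseteq>\<^sub>m total_op B"
    unfolding map_le_def
  proof
    fix \<phi> assume "\<phi> \<in> dom ?A"
    then show "?A \<phi> = total_op B \<phi>"
      unfolding dom_def eq by (auto simp: total_op_def split: option.splits)
  qed
  ultimately show ?thesis
    unfolding bounded_extension_def by (simp add: closure_dom_K_power[OF r] B)
qed

section \<open>A rank one symbol\<close>

definition proj :: "l2 \<Rightarrow> l2 \<Rightarrow> l2" where
  "proj e \<phi> = cscale (cinner \<phi> e) e"

lemma bounded_clinear_proj: "bounded_clinear (proj e)"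
  by (rule bounded_clinearI[where K = "norm e * norm e"])
     (auto simp: proj_def cinner_add_left cscale_add_left cinner_cscale_left cscale_cscale norm_cscale
       intro: order_trans[OF mult_right_mono[OF cmod_cinner_le]])

lemma proj_selfadj: "cinner (proj e \<phi>) \<psi> = cinner \<phi> (proj e \<psi>)"
  by (simp add: proj_def cinner_cscale_left cinner_cscale_right cnj_cinner mult.commute)

lemma proj_idem: "norm e = 1 \<Longrightarrow> proj e (proj e \<phi>) = proj e \<phi>"
  by (simp add: proj_def cinner_cscale_left cinner_self)

lemma bounded_clinear_zero: "bounded_clinear (\<lambda>_. 0)"
  by (rule bounded_clinearI[where K = 0]) auto

lemma positive_trace_proj_le: 
  assumes "norm e = 1"
  shows "positive_trace (proj e) \<le> 1"
proof (rule positive_trace_le)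
  fix F assume F: "finite F" "orthonormal_set F"
  have "Re (cinner (proj e e') e') = (cmod (cinner e e'))\<^sup>2" for e'
  proof -
    have "cinner (proj e e') e' = cinner e e' * cnj (cinner e e')"
      by (simp add: proj_def cinner_cscale_left cnj_cinner mult.commute)
    also have "\<dots> = of_real ((cmod (cinner e e'))\<^sup>2)"
      by (simp only: complex_norm_square)
    finally show ?thesis by simp
  qed
  then have "(\<Sum>e'\<in>F. ennreal (Re (cinner (proj e e') e'))) = ennreal (\<Sum>e'\<in>F. (cmod (cinner e e'))\<^sup>2)"
    by (simp add: sum_ennreal)
  also have "\<dots> \<le> ennreal ((norm e)\<^sup>2)"
    by (intro ennreal_leI bessel_inequality F)
  finally show "(\<Sum>e'\<in>F. ennreal (Re (cinner (proj e e') e'))) \<le> 1"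
    using assms by simp
qed

lemma positive_trace_zero: "positive_trace (\<lambda>_. 0) = 0"
proof -
  have "positive_trace (\<lambda>_. 0) \<le> 0" by (rule positive_trace_le) simp
  then show ?thesis by simp
qed

text \<open>The factor $K_\pi^{-1/p}$ is chosen so that $\sigma K_\pi^{1/p}$ extends to a projection at the points of
  \<open>E\<close> and to zero elsewhere.\<close>

definition rank_one_symbol :: "real \<Rightarrow> sim2 set \<Rightarrow> l2 \<Rightarrow> sim2 \<Rightarrow> op" where
  "rank_one_symbol p E e x = total_op (if x \<in> E then proj e else (\<lambda>_. 0)) \<circ>\<^sub>m K_power (- (1 / p))"

lemma bounded_extension_rank_one_symbol:
  assumes "0 < p"
  shows "bounded_extension (rank_one_symbol p E e x \<circ>\<^sub>m K_power (1 / p)) (if x \<in> E then proj e else (\<lambda>_. 0))"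
  unfolding rank_one_symbol_def
  by (rule bounded_extension_K_inverse) (use assms bounded_clinear_proj bounded_clinear_zero in auto)

lemma rank_one_symbol_in_Lp:
  assumes p: "0 < p" and e: "norm e = 1" and E: "E \<in> sets haar" "emeasure haar E < \<infinity>"
  shows "rank_one_symbol p E e \<in> Lp_symbols p"
proof -
  let ?B = "\<lambda>x. if x \<in> E then proj e else (\<lambda>_. 0)"
  note ext = bounded_extension_rank_one_symbol[OF p, of E e]
  have "linear_op (rank_one_symbol p E e x)" for x
    unfolding rank_one_symbol_def
    by (intro linear_op_map_comp linear_op_K_power linear_op_total) (simp add: bounded_clinear_proj bounded_clinear_zero)
  moreover have "measurable_symbol p (rank_one_symbol p E e)"
    unfolding measurable_symbol_def
  proof (intro exI[of _ ?B] conjI allI)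
    show "AE x in haar. bounded_extension (rank_one_symbol p E e x \<circ>\<^sub>m K_power (1 / p)) (?B x)"
      using ext by simp
    have "(\<lambda>x. cinner (?B x \<phi>) \<psi>) = (\<lambda>x. indicator E x *\<^sub>R cinner (proj e \<phi>) \<psi>)" for \<phi> \<psi>
      by (auto simp: indicator_def)
    then show "(\<lambda>x. cinner (?B x \<phi>) \<psi>) \<in> borel_measurable haar" for \<phi> \<psi>
      using E(1) by simp
  qed
  moreover have "symbol_norm_pow p (rank_one_symbol p E e) < \<infinity>"
  proof -
    have "schatten_pow p (rank_one_symbol p E e x \<circ>\<^sub>m K_power (1 / p)) \<le> indicator E x" for x
    proof -
      have "schatten_pow p (rank_one_symbol p E e x \<circ>\<^sub>m K_power (1 / p)) = positive_trace (?B x)"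
        by (rule schatten_pow_projection_le[OF ext _ _ p]) (auto simp: proj_selfadj proj_idem[OF e])
      then show ?thesis
        using positive_trace_proj_le[OF e] positive_trace_zero by (simp add: indicator_def)
    qed
    then have "symbol_norm_pow p (rank_one_symbol p E e) \<le> (\<integral>\<^sup>+x. indicator E x \<partial>haar)"
      unfolding symbol_norm_pow_def by (intro nn_integral_mono)
    also have "\<dots> = emeasure haar E" using E(1) by simp
    finally show ?thesis using E(2) by (rule order.strict_trans1)
  qed
  ultimately show ?thesis unfolding Lp_symbols_def by blast
qed

section \<open>The two functions on the group and their Wigner transform\<close>

definition bump :: "real \<Rightarrow> real" where "bump a = max 0 (min (a - 1) (2 - a))"
text \<open>Equal to $1$ up to $4$, which bounds $\|b' - b\|/a$ for $b, b' \in [-1,1]^2$ and $a \ge 1$.\<close>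

definition cut_b :: "real \<Rightarrow> real" where "cut_b t = max 0 (min 1 (5 - t))"
text \<open>Equal to $1$ on $[1/2,2]$, where $a'/a$ lies for $a, a' \in [1,2]$.\<close>

definition cut_a :: "real \<Rightarrow> real" where "cut_a t = max 0 (min 1 (min (4 * t - 1) (5 - 2 * t)))"

text \<open>The function $f$ of the argument above, as an amplitude.\<close>

definition rough_amp :: "real \<Rightarrow> (real^2) \<times> real \<Rightarrow> complex" where
  "rough_amp r = (\<lambda>(b, a). lacunary r b * of_real (bump a))"

text \<open>The function $g$ of the argument above.\<close>

definition cutoff :: "sim2 \<Rightarrow> complex" where
  "cutoff = (\<lambda>(b, a, \<theta>). of_real (cut_b (norm b) * cut_a a))"

text \<open>The function $x' \mapsto f(x') g(x'^{-1} x)$ for $x = (b',a',\theta')$.  As \<open>cutoff\<close> depends on the length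
  of the translation and on the dilation alone, no angle occurs.\<close>

definition cut_amp :: "real \<Rightarrow> real^2 \<Rightarrow> real \<Rightarrow> (real^2) \<times> real \<Rightarrow> complex" where
  "cut_amp r b' a' = (\<lambda>(b, a). rough_amp r (b, a) * of_real (cut_b (norm (b' - b) / a) * cut_a (a' / a)))"

lemma inv_mult_SIM2:
  assumes x: "(b, a, \<theta>) \<in> carrier SIM2" and y: "(b', a', \<theta>') \<in> carrier SIM2"
  shows "cutoff (inv\<^bsub>SIM2\<^esub> (b, a, \<theta>) \<otimes>\<^bsub>SIM2\<^esub> (b', a', \<theta>')) = of_real (cut_b (norm (b' - b) / a) * cut_a (a' / a))"
proof -
  interpret group SIM2 by (rule group_SIM2)
  obtain c d \<tau> where w: "inv\<^bsub>SIM2\<^esub> (b, a, \<theta>) \<otimes>\<^bsub>SIM2\<^esub> (b', a', \<theta>') = (c, d, \<tau>)"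
    by (cases "inv\<^bsub>SIM2\<^esub> (b, a, \<theta>) \<otimes>\<^bsub>SIM2\<^esub> (b', a', \<theta>')")
  have "(b, a, \<theta>) \<otimes>\<^bsub>SIM2\<^esub> (c, d, \<tau>) = (b', a', \<theta>')"
    unfolding w[symmetric] using x y by (simp add: m_assoc[symmetric])
  then have *: "b + a *\<^sub>R (rot \<theta> *v c) = b'" "a * d = a'"
    by (auto simp: SIM2_def)
  have a: "0 < a" using x by (auto simp: SIM2_def)
  have "b' - b = act a (- \<theta>) c" using *(1) by (auto simp: act_def)
  then have "norm (b' - b) / a = norm c" using a by (simp add: norm_act)
  moreover have "a' / a = d" using *(2) a by (auto simp: field_simps)
  ultimately show ?thesis by (simp add: w cutoff_def)
qed

lemma bump_bounds: "0 \<le> bump a" "bump a \<le> 1" "a \<notin> {1..2} \<Longrightarrow> bump a = 0"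
  by (auto simp: bump_def)

lemma cut_bounds: "0 \<le> cut_b t" "cut_b t \<le> 1" "0 \<le> cut_a t" "cut_a t \<le> 1"
  by (auto simp: cut_b_def cut_a_def)

lemma cut_supp: "cut_b t \<noteq> 0 \<Longrightarrow> t \<le> 5" "cut_a t \<noteq> 0 \<Longrightarrow> 1 / 4 \<le> t" "cut_a t \<noteq> 0 \<Longrightarrow> t \<le> 5 / 2"
  by (auto simp: cut_b_def cut_a_def max_def min_def split: if_splits)

lemma cut_measurable [measurable]:
  "bump \<in> borel_measurable borel" "cut_b \<in> borel_measurable borel" "cut_a \<in> borel_measurable borel"
  unfolding bump_def[abs_def] cut_b_def[abs_def] cut_a_def[abs_def] by measurable

text \<open>If $a \le 2$, $\|b\| \le 2$ and $\|b' - b\| \le 5a$, then $\|b'\| \le 12$; the bounds on $a'$ come from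
  $1/4 \le a'/a \le 5/2$ and $1 \le a \le 2$.\<close>

definition support_box :: "sim2 set" where
  "support_box = cball 0 12 \<times> {1 / 4..5} \<times> UNIV"

lemma emeasure_haar_box:
  assumes B: "bounded B" "B \<in> sets borel" and \<alpha>: "0 < \<alpha>"
  shows "emeasure haar ((B \<times> {\<alpha>..\<beta>} \<times> UNIV) \<inter> carrier SIM2) < \<infinity>"
proof -
  let ?S = "(B \<times> {\<alpha>..\<beta>} \<times> UNIV) \<inter> carrier SIM2"
  let ?T = "B \<times> {\<alpha>..\<beta>} \<times> {0..2 * pi}"
  have S: "?S \<in> sets borel"
    using B(2) by (intro sets.Int borel_Times borel_carrier) auto
  have bT: "bounded ?T"
    using B(1) by (intro bounded_Times) auto
  have T: "?T \<in> sets borel"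
    using B(2) by (intro borel_Times) auto
  have "?S \<in> sets haar"
    unfolding sets_haar sets_restrict_space using S by blast
  then have "emeasure haar ?S = (\<integral>\<^sup>+z. indicator ?S z \<partial>haar)" by simp
  also have "\<dots> = (\<integral>\<^sup>+z. indicator (carrier SIM2) z * ennreal (1 / fst (snd z) ^ 3) * indicator ?S z \<partial>lborel)"
    by (rule nn_integral_haar) (rule borel_measurable_indicator[OF S])
  also have "\<dots> \<le> (\<integral>\<^sup>+z. ennreal (1 / \<alpha> ^ 3) * indicator ?T z \<partial>lborel)"
    using \<alpha> by (intro nn_integral_mono)
      (auto simp: indicator_def SIM2_def intro!: ennreal_leI divide_left_mono power_mono mult_pos_pos zero_less_power)
  also have "\<dots> = ennreal (1 / \<alpha> ^ 3) * emeasure lborel ?T"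
    using T by (intro nn_integral_cmult_indicator) simp
  also have "\<dots> < \<infinity>"
    using emeasure_bounded_finite[OF bT] by (simp add: ennreal_mult_less_top)
  finally show ?thesis .
qed

lemma cutoff_in_Cc: "cutoff \<in> Cc_SIM2"
  unfolding Cc_SIM2_def mem_Collect_eq
proof (intro conjI exI[of _ "cball 0 5 \<times> {1 / 4..5 / 2}"])
  show "continuous_on (UNIV \<times> {0<..} \<times> UNIV) (\<lambda>(b, a, t). cutoff (b, a, t rmod (2 * pi)))"
    unfolding cutoff_def cut_a_def cut_b_def split_beta' by (auto intro!: continuous_intros)
  show "compact (cball (0 :: real^2) 5 \<times> {1 / 4..5 / 2::real})" by (intro compact_Times) auto
  have "cutoff (b, a, \<theta>) = 0" if "(b, a) \<notin> cball 0 5 \<times> {1 / 4..5 / 2}" for b a \<theta>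
    using that by (auto simp: cutoff_def cut_b_def cut_a_def)
  then show "\<forall>(b, a, \<theta>)\<in>carrier SIM2. (b, a) \<notin> cball 0 5 \<times> {1 / 4..5 / 2} \<longrightarrow> cutoff (b, a, \<theta>) = 0"
    by auto
qed auto

lemma square_integrable_haar_box:
  assumes f: "f \<in> borel_measurable haar" and bd: "\<And>z. cmod (f z) \<le> M"
    and supp: "\<And>b a \<theta>. (b, a) \<notin> cball 0 R \<times> {\<alpha>..\<beta>} \<Longrightarrow> f (b, a, \<theta>) = 0" and \<alpha>: "0 < \<alpha>"
  shows "square_integrable haar f"
proof -
  let ?S = "(cball (0 :: real^2) R \<times> {\<alpha>..\<beta>} \<times> UNIV) \<inter> carrier SIM2"
  have fin: "emeasure haar ?S < \<infinity>" by (rule emeasure_haar_box) (use \<alpha> in auto)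
  have "cball (0 :: real^2) R \<times> {\<alpha>..\<beta>} \<times> (UNIV :: real set) \<in> sets borel"
    by (intro borel_Times) auto
  then have "?S \<in> sets haar"
    unfolding sets_haar sets_restrict_space by blast
  have "(\<integral>\<^sup>+z. ennreal ((cmod (f z))\<^sup>2) \<partial>haar) \<le> (\<integral>\<^sup>+z. ennreal (M\<^sup>2) * indicator ?S z \<partial>haar)"
  proof (rule nn_integral_mono)
    fix z assume "z \<in> space haar"
    then show "ennreal ((cmod (f z))\<^sup>2) \<le> ennreal (M\<^sup>2) * indicator ?S z"
      using bd[of z] supp[of "fst z" "fst (snd z)" "snd (snd z)"]
      by (cases "z \<in> ?S") (auto simp: space_haar mem_Times_iff intro!: ennreal_leI power_mono)
  qed
  also have "\<dots> = ennreal (M\<^sup>2) * emeasure haar ?S"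
    by (rule nn_integral_cmult_indicator) fact
  also have "\<dots> < \<infinity>" using fin by (simp add: ennreal_mult_less_top)
  finally have "(\<integral>\<^sup>+z. ennreal ((cmod (f z))\<^sup>2) \<partial>haar) < \<infinity>" .
  with f show ?thesis unfolding square_integrable_iff_nn_integral by (rule conjI)
qed

lemma cutoff_in_L2: "cutoff \<in> L2_SIM2"
  unfolding L2_SIM2_def mem_Collect_eq
proof (rule square_integrable_haar_box[where R = 5 and \<alpha> = "1 / 4" and \<beta> = "5 / 2" and M = 1])
  have "continuous_on UNIV cutoff"
    unfolding cutoff_def cut_a_def cut_b_def split_beta' by (auto intro!: continuous_intros)
  then show "cutoff \<in> borel_measurable haar"
    by (intro borel_measurable_haarI borel_measurable_continuous_onI)
  show "cmod (cutoff z) \<le> 1" for z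
    by (auto simp: cutoff_def norm_mult abs_mult cut_bounds split: prod.split intro!: mult_le_one)
  show "cutoff (b, a, \<theta>) = 0" if "(b, a) \<notin> cball 0 5 \<times> {1 / 4..5 / 2}" for b a \<theta>
    using that by (auto simp: cutoff_def cut_b_def cut_a_def)
qed simp

context
  fixes r :: real
  assumes r: "0 < r" "r < 1"
begin

lemma rough_amp_comp_measurable:
  assumes [measurable]: "f \<in> borel_measurable N" "g \<in> borel_measurable N"
  shows "(\<lambda>y. rough_amp r (f y, g y)) \<in> borel_measurable N"
  unfolding rough_amp_def split using lacunary_measurable[OF r] by measurable

lemma cut_amp_comp_measurable:
  assumes [measurable]: "f \<in> borel_measurable N" "g \<in> borel_measurable N" "f' \<in> borel_measurable N" "g' \<in> borel_measurable N"
  shows "(\<lambda>y. cut_amp r (f' y) (g' y) (f y, g y)) \<in> borel_measurable N"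
proof -
  have "(\<lambda>y. complex_of_real (cut_b (norm (f' y - f y) / g y) * cut_a (g' y / g y))) \<in> borel_measurable N"
    by measurable
  then show ?thesis
    unfolding cut_amp_def split by (rule borel_measurable_times[OF rough_amp_comp_measurable[OF assms(1,2)]])
qed

lemma amplitude_rough_amp: "amplitude (1 / (1 - r)) (rough_amp r)"
  unfolding amplitude_def
proof (intro conjI allI impI)
  have "(\<lambda>y. rough_amp r (fst y, snd y)) \<in> borel_measurable borel"
    by (rule rough_amp_comp_measurable) (intro borel_measurable_continuous_onI continuous_intros)+
  then show "rough_amp r \<in> borel_measurable borel" by simp
  show "cmod (rough_amp r z) \<le> 1 / (1 - r)" for z
  proof -
    have "cmod (lacunary r (fst z)) * \<bar>bump (snd z)\<bar> \<le> 1 / (1 - r) * 1"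
      by (intro mult_mono norm_lacunary_le[OF r]) (use r bump_bounds in auto)
    then show ?thesis by (simp add: rough_amp_def split_beta' norm_mult)
  qed
  show "rough_amp r (b, a) = 0" if "b \<notin> unit_square \<or> a \<notin> {1..2}" for b a
    using that lacunary_supp[OF r, of b] bump_bounds(3)[of a] by (auto simp: rough_amp_def)
qed

text \<open>The indicator records that the product vanishes unless $x$ lies in a fixed box, which makes
  $\|W(f,g)\|_{2,\mu}$ finite.\<close>

lemma amplitude_cut_amp:
  "amplitude (1 / (1 - r) * indicator support_box x) (cut_amp r (fst x) (fst (snd x)))"
proof -
  let ?G = "cut_amp r (fst x) (fst (snd x))"
  have 0: "?G (b, a) = 0" if "b \<notin> unit_square \<or> a \<notin> {1..2} \<or> x \<notin> support_box" for b a
  proof (rule ccontr)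
    assume nz: "?G (b, a) \<noteq> 0"
    then have "rough_amp r (b, a) \<noteq> 0" and c: "cut_b (norm (fst x - b) / a) \<noteq> 0" "cut_a (fst (snd x) / a) \<noteq> 0"
      by (auto simp: cut_amp_def)
    then have ba: "b \<in> unit_square" "1 \<le> a" "a \<le> 2"
      using amplitude_rough_amp unfolding amplitude_def by fastforce+
    have "norm b \<le> 2"
      using norm_le_l1_cart[of b] ba by (simp add: sum_2)
    moreover have "norm (fst x - b) / a \<le> 5" by (rule cut_supp(1)[OF c(1)])
    then have "norm (fst x - b) \<le> 10" using ba by (simp add: field_simps)
    ultimately have "norm (fst x) \<le> 12" using norm_triangle_sub[of "fst x" b] by linarith
    moreover have "1 / 4 \<le> fst (snd x) / a" "fst (snd x) / a \<le> 5 / 2"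
      by (rule cut_supp(2)[OF c(2)] cut_supp(3)[OF c(2)])+
    then have "1 / 4 \<le> fst (snd x)" "fst (snd x) \<le> 5" using ba by (auto simp: field_simps)
    ultimately have "x \<in> support_box" by (auto simp: support_box_def mem_Times_iff)
    then show False using that ba by auto
  qed
  have bd: "cmod (?G z) \<le> 1 / (1 - r)" for z
  proof -
    have "cmod (rough_amp r z) * \<bar>cut_b (norm (fst x - fst z) / snd z) * cut_a (fst (snd x) / snd z)\<bar> \<le> 1 / (1 - r) * 1"
      using amp_le[OF amplitude_rough_amp, of z] r
      by (intro mult_mono) (auto simp: abs_mult cut_bounds intro!: mult_le_one)
    then show ?thesis by (simp add: cut_amp_def split_beta' norm_mult abs_mult)
  qed
  show ?thesis
    unfolding amplitude_def
  proof (intro conjI allI impI)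
    have "(\<lambda>y. ?G (fst y, snd y)) \<in> borel_measurable borel"
      by (rule cut_amp_comp_measurable) (intro borel_measurable_continuous_onI continuous_intros)+
    then show "?G \<in> borel_measurable borel" by simp
    show "cmod (?G z) \<le> 1 / (1 - r) * indicator support_box x" for z
      using bd[of z] 0[of "fst z" "snd z"] by (cases "x \<in> support_box") auto
  qed (use 0 in blast)
qed

lemma wigner_Cc_cut:
  assumes "x \<in> carrier SIM2"
  shows "wigner_Cc (lift_amp (rough_amp r)) cutoff x = pi_op (lift_amp (cut_amp r (fst x) (fst (snd x))))"
proof (rule wigner_Cc_eq_pi_op)
  fix x' assume x': "x' \<in> carrier SIM2"
  obtain b a \<theta> b' a' \<theta>' where e: "x' = (b, a, \<theta>)" "x = (b', a', \<theta>')" by (metis prod_cases3)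
  show "lift_amp (rough_amp r) x' * cutoff (inv\<^bsub>SIM2\<^esub> x' \<otimes>\<^bsub>SIM2\<^esub> x) = lift_amp (cut_amp r (fst x) (fst (snd x))) x'"
    using inv_mult_SIM2[of b a \<theta> b' a' \<theta>'] x' assms by (simp add: e lift_amp_def cut_amp_def)
qed (rule lift_amp_borel[OF amplitude_cut_amp] integrable_lift_amp[OF amplitude_cut_amp])+

definition wigner_symbol :: "sim2 \<Rightarrow> op" where
  "wigner_symbol x = total_op (wigner_Cc (lift_amp (rough_amp r)) cutoff x) |` dom (K_power (- 1 / 2))"

lemma bounded_extension_wigner_symbol:
  assumes "x \<in> carrier SIM2"
  shows "bounded_extension (wigner_symbol x \<circ>\<^sub>m K_power (1 / 2)) (kernel_op (amp_kernel (cut_amp r (fst x) (fst (snd x)))))"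
proof -
  let ?B = "kernel_op (amp_kernel (cut_amp r (fst x) (fst (snd x))))"
  have eq: "(wigner_symbol x \<circ>\<^sub>m K_power (1 / 2)) \<phi> = Some (?B \<phi>)" if K: "K_power (1 / 2) \<phi> = Some \<psi>" for \<phi> \<psi>
  proof -
    have d: "\<psi> \<in> dom (K_power (- 1 / 2))" using K_power_inverse[OF K] by auto
    have \<psi>: "square_integrable lborel (\<lambda>\<eta>. of_real (norm \<eta>) * rep_l2 \<phi> \<eta>)" "\<psi> = abs_l2 (\<lambda>\<eta>. of_real (norm \<eta>) * rep_l2 \<phi> \<eta>)"
      using K unfolding K_power_eq_Some_iff by simp_all
    have "(wigner_symbol x \<circ>\<^sub>m K_power (1 / 2)) \<phi> = Some (wigner_Cc (lift_amp (rough_amp r)) cutoff x \<psi>)"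
      using d by (simp add: wigner_symbol_def map_comp_def K total_op_def)
    then show ?thesis
      unfolding wigner_Cc_cut[OF assms] \<psi>(2) pi_op_lift_amp[OF amplitude_cut_amp \<psi>(1)] .
  qed
  have "dom (wigner_symbol x \<circ>\<^sub>m K_power (1 / 2)) = dom (K_power (1 / 2))"
    using eq by (fastforce simp: dom_def map_comp_Some_iff)
  then show ?thesis
    unfolding bounded_extension_def map_le_def
    using eq bounded_clinear_kernel_op[OF L2_kernel_amp_kernel[OF amplitude_cut_amp]]
    by (auto simp: closure_dom_K_power total_op_def)
qed

text \<open>Matrix coefficients of an integral operator are integrals against its kernel, which is jointly
  measurable in $x$ and the two plane variables.\<close>

lemma measurable_wigner_symbol: "measurable_symbol 2 wigner_symbol"
  unfolding measurable_symbol_def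
proof (intro exI[of _ "\<lambda>x. kernel_op (amp_kernel (cut_amp r (fst x) (fst (snd x))))"] conjI allI)
  show "AE x in haar. bounded_extension (wigner_symbol x \<circ>\<^sub>m K_power (1 / 2)) (kernel_op (amp_kernel (cut_amp r (fst x) (fst (snd x)))))"
    by (rule AE_I2) (simp add: space_haar bounded_extension_wigner_symbol)
  fix \<phi> \<psi>
  let ?N = "haar \<Otimes>\<^sub>M (lborel :: ((real^2) \<times> (real^2)) measure)"
  have c: "(\<lambda>x :: sim2. fst x) \<in> borel_measurable borel" "(\<lambda>x :: sim2. fst (snd x)) \<in> borel_measurable borel"
    "(\<lambda>z :: (real^2) \<times> (real^2). fst z) \<in> borel_measurable borel" "(\<lambda>z :: (real^2) \<times> (real^2). snd z) \<in> borel_measurable borel"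
    by (intro borel_measurable_continuous_onI continuous_intros)+
  have p: "(\<lambda>y. fst (fst y)) \<in> borel_measurable ?N" "(\<lambda>y. fst (snd (fst y))) \<in> borel_measurable ?N"
    by (rule measurable_compose[OF measurable_fst borel_measurable_haarI[OF c(1)]]
        measurable_compose[OF measurable_fst borel_measurable_haarI[OF c(2)]])+
  have "(\<lambda>y. snd y) \<in> measurable ?N borel" using measurable_snd[of haar "lborel :: ((real^2) \<times> (real^2)) measure"] by simp
  then have q: "(\<lambda>y. fst (snd y)) \<in> borel_measurable ?N" "(\<lambda>y. snd (snd y)) \<in> borel_measurable ?N"
    by (rule measurable_compose[OF _ c(3)] measurable_compose[OF _ c(4)])+
  have hat: "(\<lambda>y. fourier (\<lambda>b. cut_amp r (fst (fst y)) (fst (snd (fst y))) (b, norm (snd (snd y)) / norm (fst (snd y)))) (fst (snd y))) \<in> borel_measurable ?N"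
  proof (rule borel_measurable_fourier_comp[OF _ q(1)], unfold split_beta', rule cut_amp_comp_measurable)
    show "(\<lambda>x. snd x) \<in> borel_measurable (?N \<Otimes>\<^sub>M (lborel :: (real^2) measure))"
      using measurable_snd[of ?N "lborel :: (real^2) measure"] by simp
    have "(\<lambda>y. norm (snd (snd y)) / norm (fst (snd y))) \<in> borel_measurable ?N"
      by (intro borel_measurable_divide borel_measurable_norm[THEN measurable_compose[rotated]] q)
    then show "(\<lambda>x. norm (snd (snd (fst x))) / norm (fst (snd (fst x)))) \<in> borel_measurable (?N \<Otimes>\<^sub>M (lborel :: (real^2) measure))"
      by (rule measurable_compose[OF measurable_fst])
  qed (rule measurable_compose[OF measurable_fst p(1)] measurable_compose[OF measurable_fst p(2)])+
  have "(\<lambda>y. (amp_hat (cut_amp r (fst (fst y)) (fst (snd (fst y)))) (fst (snd y)) (norm (snd (snd y)) / norm (fst (snd y)))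
        * of_real (norm (fst (snd y)) / (norm (snd (snd y)))\<^sup>2))
      * (rep_l2 \<phi> (snd (snd y)) * cnj (rep_l2 \<psi> (fst (snd y))))) \<in> borel_measurable ?N"
    unfolding amp_hat_def
  proof (intro borel_measurable_times hat)
    have "(\<lambda>z. (of_real (norm (fst z) / (norm (snd z))\<^sup>2) :: complex)) \<in> borel_measurable (borel :: ((real^2) \<times> (real^2)) measure)"
      using c(3,4) by measurable
    from measurable_compose[OF \<open>(\<lambda>y. snd y) \<in> measurable ?N borel\<close> this]
    show "(\<lambda>y. (of_real (norm (fst (snd y)) / (norm (snd (snd y)))\<^sup>2) :: complex)) \<in> borel_measurable ?N" .
    show "(\<lambda>y. rep_l2 \<phi> (snd (snd y))) \<in> borel_measurable ?N"
      by (rule measurable_compose[OF q(2) borel_measurable_rep_l2])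
    show "(\<lambda>y. cnj (rep_l2 \<psi> (fst (snd y)))) \<in> borel_measurable ?N"
      by (rule borel_measurable_cnj[OF measurable_compose[OF q(1) borel_measurable_rep_l2]])
  qed
  then have "(\<lambda>(x, z). amp_kernel (cut_amp r (fst x) (fst (snd x))) z * (rep_l2 \<phi> (snd z) * cnj (rep_l2 \<psi> (fst z)))) \<in> borel_measurable ?N"
    unfolding amp_kernel_def split_beta' .
  from lborel.borel_measurable_lebesgue_integral[OF this]
  show "(\<lambda>x. cinner (kernel_op (amp_kernel (cut_amp r (fst x) (fst (snd x)))) \<phi>) \<psi>) \<in> borel_measurable haar"
    unfolding cinner_kernel_op(1)[OF L2_kernel_amp_kernel[OF amplitude_cut_amp]] .
qed

lemma wigner_symbol_in_Lp: "wigner_symbol \<in> Lp_symbols 2"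
proof -
  have "linear_op (wigner_symbol x)" if "x \<in> carrier SIM2" for x
    unfolding wigner_symbol_def wigner_Cc_cut[OF that]
    by (intro linear_op_restrict_dom linear_op_K_power linear_op_total
        bounded_clinear_pi_op lift_amp_borel[OF amplitude_cut_amp] integrable_lift_amp[OF amplitude_cut_amp])
  moreover have "symbol_norm_pow 2 wigner_symbol < \<infinity>"
  proof -
    let ?C = "32 * pi ^ 3 * (1 / (1 - r))\<^sup>2" and ?S = "support_box \<inter> carrier SIM2"
    have S: "?S \<in> sets haar" "emeasure haar ?S < \<infinity>"
    proof -
      have "support_box \<in> sets borel"
        unfolding support_box_def by (intro borel_Times) auto
      then show "?S \<in> sets haar" unfolding sets_haar sets_restrict_space by blast
      show "emeasure haar ?S < \<infinity>"
        unfolding support_box_def by (rule emeasure_haar_box) auto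
    qed
    have "symbol_norm_pow 2 wigner_symbol \<le> (\<integral>\<^sup>+x. ennreal ?C * indicator ?S x \<partial>haar)"
      unfolding symbol_norm_pow_def
    proof (rule nn_integral_mono)
      fix x assume "x \<in> space haar"
      then have x: "x \<in> carrier SIM2" by (simp add: space_haar)
      have "schatten_pow 2 (wigner_symbol x \<circ>\<^sub>m K_power (1 / 2))
          \<le> sq_norm (amp_kernel (cut_amp r (fst x) (fst (snd x))))"
        by (rule schatten_pow_2_le[OF bounded_extension_wigner_symbol[OF x] L2_kernel_amp_kernel[OF amplitude_cut_amp]])
      also have "\<dots> \<le> ennreal (32 * pi ^ 3 * (1 / (1 - r) * indicator support_box x)\<^sup>2)"
        by (rule nn_integral_amp_kernel_le[OF amplitude_cut_amp])
      also have "\<dots> = ennreal ?C * indicator ?S x"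
        using x by (simp add: indicator_def)
      finally show "schatten_pow 2 (wigner_symbol x \<circ>\<^sub>m K_power (1 / 2)) \<le> ennreal ?C * indicator ?S x" .
    qed
    also have "\<dots> = ennreal ?C * emeasure haar ?S"
      by (rule nn_integral_cmult_indicator[OF S(1)])
    also have "\<dots> < \<infinity>" using S(2) by (simp add: ennreal_mult_less_top)
    finally show ?thesis .
  qed
  ultimately show ?thesis
    unfolding Lp_symbols_def using measurable_wigner_symbol by blast
qed

lemma rough_in_Cc: "lift_amp (rough_amp r) \<in> Cc_SIM2"
  unfolding Cc_SIM2_def mem_Collect_eq
proof (intro conjI exI[of _ "cball 0 2 \<times> {1..2}"])
  have "continuous_on UNIV (\<lambda>z :: sim2. lacunary r (fst z) * complex_of_real (max 0 (min (fst (snd z) - 1) (2 - fst (snd z)))))"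
    by (intro continuous_intros continuous_on_compose2[OF continuous_lacunary[OF r]]) auto
  then show "continuous_on (UNIV \<times> {0<..} \<times> UNIV) (\<lambda>(b, a, t). lift_amp (rough_amp r) (b, a, t rmod (2 * pi)))"
    unfolding lift_amp_def rough_amp_def bump_def split_beta' by (auto intro: continuous_on_subset)
  show "compact (cball (0 :: real^2) 2 \<times> {1..2::real})" by (intro compact_Times) auto
  have "lift_amp (rough_amp r) (b, a, \<theta>) = 0" if "(b, a) \<notin> cball 0 2 \<times> {1..2}" for b a \<theta>
  proof -
    have "norm b \<le> 2" if "b \<in> unit_square" using norm_le_l1_cart[of b] that by (simp add: sum_2)
    then have "b \<notin> unit_square \<or> a \<notin> {1..2}" using that by auto
    then show ?thesis using amplitude_rough_amp unfolding amplitude_def lift_amp_def by simp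
  qed
  then show "\<forall>(b, a, \<theta>)\<in>carrier SIM2. (b, a) \<notin> cball 0 2 \<times> {1..2} \<longrightarrow> lift_amp (rough_amp r) (b, a, \<theta>) = 0"
    by auto
qed auto

lemma rough_in_L2: "lift_amp (rough_amp r) \<in> L2_SIM2"
  unfolding L2_SIM2_def mem_Collect_eq
proof (rule square_integrable_haar_box[where R = 2 and \<alpha> = 1 and \<beta> = 2 and M = "1 / (1 - r)"])
  show "lift_amp (rough_amp r) \<in> borel_measurable haar"
    by (rule borel_measurable_haarI[OF lift_amp_borel[OF amplitude_rough_amp]])
  show "cmod (lift_amp (rough_amp r) z) \<le> 1 / (1 - r)" for z
    using amplitude_rough_amp unfolding amplitude_def lift_amp_def by blast
  show "lift_amp (rough_amp r) (b, a, \<theta>) = 0" if "(b, a) \<notin> cball 0 2 \<times> {1..2}" for b a \<theta>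
  proof -
    have "norm b \<le> 2" if "b \<in> unit_square" using norm_le_l1_cart[of b] that by (simp add: sum_2)
    then have "b \<notin> unit_square \<or> a \<notin> {1..2}" using that by auto
    then show ?thesis using amplitude_rough_amp unfolding amplitude_def lift_amp_def by simp
  qed
qed simp

text \<open>Both functions lie in $C_c(G)$, so constant sequences approximate them, and the difference of
  symbols vanishes on the domain of $K_\pi^{-1/2}$.\<close>

lemma wigner_symbol_in_wigner: "wigner_symbol \<in> wigner (lift_amp (rough_amp r)) cutoff"
proof -
  let ?f = "lift_amp (rough_amp r)"
  have d: "dom (wigner_symbol x) = dom (K_power (- 1 / 2))" for x
    by (auto simp: wigner_symbol_def total_op_def)
  have zero: "schatten_pow 2 (op_diff (total_op T) (total_op T |` dom (K_power (- 1 / 2))) \<circ>\<^sub>m K_power (1 / 2)) = 0" for T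
  proof -
    let ?A = "op_diff (total_op T) (total_op T |` dom (K_power (- 1 / 2))) \<circ>\<^sub>m K_power (1 / 2)"
    have eq: "?A \<phi> = Some 0" if K: "K_power (1 / 2) \<phi> = Some \<psi>" for \<phi> \<psi>
      using K_power_inverse[OF K] by (auto simp: map_comp_def K op_diff_def total_op_def restrict_map_def)
    then have "dom ?A = dom (K_power (1 / 2))" by (fastforce simp: dom_def map_comp_Some_iff)
    then have "bounded_extension ?A (\<lambda>_. 0)"
      unfolding bounded_extension_def map_le_def using eq bounded_clinear_zero
      by (auto simp: closure_dom_K_power total_op_def)
    then have "schatten_pow 2 ?A = positive_trace (\<lambda>_. 0)"
      by (rule schatten_pow_projection_le) simp_all
    then show ?thesis by (simp add: positive_trace_zero)
  qed
  have "symbol_norm_pow 2 (\<lambda>x. op_diff (total_op (wigner_Cc ?f cutoff x)) (wigner_symbol x)) = 0"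
    unfolding symbol_norm_pow_def wigner_symbol_def zero by simp
  then show ?thesis
    unfolding wigner_def mem_Collect_eq
    by (intro conjI exI[of _ "\<lambda>_. ?f"] exI[of _ "\<lambda>_. cutoff"])
       (auto simp: wigner_symbol_in_Lp d rough_in_Cc cutoff_in_Cc L2_norm_def)
qed

end

section \<open>The pairing is not defined\<close>

definition annulus :: "nat \<Rightarrow> (real^2) set" where
  "annulus n = {\<eta>. 2 ^ n \<le> norm \<eta> \<and> norm \<eta> \<le> 2 ^ (n + 2)}"

text \<open>The image under $K_\pi^{q/2}$ of the indicator of an annulus.\<close>

definition shell :: "real \<Rightarrow> nat \<Rightarrow> real^2 \<Rightarrow> complex" where
  "shell q n \<eta> = of_real (norm \<eta> powr q * indicator (annulus n) \<eta>)"

lemma annulus_measurable [measurable]: "annulus n \<in> sets borel"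
  unfolding annulus_def by measurable

lemma shell_measurable [measurable]: "shell q n \<in> borel_measurable borel"
  unfolding shell_def[abs_def] by measurable

lemma nn_integral_shell_0: "sq_norm (shell 0 n) \<le> ennreal ((8 * 2 ^ n)\<^sup>2)"
proof -
  let ?I = "{- (2 ^ (n + 2))..2 ^ (n + 2)} :: real set"
  let ?B = "{v :: real^2. v $ 1 \<in> ?I \<and> v $ 2 \<in> ?I}"
  have sub: "annulus n \<subseteq> ?B"
  proof
    fix v :: "real^2" assume "v \<in> annulus n"
    then have "\<bar>v $ i\<bar> \<le> 2 ^ (n + 2)" for i
      unfolding annulus_def by (intro order_trans[OF component_le_norm_cart]) simp
    from this[of 1] this[of 2] show "v \<in> ?B" unfolding abs_le_iff by simp
  qed
  have "sq_norm (shell 0 n) \<le> (\<integral>\<^sup>+\<eta>. indicator ?B \<eta> \<partial>lborel)"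
  proof (rule nn_integral_mono)
    fix \<eta> :: "real^2"
    show "ennreal ((cmod (shell 0 n \<eta>))\<^sup>2) \<le> indicator ?B \<eta>"
    proof (cases "\<eta> \<in> annulus n")
      case True
      then have "\<eta> \<in> ?B" using sub by blast
      then show ?thesis by (simp add: shell_def norm_mult True)
    qed (simp add: shell_def)
  qed
  also have "\<dots> = emeasure lborel ?B" by simp
  also have "\<dots> = emeasure lborel ?I * emeasure lborel ?I"
    by (rule emeasure_vec2) auto
  also have "emeasure lborel ?I = ennreal (8 * 2 ^ n)" by simp
  also have "ennreal (8 * 2 ^ n) * ennreal (8 * 2 ^ n) = ennreal ((8 * 2 ^ n)\<^sup>2)"
    unfolding power2_eq_square by (rule ennreal_mult[symmetric]) auto
  finally show ?thesis .
qed

lemma square_integrable_shell_0: "square_integrable lborel (shell 0 n)"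
proof -
  have "ennreal ((8 * 2 ^ n)\<^sup>2) < \<infinity>" by simp
  with nn_integral_shell_0[of n] have "sq_norm (shell 0 n) < \<infinity>"
    by (rule order.strict_trans1)
  moreover have "shell 0 n \<in> borel_measurable lborel" by simp
  ultimately show ?thesis unfolding square_integrable_iff_nn_integral by blast
qed

lemma norm_shell_0: "norm (abs_l2 (shell 0 n)) \<le> 8 * 2 ^ n"
proof -
  have "ennreal ((norm (abs_l2 (shell 0 n)))\<^sup>2) \<le> ennreal ((8 * 2 ^ n)\<^sup>2)"
    unfolding norm_abs_l2[OF square_integrable_shell_0] by (rule nn_integral_shell_0)
  then have "(norm (abs_l2 (shell 0 n)))\<^sup>2 \<le> (8 * 2 ^ n)\<^sup>2"
    by (subst (asm) ennreal_le_iff) simp_all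
  then show ?thesis by (rule power2_le_imp_le) simp
qed

lemma square_integrable_shell: "square_integrable lborel (shell q n)"
proof (rule square_integrable_dominated[OF square_integrable_shell_0[of n] shell_measurable])
  fix \<eta> :: "real^2"
  show "cmod (shell q n \<eta>) \<le> max ((2 ^ n) powr q) ((2 ^ (n + 2)) powr q) * cmod (shell 0 n \<eta>)"
  proof (cases "\<eta> \<in> annulus n")
    case True
    then have b: "2 ^ n \<le> norm \<eta>" "norm \<eta> \<le> 2 ^ (n + 2)" by (auto simp: annulus_def)
    then have pos: "0 < norm \<eta>" by (smt (verit) zero_less_power)
    have "norm \<eta> powr q \<le> max ((2 ^ n) powr q) ((2 ^ (n + 2)) powr q)"
    proof (cases "0 \<le> q")
      case True
      then have "norm \<eta> powr q \<le> (2 ^ (n + 2)) powr q" using b by (intro powr_mono2) auto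
      then show ?thesis by simp
    next
      case False
      then have "norm \<eta> powr q \<le> (2 ^ n) powr q" using b by (intro powr_mono2') auto
      then show ?thesis by simp
    qed
    then show ?thesis using True pos by (auto simp: shell_def)
  qed (simp add: shell_def)
qed

lemma K_power_shell: "K_power c (abs_l2 (shell q n)) = Some (abs_l2 (shell (2 * c + q) n))"
proof -
  have eq: "mult_norm_powr c (shell q n) = shell (2 * c + q) n"
    by (simp add: fun_eq_iff shell_def powr_add)
  show ?thesis
    using K_power_abs[OF square_integrable_shell[of q n], of c] unfolding eq
    by (simp add: square_integrable_shell)
qed

text \<open>The cutoff is $1$ at $x'^{-1} x$ whenever $x$ is as stated and $x'$ is in the support of $f$.\<close>

lemma cut_amp_eq_rough_amp:
  assumes x: "b' \<in> unit_square" "a' \<in> {1..2}"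
  shows "cut_amp r b' a' = rough_amp r"
proof (rule ext, clarify)
  fix b :: "real^2" and a :: real
  show "cut_amp r b' a' (b, a) = rough_amp r (b, a)"
  proof (cases "rough_amp r (b, a) = 0")
    case True
    then show ?thesis by (simp add: cut_amp_def)
  next
    case False
    then have "tent (b $ 1) \<noteq> 0" "tent (b $ 2) \<noteq> 0" "bump a \<noteq> 0"
      by (auto simp: rough_amp_def lacunary_def)
    then have ba: "\<bar>b $ 1\<bar> \<le> 1" "\<bar>b $ 2\<bar> \<le> 1" "1 \<le> a" "a \<le> 2"
      by (auto simp: tent_def bump_def)
    have "norm (b' - b) \<le> \<bar>(b' - b) $ 1\<bar> + \<bar>(b' - b) $ 2\<bar>"
      using norm_le_l1_cart[of "b' - b"] by (simp add: sum_2)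
    also have "\<dots> \<le> 4" using ba x by auto
    finally have "norm (b' - b) / a \<le> 4" using ba by (simp add: field_simps)
    then have 1: "cut_b (norm (b' - b) / a) = 1" by (auto simp: cut_b_def)
    have "1 / 2 \<le> a' / a" "a' / a \<le> 2" using ba x by (auto simp: field_simps)
    then have 2: "cut_a (a' / a) = 1" by (auto simp: cut_a_def min_def max_def)
    show ?thesis by (simp add: cut_amp_def 1 2)
  qed
qed

lemma bump_mass_pos:
  "integrable lborel (\<lambda>z. indicator half_strip z / (fst z)\<^sup>2 * bump (fst z))"
  "0 < (\<integral>z. indicator half_strip z / (fst z)\<^sup>2 * bump (fst z) \<partial>lborel)"
proof -
  have c [measurable]: "(\<lambda>z :: real \<times> real. fst z) \<in> borel_measurable borel"
    by (intro borel_measurable_continuous_onI continuous_intros)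
  define T :: "(real \<times> real) set" where "T = {1..2} \<times> {0..<2 * pi}"
  \<comment> \<open>On \<open>T'\<close> both factors of the integrand are at least $1/4$.\<close>
  define T' :: "(real \<times> real) set" where "T' = {5 / 4..7 / 4} \<times> {0..<2 * pi}"
  have T: "T \<in> sets borel" "T' \<in> sets borel" unfolding T_def T'_def by (intro borel_Times; simp)+
  have eI: "emeasure lborel ({x..y} \<times> {0..<2 * pi}) = ennreal ((y - x) * (2 * pi))" if "x \<le> y" for x y :: real
  proof -
    have "emeasure lborel ({x..y} \<times> {0..<2 * pi}) = emeasure lborel {x..y} * emeasure lborel {0..<2 * pi}"
      unfolding lborel_prod[symmetric] by (rule lborel.emeasure_pair_measure_Times) auto
    also have "\<dots> = ennreal (y - x) * ennreal (2 * pi)" using that by simp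
    also have "\<dots> = ennreal ((y - x) * (2 * pi))"
      using that by (intro ennreal_mult[symmetric]) auto
    finally show ?thesis .
  qed
  have eT: "emeasure lborel T = ennreal (2 * pi)" "emeasure lborel T' = ennreal pi"
    unfolding T_def T'_def by (subst eI, simp, simp)+
  have int: "integrable lborel (indicator T :: _ \<Rightarrow> real)" "integrable lborel (indicator T' :: _ \<Rightarrow> real)"
    using T eT by (intro integrable_real_indicator; simp)+
  have m: "(\<lambda>z. indicator half_strip z / (fst z)\<^sup>2 * bump (fst z)) \<in> borel_measurable borel"
    by measurable
  show 1: "integrable lborel (\<lambda>z. indicator half_strip z / (fst z)\<^sup>2 * bump (fst z))"
  proof (rule Bochner_Integration.integrable_bound[OF int(1)])
    show "AE z in lborel. norm (indicator half_strip z / (fst z)\<^sup>2 * bump (fst z)) \<le> norm (indicator T z :: real)"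
    proof (rule AE_I2)
      fix z :: "real \<times> real"
      show "norm (indicator half_strip z / (fst z)\<^sup>2 * bump (fst z)) \<le> norm (indicator T z :: real)"
      proof (cases "z \<in> T")
        case True
        then have "1 \<le> fst z" by (auto simp: T_def)
        then have "1 / (fst z)\<^sup>2 * bump (fst z) \<le> 1 * 1"
          by (intro mult_mono bump_bounds) auto
        then show ?thesis using True bump_bounds(1)[of "fst z"] by (auto simp: indicator_def abs_mult)
      next
        case False
        then have "z \<notin> half_strip \<or> bump (fst z) = 0"
          using bump_bounds(3)[of "fst z"] by (auto simp: T_def mem_Times_iff)
        then show ?thesis by auto
      qed
    qed
  qed (use m in simp)
  have "(\<integral>z. (1 / 16) * indicator T' z \<partial>lborel) \<le> (\<integral>z. indicator half_strip z / (fst z)\<^sup>2 * bump (fst z) \<partial>lborel)"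
  proof (intro integral_mono 1)
    fix z :: "real \<times> real"
    show "(1 / 16) * indicator T' z \<le> indicator half_strip z / (fst z)\<^sup>2 * bump (fst z)"
    proof (cases "z \<in> T'")
      case True
      then have z: "5 / 4 \<le> fst z" "fst z \<le> 7 / 4" "z \<in> half_strip" by (auto simp: T'_def)
      have "(fst z)\<^sup>2 \<le> 2\<^sup>2" using z by (intro power_mono) auto
      then have "1 / 4 \<le> 1 / (fst z)\<^sup>2" using z by (auto simp: field_simps)
      moreover have "1 / 4 \<le> bump (fst z)" using z by (auto simp: bump_def)
      ultimately have "(1 / 4) * (1 / 4) \<le> 1 / (fst z)\<^sup>2 * bump (fst z)" by (intro mult_mono) auto
      then show ?thesis using z(3) True by simp
    next
      case False
      then show ?thesis using bump_bounds(1) by simp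
    qed
  qed (use int(2) in simp)
  moreover have "(\<integral>z. (1 / 16) * indicator T' z \<partial>lborel) = (1 / 16) * pi"
    using T eT(2) by (simp add: measure_def)
  ultimately show "0 < (\<integral>z. indicator half_strip z / (fst z)\<^sup>2 * bump (fst z) \<partial>lborel)"
    using pi_gt_zero by linarith
qed

text \<open>The set $E$ on which $W(f,g)$ equals $\pi(f)$ and the symbol does not vanish.\<close>

definition probe_set :: "sim2 set" where
  "probe_set = unit_square \<times> {1..2} \<times> {0..<2 * pi}"

lemma emeasure_haar_probe_set:
  "probe_set \<in> sets haar" "emeasure haar probe_set < \<infinity>" "emeasure haar probe_set \<noteq> 0"
proof -
  have us: "unit_square \<in> sets borel" by measurable
  have E: "probe_set \<in> sets borel"
    unfolding probe_set_def using us by (intro borel_Times) auto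
  have sub: "probe_set \<subseteq> carrier SIM2" by (auto simp: probe_set_def SIM2_def)
  then have "probe_set = carrier SIM2 \<inter> probe_set" by blast
  then show E': "probe_set \<in> sets haar"
    unfolding sets_haar sets_restrict_space using E by blast
  have "unit_square \<subseteq> cball 0 2"
  proof
    fix b :: "real^2" assume "b \<in> unit_square"
    then show "b \<in> cball 0 2" using norm_le_l1_cart[of b] by (simp add: sum_2)
  qed
  then have "bounded unit_square" using bounded_cball bounded_subset by blast
  from emeasure_haar_box[OF this us, of 1 2]
  have fin: "emeasure haar ((unit_square \<times> {1..2} \<times> UNIV) \<inter> carrier SIM2) < \<infinity>" by simp
  have "(unit_square \<times> {1..2} \<times> UNIV) \<inter> carrier SIM2 = probe_set"
    by (auto simp: probe_set_def SIM2_def)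
  then show "emeasure haar probe_set < \<infinity>" using fin by simp
  have "emeasure haar probe_set = (\<integral>\<^sup>+z. indicator probe_set z \<partial>haar)" using E' by simp
  also have "\<dots> = (\<integral>\<^sup>+z. indicator (carrier SIM2) z * ennreal (1 / fst (snd z) ^ 3) * indicator probe_set z \<partial>lborel)"
    by (rule nn_integral_haar) (rule borel_measurable_indicator[OF E])
  also have "\<dots> \<ge> (\<integral>\<^sup>+z. ennreal (1 / 8) * indicator probe_set z \<partial>lborel)"
  proof (rule nn_integral_mono)
    fix z :: sim2
    show "ennreal (1 / 8) * indicator probe_set z \<le> indicator (carrier SIM2) z * ennreal (1 / fst (snd z) ^ 3) * indicator probe_set z"
    proof (cases "z \<in> probe_set")
      case True
      then have "1 \<le> fst (snd z)" "fst (snd z) \<le> 2" by (auto simp: probe_set_def)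
      then have "fst (snd z) ^ 3 \<le> 2 ^ 3" "0 < fst (snd z)"
        using power_mono[of "fst (snd z)" 2 3] by simp_all
      then have "1 / 8 \<le> 1 / fst (snd z) ^ 3" by (simp add: field_simps)
      then show ?thesis using True sub by (auto simp: ennreal_leI)
    qed simp
  qed
  also have "(\<integral>\<^sup>+z. ennreal (1 / 8) * indicator probe_set z \<partial>lborel) = ennreal (1 / 8) * emeasure lborel probe_set"
    using E by (intro nn_integral_cmult_indicator) simp
  also have "emeasure lborel probe_set = emeasure lborel unit_square * emeasure lborel ({1..2::real} \<times> {0..<2 * pi})"
    unfolding probe_set_def lborel_prod[symmetric, where 'a = "real^2"]
    using us by (intro lborel.emeasure_pair_measure_Times) (auto intro: borel_Times)
  also have "emeasure lborel ({1..2::real} \<times> {0..<2 * pi}) = ennreal (2 * pi)"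
    unfolding lborel_prod[symmetric] by (subst lborel.emeasure_pair_measure_Times) auto
  finally show "emeasure haar probe_set \<noteq> 0"
    by (auto simp: emeasure_unit_square)
qed

text \<open>The average over dilations and rotations by which $\pi(f)$ acts on \<open>shell q n\<close>.\<close>

definition radial_part :: "real \<Rightarrow> nat \<Rightarrow> real^2 \<Rightarrow> real" where
  "radial_part q n \<xi> = (\<integral>z. indicator half_strip z / (fst z)\<^sup>2 * bump (fst z)
      * (norm (act (fst z) (snd z) \<xi>) powr q * indicator (annulus n) (act (fst z) (snd z) \<xi>)) \<partial>lborel)"

abbreviation bump_mass :: real where
  "bump_mass \<equiv> (\<integral>z. indicator half_strip z / (fst z)\<^sup>2 * bump (fst z) \<partial>lborel)"

text \<open>If $2^n \le \|\xi\| \le 2^{n+1}$ and $1 \le a \le 2$, then $a R_{-\theta} \xi$ lies in the annulus, where the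
  weight is at least $2^{nq}$.\<close>

lemma radial_part_ge:
  assumes q: "0 \<le> q" and \<xi>: "2 ^ n \<le> norm \<xi>" "norm \<xi> \<le> 2 ^ (n + 1)"
  shows "bump_mass * (2 ^ n) powr q \<le> radial_part q n \<xi>"
proof -
  let ?J = "\<lambda>z. indicator half_strip z / (fst z)\<^sup>2 * bump (fst z)
      * (norm (act (fst z) (snd z) \<xi>) powr q * indicator (annulus n) (act (fst z) (snd z) \<xi>))"
  have c [measurable]: "(\<lambda>z :: real \<times> real. fst z) \<in> borel_measurable borel" "(\<lambda>z :: real \<times> real. snd z) \<in> borel_measurable borel"
    by (intro borel_measurable_continuous_onI continuous_intros)+
  have m: "?J \<in> borel_measurable borel" by measurable
  have J_le: "?J z \<le> (2 ^ (n + 2)) powr q * (indicator half_strip z / (fst z)\<^sup>2 * bump (fst z))" for z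
  proof -
    have "norm (act (fst z) (snd z) \<xi>) powr q * indicator (annulus n) (act (fst z) (snd z) \<xi>) \<le> (2 ^ (n + 2)) powr q"
      using q by (auto simp: indicator_def annulus_def intro!: powr_mono2)
    then show ?thesis
      by (subst mult.commute) (intro mult_right_mono mult_nonneg_nonneg bump_bounds, auto)
  qed
  have J_nonneg: "0 \<le> ?J z" for z
    by (intro mult_nonneg_nonneg bump_bounds) auto
  have int: "integrable lborel ?J"
  proof (rule Bochner_Integration.integrable_bound[OF integrable_mult_right[OF bump_mass_pos(1), of "(2 ^ (n + 2)) powr q"]])
    show "AE z in lborel. norm (?J z) \<le> norm ((2 ^ (n + 2)) powr q * (indicator half_strip z / (fst z)\<^sup>2 * bump (fst z)))"
      using J_le J_nonneg by (intro AE_I2) (smt (verit) real_norm_def)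
  qed (use m in simp)
  have "(\<integral>z. (indicator half_strip z / (fst z)\<^sup>2 * bump (fst z)) * (2 ^ n) powr q \<partial>lborel) \<le> (\<integral>z. ?J z \<partial>lborel)"
  proof (intro integral_mono int integrable_mult_left bump_mass_pos(1))
    fix z :: "real \<times> real"
    show "(indicator half_strip z / (fst z)\<^sup>2 * bump (fst z)) * (2 ^ n) powr q \<le> ?J z"
    proof (cases "bump (fst z) = 0")
      case False
      then have a: "1 \<le> fst z" "fst z \<le> 2" using bump_bounds(3)[of "fst z"] by auto
      have n: "norm (act (fst z) (snd z) \<xi>) = fst z * norm \<xi>" using a by (simp add: norm_act)
      have lo: "2 ^ n \<le> fst z * norm \<xi>" using mult_mono[of 1 "fst z" "2 ^ n" "norm \<xi>"] a \<xi> by simp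
      have "fst z * norm \<xi> \<le> 2 * 2 ^ (n + 1)" using a \<xi> by (intro mult_mono) auto
      then have "act (fst z) (snd z) \<xi> \<in> annulus n" using lo by (simp add: annulus_def n)
      moreover have "(2 ^ n) powr q \<le> (fst z * norm \<xi>) powr q" using lo q by (intro powr_mono2) auto
      ultimately show ?thesis
        using bump_bounds(1)[of "fst z"] by (simp add: n) (intro divide_right_mono mult_left_mono mult_nonneg_nonneg; simp)
    qed simp
  qed
  then show ?thesis unfolding radial_part_def integral_mult_left_zero .
qed

context
  fixes r :: real
  assumes r: "0 < r" "r < 1"
begin

abbreviation "\<alpha> \<equiv> fourier (lacunary r)"

lemma square_integrable_lacunary_hat: "square_integrable lborel \<alpha>"
proof -
  note S = square_integrable_bounded_supp[OF lacunary_measurable[OF r] norm_lacunary_le[OF r] lacunary_supp[OF r]]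
  have "sq_norm \<alpha> \<le> ennreal (4 * pi\<^sup>2) * sq_norm (lacunary r)"
    by (rule plancherel_le[OF S(2) lacunary_supp[OF r]])
  also have "\<dots> < \<infinity>" using square_integrable_finite[OF S(2)] by (simp add: ennreal_mult_less_top)
  finally have "sq_norm \<alpha> < \<infinity>" .
  moreover have "\<alpha> \<in> borel_measurable lborel"
    using fourier_measurable[OF lacunary_measurable[OF r]] by simp
  ultimately show ?thesis unfolding square_integrable_iff_nn_integral by blast
qed

lemma pi_fun_shell:
  assumes \<xi>: "\<xi> \<noteq> 0"
  shows "pi_fun (lift_amp (rough_amp r)) (shell q n) \<xi> = of_real (lacunary_hat r \<xi> * radial_part q n \<xi>)"
proof -
  have hat: "amp_hat (rough_amp r) \<xi> a = of_real (lacunary_hat r \<xi> * bump a)" for a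
  proof -
    have "amp_hat (rough_amp r) \<xi> a = (\<integral>b. of_real (bump a) * (lacunary r b * cis (- (b \<bullet> \<xi>))) \<partial>lborel)"
      by (simp add: amp_hat_def fourier_def rough_amp_def mult_ac)
    also have "\<dots> = of_real (bump a) * \<alpha> \<xi>"
      unfolding fourier_def by (rule integral_mult_right_zero)
    finally show ?thesis by (simp add: fourier_lacunary[OF r] mult_ac)
  qed
  have "pi_fun (lift_amp (rough_amp r)) (shell q n) \<xi>
      = (\<integral>z. of_real (lacunary_hat r \<xi> * (indicator half_strip z / (fst z)\<^sup>2 * bump (fst z)
      * (norm (act (fst z) (snd z) \<xi>) powr q * indicator (annulus n) (act (fst z) (snd z) \<xi>)))) \<partial>lborel)"
    unfolding pi_fun_lift_amp[OF amplitude_rough_amp[OF r] square_integrable_shell \<xi>] hat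
    by (intro Bochner_Integration.integral_cong) (auto simp: shell_def scaleR_conv_of_real mult_ac)
  also have "\<dots> = of_real (lacunary_hat r \<xi> * radial_part q n \<xi>)"
    unfolding integral_complex_of_real radial_part_def by (simp only: integral_mult_right_zero)
  finally show ?thesis .
qed

text \<open>The integrand is $\hat u(\xi)^2$ times the radial part, hence nonnegative, and on the unit square
  $[2^n, 2^n + 1] \times [0,1]$ both factors are large.\<close>

lemma cinner_pi_shell_ge:
  assumes q: "0 \<le> q" and n: "1 \<le> n"
  shows "(r ^ n / 4)\<^sup>2 * (bump_mass * (2 ^ n) powr q)
    \<le> cmod (cinner (pi_op (lift_amp (rough_amp r)) (abs_l2 (shell q n))) (abs_l2 \<alpha>))"
proof -
  note amp = amplitude_rough_amp[OF r]
  let ?h = "lift_amp (rough_amp r)" and ?c = "(r ^ n / 4)\<^sup>2 * (bump_mass * (2 ^ n) powr q)"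
  let ?Q = "{v :: real^2. v $ 1 \<in> {2 ^ n..2 ^ n + 1} \<and> v $ 2 \<in> {0..1}}"
  have sq: "square_integrable lborel (pi_fun ?h (shell q n))"
    by (rule square_integrable_pi_fun[OF lift_amp_borel[OF amp] integrable_lift_amp[OF amp] square_integrable_shell])
  have Q: "?Q \<in> sets borel" by measurable
  have eQ: "emeasure lborel ?Q = 1"
    using emeasure_vec2[of "{2 ^ n..2 ^ n + 1}" "{0..1}"] by simp
  have int: "integrable lborel (\<lambda>\<xi>. pi_fun ?h (shell q n) \<xi> * cnj (\<alpha> \<xi>))"
    by (rule square_integrable_mult_cnj[OF sq square_integrable_lacunary_hat])
  have "cinner (pi_op ?h (abs_l2 (shell q n))) (abs_l2 \<alpha>) = (\<integral>\<xi>. pi_fun ?h (shell q n) \<xi> * cnj (\<alpha> \<xi>) \<partial>lborel)"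
    unfolding pi_op_abs[OF lift_amp_borel[OF amp] integrable_lift_amp[OF amp] square_integrable_shell]
    by (rule cinner_abs[OF sq square_integrable_lacunary_hat])
  then have Re: "Re (cinner (pi_op ?h (abs_l2 (shell q n))) (abs_l2 \<alpha>)) = (\<integral>\<xi>. Re (pi_fun ?h (shell q n) \<xi> * cnj (\<alpha> \<xi>)) \<partial>lborel)"
    by (simp only: integral_Re[OF int])
  have "(\<integral>\<xi>. ?c * indicator ?Q \<xi> \<partial>lborel) \<le> (\<integral>\<xi>. Re (pi_fun ?h (shell q n) \<xi> * cnj (\<alpha> \<xi>)) \<partial>lborel)"
  proof (rule integral_mono_AE)
    show "integrable lborel (\<lambda>\<xi>. ?c * indicator ?Q \<xi>)"
      using Q eQ by (intro integrable_mult_right integrable_real_indicator) auto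
    show "integrable lborel (\<lambda>\<xi>. Re (pi_fun ?h (shell q n) \<xi> * cnj (\<alpha> \<xi>)))"
      by (rule integrable_Re[OF int])
    show "AE \<xi> in lborel. ?c * indicator ?Q \<xi> \<le> Re (pi_fun ?h (shell q n) \<xi> * cnj (\<alpha> \<xi>))"
    proof (rule AE_mp[OF AE_lborel_singleton[of 0]], rule AE_I2, rule impI)
      fix \<xi> :: "real^2" assume \<xi>: "\<xi> \<noteq> 0"
      have eq: "Re (pi_fun ?h (shell q n) \<xi> * cnj (\<alpha> \<xi>)) = (lacunary_hat r \<xi>)\<^sup>2 * radial_part q n \<xi>"
        unfolding pi_fun_shell[OF \<xi>] fourier_lacunary[OF r] by (simp add: power2_eq_square)
      show "?c * indicator ?Q \<xi> \<le> Re (pi_fun ?h (shell q n) \<xi> * cnj (\<alpha> \<xi>))"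
      proof (cases "\<xi> \<in> ?Q")
        case True
        have "2 ^ n \<le> norm \<xi>"
          using True component_le_norm_cart[of \<xi> 1] by (auto simp: abs_le_iff)
        \<comment> \<open>Here $1 \le n$ enters, through $2^n + 2 \le 2^{n+1}$.\<close>
        moreover have "norm \<xi> \<le> 2 ^ (n + 1)"
        proof -
          have "norm \<xi> \<le> \<bar>\<xi> $ 1\<bar> + \<bar>\<xi> $ 2\<bar>" using norm_le_l1_cart[of \<xi>] by (simp add: sum_2)
          also have "\<dots> \<le> (2 ^ n + 1) + 1"
          proof -
            have "2 ^ n \<le> \<xi> $ 1" "\<xi> $ 1 \<le> 2 ^ n + 1" "0 \<le> \<xi> $ 2" "\<xi> $ 2 \<le> 1" using True by auto
            then show ?thesis using zero_less_power[of "2 :: real" n] by linarith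
          qed
          also have "\<dots> \<le> 2 ^ (n + 1)" using power_increasing[OF n, of "2 :: real"] by simp
          finally show ?thesis .
        qed
        ultimately have R: "bump_mass * (2 ^ n) powr q \<le> radial_part q n \<xi>" by (rule radial_part_ge[OF q])
        have "r ^ n / 4 \<le> lacunary_hat r \<xi>" using True by (intro lacunary_hat_ge[OF r]) auto
        then have "?c \<le> (lacunary_hat r \<xi>)\<^sup>2 * radial_part q n \<xi>"
          using r bump_mass_pos(2) by (intro mult_mono R power_mono) auto
        then show ?thesis using True eq by simp
      next
        case False
        have "0 \<le> radial_part q n \<xi>"
          unfolding radial_part_def by (intro integral_nonneg_AE AE_I2 mult_nonneg_nonneg bump_bounds) auto
        then show ?thesis using False eq by simp
      qed
    qed
  qed
  moreover have "(\<integral>\<xi>. ?c * indicator ?Q \<xi> \<partial>lborel) = ?c"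
    using Q eQ by (simp add: measure_def)
  ultimately have "?c \<le> Re (cinner (pi_op ?h (abs_l2 (shell q n))) (abs_l2 \<alpha>))" by (simp only: Re)
  then show ?thesis using complex_Re_le_cmod order_trans by blast
qed

lemma norm_lacunary_hat_pos: "0 < norm (abs_l2 \<alpha>)"
proof (rule ccontr)
  assume "\<not> 0 < norm (abs_l2 \<alpha>)"
  then have "abs_l2 \<alpha> = 0" by simp
  then have "(r ^ 1 / 4)\<^sup>2 * (bump_mass * (2 ^ 1) powr 0) \<le> 0"
    using cinner_pi_shell_ge[of 0 1] by simp
  then show False using r bump_mass_pos(2) by (simp add: mult_le_0_iff)
qed

definition unit_hat :: l2 where
  "unit_hat = cscale (of_real (1 / norm (abs_l2 \<alpha>))) (abs_l2 \<alpha>)"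

lemma norm_unit_hat: "norm unit_hat = 1"
  using norm_lacunary_hat_pos by (simp add: unit_hat_def norm_cscale norm_divide)

lemma weyl_integrand_shell:
  assumes p: "2 < p" and x: "x \<in> probe_set"
  shows "weyl_integrand p (rank_one_symbol p probe_set unit_hat) (wigner_symbol r) x (abs_l2 (shell 0 n))
    = Some (proj unit_hat (pi_op (lift_amp (rough_amp r)) (abs_l2 (shell (2 * (1 - 1 / p)) n))))"
proof -
  let ?K = "abs_l2 (shell (2 * (1 - 1 / p)) n)"
  have xc: "x \<in> carrier SIM2" using x by (auto simp: probe_set_def SIM2_def)
  have "bounded_extension (rank_one_symbol p probe_set unit_hat x \<circ>\<^sub>m K_power (1 / p)) (proj unit_hat)"
    using bounded_extension_rank_one_symbol[of p probe_set unit_hat x] p x by simp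
  then have b: "bext (rank_one_symbol p probe_set unit_hat x \<circ>\<^sub>m K_power (1 / p)) = proj unit_hat"
    by (rule bextI)
  have adj: "cadjoint (proj unit_hat) = proj unit_hat"
    by (rule cadjointI) (rule proj_selfadj)
  have K: "K_power (1 - 1 / p) (abs_l2 (shell 0 n)) = Some ?K"
    using K_power_shell[of "1 - 1 / p" 0 n] by simp
  have d: "?K \<in> dom (K_power (- 1 / 2))"
    using K_power_shell[of "- 1 / 2"] by blast
  have "cut_amp r (fst x) (fst (snd x)) = rough_amp r"
    by (rule cut_amp_eq_rough_amp) (use x in \<open>auto simp: probe_set_def\<close>)
  then have W: "wigner_Cc (lift_amp (rough_amp r)) cutoff x = pi_op (lift_amp (rough_amp r))"
    using wigner_Cc_cut[OF r xc] by simp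
  show ?thesis
    unfolding weyl_integrand_def b adj
    using d by (simp add: map_comp_def K wigner_symbol_def[OF r] W total_op_def)
qed

text \<open>A bounded extension would grow at most like the norms $2^n$ of the annulus indicators.\<close>

lemma not_bounded_extension_weyl_integrand:
  assumes p: "2 < p" and growth: "1 < r\<^sup>2 * 2 powr (1 - 2 / p)" and x: "x \<in> probe_set"
  shows "\<not> bounded_extension (weyl_integrand p (rank_one_symbol p probe_set unit_hat) (wigner_symbol r) x) B"
proof
  let ?A = "weyl_integrand p (rank_one_symbol p probe_set unit_hat) (wigner_symbol r) x"
  define q where "q = 2 * (1 - 1 / p)"
  let ?W = "\<lambda>n. pi_op (lift_amp (rough_amp r)) (abs_l2 (shell q n))"
  assume B: "bounded_extension ?A B"
  have q: "0 \<le> q" using p by (simp add: q_def field_simps)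
  have lin: "bounded_linear B" using B by (simp add: bounded_extension_def bounded_clinear_def)
  have bound: "(r\<^sup>2 * 2 powr (1 - 2 / p)) ^ n \<le> 128 * norm (abs_l2 \<alpha>) * onorm B / bump_mass" if n: "1 \<le> n" for n
  proof -
    have A: "?A (abs_l2 (shell 0 n)) = Some (proj unit_hat (?W n))"
      unfolding q_def by (rule weyl_integrand_shell[OF p x])
    then have "abs_l2 (shell 0 n) \<in> dom ?A" by blast
    then have "?A (abs_l2 (shell 0 n)) = Some (B (abs_l2 (shell 0 n)))"
      using B by (auto simp: bounded_extension_def map_le_def total_op_def)
    with A have "B (abs_l2 (shell 0 n)) = proj unit_hat (?W n)" by simp
    then have "norm (proj unit_hat (?W n)) \<le> onorm B * norm (abs_l2 (shell 0 n))"
      using onorm[OF lin, of "abs_l2 (shell 0 n)"] by simp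
    also have "\<dots> \<le> onorm B * (8 * 2 ^ n)"
      by (intro mult_left_mono norm_shell_0 onorm_pos_le[OF lin])
    finally have "cmod (cinner (?W n) (abs_l2 \<alpha>)) / norm (abs_l2 \<alpha>) \<le> onorm B * (8 * 2 ^ n)"
      by (simp add: proj_def norm_cscale norm_unit_hat) (simp add: unit_hat_def cinner_cscale_right norm_mult norm_divide)
    then have "cmod (cinner (?W n) (abs_l2 \<alpha>)) \<le> norm (abs_l2 \<alpha>) * (onorm B * (8 * 2 ^ n))"
      using norm_lacunary_hat_pos by (simp add: field_simps)
    with cinner_pi_shell_ge[OF q n]
    have "(r ^ n / 4)\<^sup>2 * (bump_mass * (2 ^ n) powr q) \<le> norm (abs_l2 \<alpha>) * (onorm B * (8 * 2 ^ n))"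
      by (rule order_trans)
    moreover have "(2 ^ n) powr q = 2 ^ n * (2 powr (1 - 2 / p)) ^ n"
    proof -
      have "(2 ^ n) powr q = 2 powr (real n * q)"
        by (simp add: powr_realpow[symmetric] powr_powr)
      also have "real n * q = real n + real n * (1 - 2 / p)" by (simp add: q_def algebra_simps)
      also have "2 powr \<dots> = 2 ^ n * 2 powr ((1 - 2 / p) * real n)"
        by (simp add: powr_add powr_realpow mult.commute)
      also have "2 powr ((1 - 2 / p) * real n) = (2 powr (1 - 2 / p)) ^ n"
        by (simp add: powr_powr[symmetric] powr_realpow)
      finally show ?thesis .
    qed
    ultimately have "(bump_mass / 16 * (r\<^sup>2 * 2 powr (1 - 2 / p)) ^ n) * 2 ^ n \<le> (8 * norm (abs_l2 \<alpha>) * onorm B) * 2 ^ n"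
      by (simp add: power_mult_distrib power_divide power2_eq_square mult_ac)
    then have "bump_mass / 16 * (r\<^sup>2 * 2 powr (1 - 2 / p)) ^ n \<le> 8 * norm (abs_l2 \<alpha>) * onorm B"
      by (simp only: mult_le_cancel_right_pos zero_less_power zero_less_numeral)
    then show ?thesis using bump_mass_pos(2) by (simp add: field_simps)
  qed
  obtain n where n: "128 * norm (abs_l2 \<alpha>) * onorm B / bump_mass < (r\<^sup>2 * 2 powr (1 - 2 / p)) ^ n"
    using real_arch_pow[OF growth] by blast
  also have "\<dots> \<le> (r\<^sup>2 * 2 powr (1 - 2 / p)) ^ Suc n"
    using growth by (intro power_increasing) auto
  also have "\<dots> \<le> 128 * norm (abs_l2 \<alpha>) * onorm B / bump_mass"
    by (rule bound) simp
  finally show False by simp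
qed

end

theorem theorem3p3:
  fixes p :: real
  assumes "2 < p"
  shows "\<exists>\<sigma>\<in>Lp_symbols p. \<not> weyl_bounded p \<sigma>"
proof -
  define \<delta> where "\<delta> = 1 - 2 / p"
  have \<delta>: "0 < \<delta>" using assms by (simp add: \<delta>_def)
  \<comment> \<open>Every \<open>r < 1\<close> larger than $2^{-\delta/2}$ makes $r^2 2^\delta$ exceed $1$.\<close>
  define r :: real where "r = 2 powr (- \<delta> / 4)"
  have r: "0 < r" "r < 1"
    using \<delta> by (simp_all add: r_def powr_less_one)
  have "r\<^sup>2 * 2 powr \<delta> = 2 powr (\<delta> / 2)"
    by (simp add: r_def power2_eq_square powr_add[symmetric])
  then have growth: "1 < r\<^sup>2 * 2 powr (1 - 2 / p)"
    using powr_less_mono[of 0 "\<delta> / 2" 2] \<delta> by (simp add: \<delta>_def[symmetric])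
  let ?\<sigma> = "rank_one_symbol p probe_set (unit_hat r)"
  have "?\<sigma> \<in> Lp_symbols p"
    using assms by (intro rank_one_symbol_in_Lp norm_unit_hat[OF r] emeasure_haar_probe_set) simp
  moreover have "\<not> weyl_bounded p ?\<sigma>"
  proof
    assume "weyl_bounded p ?\<sigma>"
    then obtain z where "weyl_pairing p ?\<sigma> (wigner_symbol r) z"
      unfolding weyl_bounded_def
      using rough_in_L2[OF r] cutoff_in_L2 wigner_symbol_in_wigner[OF r] by blast
    then have "AE x in haar. schatten_pow 1 (weyl_integrand p ?\<sigma> (wigner_symbol r) x) < \<infinity>"
      unfolding weyl_pairing_def by auto
    then have "AE x in haar. x \<notin> probe_set"
    proof eventually_elim
      case (elim x)
      then have "\<exists>B. bounded_extension (weyl_integrand p ?\<sigma> (wigner_symbol r) x) B"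
        by (auto simp: schatten_pow_def split: if_splits)
      then show ?case
        using not_bounded_extension_weyl_integrand[OF r assms growth] by blast
    qed
    then have "emeasure haar probe_set = 0"
      using emeasure_haar_probe_set(1) by (subst (asm) AE_iff_measurable[of probe_set])
        (auto simp: space_haar probe_set_def SIM2_def)
    then show False using emeasure_haar_probe_set(3) by simp
  qed
  ultimately show ?thesis by blast
qed

end
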